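(* (i) There is an absolute constant $C<\infty$ such that, for every $N\ge2$ and every trigonometric polynomial $f$ on $\mathbb{T}^2$ with Fourier support in $\{n\in\mathbb{Z}^2:|n|\le2N\}$, $$\left\|\sup_{0<t<1}|e^{it\Delta}f|\right\|_{L^2(\mathbb{T}^2)}\le C\,N^{1/2}(\log(2+N))^{1/4}\|f\|_{L^2(\mathbb{T}^2)}.$$ (ii) There are a constant $c>0$ and an unbounded sequence of $N$ such that, for each $N$ in the sequence, the corresponding operator norm restricted to frequencies $N\le|n|\le2N$ is at least $cN^{1/2}$, both in $L^2$ and in weak $L^2$; that is, for both $X=L^2(\mathbb{T}^2)$ and $X=L^{2,\infty}(\mathbb{T}^2)$, $$\sup_{f}\frac{\left\|\sup_{0<t<1}|e^{it\Delta}f|\right\|_{X}}{\|f\|_{L^2(\mathbb{T}^2)}}\ge cN^{1/2},$$ where the supremum is over all nonzero trigonometric polynomials $f$ on $\mathbb{T}^2$ with Fourier support in $\{n\in\mathbb{Z}^2:N\le|n|\le2N\}$.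
   Context: $\mathbb{T}^2=(\mathbb{R}/2\pi\mathbb{Z})^2$ carries normalized Haar measure $(2\pi)^{-2}\,dx$; $|A|$ denotes the normalized measure of a set $A\subseteq\mathbb{T}^2$. Fourier coefficients are $\widehat f(n)=(2\pi)^{-2}\int_{[0,2\pi)^2}f(x)e^{-in\cdot x}\,dx$, $n\in\mathbb{Z}^2$; the Fourier support of $f$ is $\{n:\widehat f(n)\ne0\}$; $|n|$ is the Euclidean length. A trigonometric polynomial is a finite complex linear combination of the functions $x\mapsto e^{in\cdot x}$, and $e^{it\Delta}f(x)=\sum_{n}\widehat f(n)e^{i(n\cdot x-t|n|^2)}$. The weak $L^2$ norm is $\|g\|_{L^{2,\infty}(\mathbb{T}^2)}=\sup_{\lambda>0}\lambda\,|\{x\in\mathbb{T}^2:|g(x)|>\lambda\}|^{1/2}$. *)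

theory Defs
  imports "HOL-Analysis.Analysis"
begin

(* Functions on the torus are functions on the plane that are 2 pi - periodic in each
   coordinate; integration is over the fundamental domain [0, 2 pi)^2. *)

definition torus :: "(real \<times> real) measure" where
  "torus = uniform_measure lborel ({0..<2 * pi} \<times> {0..<2 * pi})"

definition freq :: "int \<times> int \<Rightarrow> real \<times> real" where
  "freq n = (real_of_int (fst n), real_of_int (snd n))"

definition trig_polynomial :: "(real \<times> real \<Rightarrow> complex) \<Rightarrow> bool" where
  "trig_polynomial f \<longleftrightarrow>
     (\<exists>S c. finite S \<and> f = (\<lambda>x. \<Sum>n\<in>S. c n * cis (freq n \<bullet> x)))"

definition fourier_coeff :: "(real \<times> real \<Rightarrow> complex) \<Rightarrow> int \<times> int \<Rightarrow> complex" where
  "fourier_coeff f n = (\<integral>x. f x * cis (- (freq n \<bullet> x)) \<partial>torus)"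

definition fourier_support :: "(real \<times> real \<Rightarrow> complex) \<Rightarrow> (int \<times> int) set" where
  "fourier_support f = {n. fourier_coeff f n \<noteq> 0}"

definition schroedinger :: "real \<Rightarrow> (real \<times> real \<Rightarrow> complex) \<Rightarrow> real \<times> real \<Rightarrow> complex" where
  "schroedinger t f x =
     (\<Sum>\<^sub>\<infinity>n\<in>UNIV. fourier_coeff f n * cis (freq n \<bullet> x - t * (norm (freq n))\<^sup>2))"

definition ennreal_sqrt :: "ennreal \<Rightarrow> ennreal" where
  "ennreal_sqrt a = (if a = \<infinity> then \<infinity> else ennreal (sqrt (enn2real a)))"

(* The norms below take the modulus of the function, with values in [0, \<infinity>], so that
   suprema and integrals need no boundedness or integrability side conditions. *)

definition modulus :: "(real \<times> real \<Rightarrow> complex) \<Rightarrow> real \<times> real \<Rightarrow> ennreal" where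
  "modulus f x = ennreal (cmod (f x))"

definition maximal_function :: "(real \<times> real \<Rightarrow> complex) \<Rightarrow> real \<times> real \<Rightarrow> ennreal" where
  "maximal_function f x = (SUP t\<in>{0<..<1}. modulus (schroedinger t f) x)"

definition L2_norm :: "(real \<times> real \<Rightarrow> ennreal) \<Rightarrow> ennreal" where
  "L2_norm g = ennreal_sqrt (\<integral>\<^sup>+x. (g x)\<^sup>2 \<partial>torus)"

definition weak_L2_norm :: "(real \<times> real \<Rightarrow> ennreal) \<Rightarrow> ennreal" where
  "weak_L2_norm g =
     (SUP s\<in>{0<..}. ennreal s * ennreal_sqrt (emeasure torus {x. g x > ennreal s}))"

definition trig_polys_on :: "(int \<times> int) set \<Rightarrow> (real \<times> real \<Rightarrow> complex) set" where
  "trig_polys_on A = {f. trig_polynomial f \<and> fourier_support f \<subseteq> A}"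

end

theory Submission
  imports Defs
begin

text \<open>
(i) Write \<open>u\<close> for the solution with Fourier coefficients \<open>c\<close>, supported in the disc of radius \<open>2 N\<close>. Its
square is a sum of at most \<open>9 N\<^sup>2\<close> time frequencies \<open>\<gamma> k x * cis (- k t)\<close>, so Cauchy--Schwarz bounds
\<open>\<bar>u\<bar> ^ 4\<close>, uniformly in \<open>t\<close>, by \<open>9 N\<^sup>2\<close> times the sum of the \<open>\<bar>\<gamma> k x\<bar>\<^sup>2\<close>. The integral of the latter over
the torus is at most the sum, over all lattice rectangles (degenerate ones included), of the product of
\<open>\<bar>c\<bar>\<close> at the four corners, and it remains to bound this energy by a multiple of \<open>log N\<close> times the fourth power of the norm of \<open>c\<close>. Decompose \<open>\<bar>c\<bar>\<close> dyadically by
rank. The number of rectangles with corners in four given level sets is controlled by the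
Szemeredi--Trotter theorem, applied to the lines carrying the sides, with a gain when the sizes of
the level sets are unbalanced. There are about \<open>log N\<close> levels, and a Schur test sums the contributions at the
cost of a single factor \<open>log N\<close>.

(ii) Let \<open>N = 4 j\<^sup>2 + 1\<close>, so \<open>(2 j)\<^sup>2 = - 1\<close> modulo \<open>N\<close>. On the set of frequencies with
\<open>n\<^sub>2 = 2 j n\<^sub>1 + 1\<close> modulo \<open>N\<close> the form \<open>\<bar>n\<bar>\<^sup>2\<close> is affine in \<open>n\<^sub>1\<close> modulo \<open>N\<close>. With about \<open>N / 2\<close> such
frequencies, one per column, at each time \<open>2 \<pi> a / N\<close> there are \<open>N\<close> squares of side comparable to \<open>1 / N\<close>
on which all phases agree; as \<open>a\<close> varies these squares are disjoint and fill a fixed proportion of the torus.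
\<close>

section \<open>Plane straight-line graphs\<close>

text \<open>The square of the solution is used because two pairs of frequencies with the same sum
  and the same sum of squared lengths are the two diagonals of a rectangle, possibly degenerate;
  this turns the energy into a problem of incidence geometry. The loss of \<open>9 N\<^sup>2\<close>
  becomes \<open>N powr (1/2)\<close>, up to a constant, under the fourth root, so the remaining
  task is to lose only one logarithm. For corner sets of equal size the rectangle bound already
  contains a factor of the number of levels, and the summation over quadruples of levels must not
  create a second one. Hence the form of the bound: the term with that factor decays as soon as any
  corner set is smaller than the largest, while each other term decays along one linear relation
  between the four levels, which costs one factor of the number of levels in the Schur test. In (ii)
  the shift by 1 is essential: on n2 = 2 j n1 modulo N the form vanishes modulo N, so the phases at
  the times 2 pi a / N would not depend on a and the squares would not move.\<close>

definition slope :: "(real \<times> real) \<times> (real \<times> real) \<Rightarrow> real" where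
  "slope e = (snd (snd e) - snd (fst e)) / (fst (snd e) - fst (fst e))"

definition height :: "(real \<times> real) \<times> (real \<times> real) \<Rightarrow> real \<Rightarrow> real" where
  "height e x = snd (fst e) + slope e * (x - fst (fst e))"

lemma height_left [simp]: "height e (fst (fst e)) = snd (fst e)"
  by (simp add: height_def)

lemma height_right: "fst (fst e) < fst (snd e) \<Longrightarrow> height e (fst (snd e)) = snd (snd e)"
  by (simp add: height_def slope_def)

lemma height_right_form:
  "fst (fst e) < fst (snd e) \<Longrightarrow> height e x = snd (snd e) - slope e * (fst (snd e) - x)"
  by (simp add: height_def slope_def field_simps)

text \<open>A negative value at \<open>x\<close> would force the zero \<open>- k / m\<close>
  strictly between \<open>x\<close> and \<open>x0\<close>, hence into the open interval.\<close>

lemma affine_sign: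
  fixes m k :: real
  assumes "\<And>x. l < x \<Longrightarrow> x < r \<Longrightarrow> m * x + k \<noteq> 0"
    and "l < x0" "x0 < r" "m * x0 + k > 0" "l \<le> x" "x \<le> r"
  shows "m * x + k \<ge> 0"
proof (rule ccontr)
  assume neg: "\<not> m * x + k \<ge> 0"
  define z where "z = - k / m"
  have m: "m \<noteq> 0" using neg assms by auto
  have mz: "m * z + k = 0" using m by (simp add: z_def)
  have "l < z \<and> z < r"
  proof (cases "m > 0")
    case True
    have "m * x < m * z" "m * z < m * x0" using mz neg assms by linarith+
    then have "x < z" "z < x0" using True by simp_all
    then show ?thesis using assms by linarith
  next
    case False
    then have "m < 0" using m by linarith
    have "m * x < m * z" "m * z < m * x0" using mz neg assms by linarith+
    then have "x > z" "z > x0" using \<open>m < 0\<close> by simp_all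
    then show ?thesis using assms by linarith
  qed
  then show False using assms(1) mz by blast
qed

text \<open>Distinct abscissas of the vertices make every edge the graph of an affine function over
  an interval, so planarity is exploited through the vertical order of the edges alone, without
  Euler's formula or the Jordan curve theorem.\<close>

locale plane_graph =
  fixes W :: "(real \<times> real) set" and G :: "((real \<times> real) \<times> (real \<times> real)) set"
  assumes finW: "finite W" and inj: "inj_on fst W" and GW: "G \<subseteq> W \<times> W"
    and lr: "\<And>e. e \<in> G \<Longrightarrow> fst (fst e) < fst (snd e)"
    and no_vertex: "\<And>e w. e \<in> G \<Longrightarrow> w \<in> W \<Longrightarrow> fst (fst e) < fst w \<Longrightarrow> fst w < fst (snd e)
                      \<Longrightarrow> height e (fst w) \<noteq> snd w"
    and no_cross: "\<And>e e' x. e \<in> G \<Longrightarrow> e' \<in> G \<Longrightarrow> e \<noteq> e' \<Longrightarrow> fst (fst e) < x \<Longrightarrow> x < fst (snd e)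
                      \<Longrightarrow> fst (fst e') < x \<Longrightarrow> x < fst (snd e') \<Longrightarrow> height e x \<noteq> height e' x"
begin

lemma finG: "finite G"
  using GW finW finite_subset by blast

text \<open>The difference of the two heights is affine without zeros over the open common range, so
  its sign at \<open>x0\<close> persists up to the ends, where the edges may touch.\<close>

lemma order_preserved:
  assumes "e \<in> G" "e' \<in> G"
    and x0: "fst (fst e) < x0" "x0 < fst (snd e)" "fst (fst e') < x0" "x0 < fst (snd e')"
    and less: "height e x0 < height e' x0"
    and x: "fst (fst e) \<le> x" "x \<le> fst (snd e)" "fst (fst e') \<le> x" "x \<le> fst (snd e')"
  shows "height e x \<le> height e' x"
proof -
  define m where "m = slope e' - slope e"
  define k where "k = snd (fst e') - slope e' * fst (fst e') - snd (fst e) + slope e * fst (fst e)"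
  have d: "height e' y - height e y = m * y + k" for y
    by (simp add: height_def m_def k_def algebra_simps)
  have ne: "e \<noteq> e'" using less by auto
  have "m * x + k \<ge> 0"
  proof (rule affine_sign[where l = "max (fst (fst e)) (fst (fst e'))"
        and r = "min (fst (snd e)) (fst (snd e'))" and ?x0.0 = x0])
    show "m * y + k \<noteq> 0" if "max (fst (fst e)) (fst (fst e')) < y"
      "y < min (fst (snd e)) (fst (snd e'))" for y
      using no_cross[OF assms(1,2) ne, of y] that d[of y] by auto
  qed (use x0 x less d[of x0] in auto)
  then show ?thesis using d[of x] by linarith
qed

lemma left_unique:
  assumes "e \<in> G" "e' \<in> G" "fst e = fst e'" "slope e = slope e'"
  shows "e = e'"
proof (rule ccontr)
  assume ne: "e \<noteq> e'"
  obtain x where x: "fst (fst e) < x" "x < min (fst (snd e)) (fst (snd e'))"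
    using dense[of "fst (fst e)" "min (fst (snd e)) (fst (snd e'))"] lr[OF assms(1)] lr[OF assms(2)] assms
    by auto
  show False using no_cross[OF assms(1,2) ne, of x] x assms by (auto simp: height_def)
qed

lemma right_unique:
  assumes "e \<in> G" "e' \<in> G" "snd e = snd e'" "slope e = slope e'"
  shows "e = e'"
proof (rule ccontr)
  assume ne: "e \<noteq> e'"
  obtain x where x: "max (fst (fst e)) (fst (fst e')) < x" "x < fst (snd e)"
    using dense[of "max (fst (fst e)) (fst (fst e'))" "fst (snd e)"] lr[OF assms(1)] lr[OF assms(2)] assms
    by auto
  show False using no_cross[OF assms(1,2) ne, of x] x assms
    height_right_form[OF lr[OF assms(1)]] height_right_form[OF lr[OF assms(2)]] by auto
qed

section \<open>Wedges between neighbouring edges at a common left end\<close>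

definition steeper where "steeper e = {e' \<in> G. fst e' = fst e \<and> slope e < slope e'}"
definition succ where "succ e = arg_min_on slope (steeper e)"

lemma succ:
  assumes "steeper e \<noteq> {}"
  shows "succ e \<in> G" "fst (succ e) = fst e" "slope e < slope (succ e)"
    "\<And>e'. e' \<in> G \<Longrightarrow> fst e' = fst e \<Longrightarrow> slope e < slope e' \<Longrightarrow> slope (succ e) \<le> slope e'"
proof -
  have "finite (steeper e)" using finG by (simp add: steeper_def)
  from arg_min_if_finite[OF this assms, of slope]
  have *: "succ e \<in> steeper e" "\<And>e'. e' \<in> steeper e \<Longrightarrow> slope (succ e) \<le> slope e'"
    unfolding succ_def by (auto simp: not_less)
  then show "succ e \<in> G" "fst (succ e) = fst e" "slope e < slope (succ e)"
    "\<And>e'. e' \<in> G \<Longrightarrow> fst e' = fst e \<Longrightarrow> slope e < slope e' \<Longrightarrow> slope (succ e) \<le> slope e'"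
    by (auto simp: steeper_def)
qed

definition wedge where
  "wedge e = {z \<in> W. fst (fst e) < fst z \<and> fst z < fst (snd e) \<and> fst z < fst (snd (succ e))
                \<and> height e (fst z) < snd z \<and> snd z < height (succ e) (fst z)}"

definition apex where "apex e = arg_min_on fst (wedge e)"

lemma apex:
  assumes "wedge e \<noteq> {}"
  shows "apex e \<in> wedge e" "\<And>z. z \<in> wedge e \<Longrightarrow> fst (apex e) \<le> fst z"
proof -
  have "finite (wedge e)" using finW by (simp add: wedge_def)
  from arg_min_if_finite[OF this assms, of fst]
  show "apex e \<in> wedge e" "\<And>z. z \<in> wedge e \<Longrightarrow> fst (apex e) \<le> fst z"
    unfolding apex_def by (auto simp: not_less)
qed

lemma succ_above:
  assumes "e \<in> G" "steeper e \<noteq> {}" "fst (fst e) < x"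
  shows "height e x < height (succ e) x"
  using succ[OF assms(2)] assms(3) by (simp add: height_def)

text \<open>An edge leaving the wedge between \<open>e\<close> and \<open>succ e\<close> to the left would have to end at or
  pass through its tip, so it starts inside the wedge.\<close>

lemma starts_in_wedge:
  assumes e: "e \<in> G" and ne: "steeper e \<noteq> {}" and g: "g \<in> G"
    and x0: "fst (fst e) < x0" "x0 < fst (snd e)" "x0 < fst (snd (succ e))"
      "fst (fst g) < x0" "x0 < fst (snd g)"
    and between: "height e x0 < height g x0" "height g x0 < height (succ e) x0"
  shows "fst g \<in> wedge e"
proof -
  note s = succ[OF ne]
  let ?u = "fst e"
  have gW: "fst g \<in> W" "?u \<in> W" using GW g e by auto
  have s0: "fst (fst (succ e)) < x0" using s x0 by simp
  show ?thesis
  proof (cases "fst (fst e) < fst (fst g)")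
    case True
    have 1: "height e (fst (fst g)) \<le> height g (fst (fst g))"
      by (rule order_preserved[OF e g x0(1,2,4,5) between(1)]) (use True x0 lr[OF g] in auto)
    have 2: "height g (fst (fst g)) \<le> height (succ e) (fst (fst g))"
      by (rule order_preserved[OF g s(1) x0(4,5) s0 x0(3) between(2)]) (use True x0 s lr[OF g] in auto)
    have "height e (fst (fst g)) \<noteq> snd (fst g)"
      by (rule no_vertex[OF e gW(1)]) (use True x0 in auto)
    moreover have "height (succ e) (fst (fst g)) \<noteq> snd (fst g)"
      by (rule no_vertex[OF s(1) gW(1)]) (use True x0 s in auto)
    ultimately show ?thesis using 1 2 True x0 gW by (auto simp: wedge_def)
  next
    case False
    have 1: "height e (fst ?u) \<le> height g (fst ?u)"
      by (rule order_preserved[OF e g x0(1,2,4,5) between(1)]) (use False x0 lr[OF e] in auto)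
    have 2: "height g (fst ?u) \<le> height (succ e) (fst ?u)"
      by (rule order_preserved[OF g s(1) x0(4,5) s0 x0(3) between(2)]) (use False x0 s lr[OF e] in auto)
    have eq: "height g (fst ?u) = snd ?u" using 1 2 s(2) height_left[of e] height_left[of "succ e"] by simp
    have nlt: "\<not> fst (fst g) < fst ?u" using no_vertex[OF g gW(2)] eq x0 by auto
    then have "fst g = ?u" using False gW inj by (auto simp: inj_on_def)
    then have "slope e < slope g" "slope g < slope (succ e)"
      using between s x0 by (auto simp: height_def)
    then show ?thesis using s(4)[OF g \<open>fst g = ?u\<close>] by simp
  qed
qed

text \<open>Of two edges with the same right end, the one of smaller slope arrives from above. Hence
  whichever of \<open>e\<close> and \<open>succ e\<close> ends first is met at its end by an edge,
  \<open>g\<close> or \<open>h\<close>, that comes from inside the wedge and so must start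
  there.\<close>

lemma wedge_nonempty:
  assumes e: "e \<in> G" and ne: "steeper e \<noteq> {}"
    and g: "g \<in> G" "snd g = snd e" "slope g < slope e"
    and h: "h \<in> G" "snd h = snd (succ e)" "slope (succ e) < slope h"
  shows "wedge e \<noteq> {}"
proof (cases "fst (snd e) \<le> fst (snd (succ e))")
  case True
  note s = succ[OF ne]
  have lt: "fst (snd e) < fst (snd (succ e))"
  proof (rule ccontr)
    assume "\<not> ?thesis"
    then have "fst (snd e) = fst (snd (succ e))" using True by simp
    moreover have "snd e \<in> W" "snd (succ e) \<in> W" using GW e s(1) by auto
    ultimately have "snd e = snd (succ e)" using inj by (auto simp: inj_on_def)
    then show False using s by (simp add: slope_def)
  qed
  have above: "height e (fst (snd e)) < height (succ e) (fst (snd e))"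
    using succ_above[OF e ne lr[OF e]] .
  \<comment> \<open>\<open>x0\<close> just left of the right end of \<open>e\<close>, where \<open>g\<close> is still below \<open>succ e\<close>\<close>
  have "((\<lambda>x. height (succ e) x - height g x) \<longlongrightarrow> height (succ e) (fst (snd e)) - height g (fst (snd e)))
          (at_left (fst (snd e)))"
    unfolding height_def by (intro tendsto_intros)
  moreover have "height g (fst (snd e)) = height e (fst (snd e))"
    using height_right[OF lr[OF e]] height_right[OF lr[OF g(1)]] g(2) by simp
  ultimately have ev: "eventually (\<lambda>x. 0 < height (succ e) x - height g x) (at_left (fst (snd e)))"
    using above by (elim order_tendstoD(1)) simp
  have ev2: "eventually (\<lambda>x. x \<in> {max (fst (fst e)) (fst (fst g))<..<fst (snd e)}) (at_left (fst (snd e)))"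
    using lr[OF e] lr[OF g(1)] g(2) by (intro eventually_at_left_real) auto
  obtain x0 where x0: "height g x0 < height (succ e) x0" "fst (fst e) < x0" "fst (fst g) < x0"
     "x0 < fst (snd e)"
    using eventually_happens[OF eventually_conj[OF ev ev2]] by (auto simp: trivial_limit_at_left_real)
  have "slope g * (fst (snd e) - x0) < slope e * (fst (snd e) - x0)"
    by (rule mult_strict_right_mono) (use g x0 in auto)
  then have "height e x0 < height g x0"
    using g(2) height_right_form[OF lr[OF e], of x0] height_right_form[OF lr[OF g(1)], of x0] by simp
  then show ?thesis
    using starts_in_wedge[OF e ne g(1), of x0] x0 lt g(2) by auto
next
  case False
  note s = succ[OF ne]
  define x1 where "x1 = fst (snd (succ e))"
  have lrs: "fst (fst e) < x1" using lr[OF s(1)] s(2) by (simp add: x1_def)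
  have above: "height e x1 < height (succ e) x1"
    using succ_above[OF e ne lrs] .
  have "((\<lambda>x. height h x - height e x) \<longlongrightarrow> height h x1 - height e x1) (at_left x1)"
    unfolding height_def by (intro tendsto_intros)
  moreover have "height h x1 = height (succ e) x1"
    using height_right[OF lr[OF s(1)]] height_right[OF lr[OF h(1)]] h(2) by (simp add: x1_def)
  ultimately have ev: "eventually (\<lambda>x. 0 < height h x - height e x) (at_left x1)"
    using above by (elim order_tendstoD(1)) simp
  have ev2: "eventually (\<lambda>x. x \<in> {max (fst (fst e)) (fst (fst h))<..<x1}) (at_left x1)"
    using lrs lr[OF h(1)] h(2) by (intro eventually_at_left_real) (auto simp: x1_def)
  obtain x0 where x0: "height e x0 < height h x0" "fst (fst e) < x0" "fst (fst h) < x0" "x0 < x1"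
    using eventually_happens[OF eventually_conj[OF ev ev2]] by (auto simp: trivial_limit_at_left_real)
  have "slope (succ e) * (x1 - x0) < slope h * (x1 - x0)"
    by (rule mult_strict_right_mono) (use h x0 in auto)
  then have "height h x0 < height (succ e) x0"
    using h(2) height_right_form[OF lr[OF s(1)], of x0] height_right_form[OF lr[OF h(1)], of x0]
    by (simp add: x1_def)
  then show ?thesis
    using starts_in_wedge[OF e ne h(1), of x0] x0 False h(2) by (auto simp: x1_def)
qed

text \<open>If \<open>e1\<close> ran below \<open>e2\<close> at the common apex, \<open>e2\<close>
  would run there between \<open>e1\<close> and \<open>succ e1\<close>, so it would start in the
  wedge of \<open>e1\<close>, strictly to the left of the leftmost vertex. Applied in both orders,
  together with \<open>no_cross\<close>, this makes \<open>apex\<close> injective.\<close>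

lemma apex_inj:
  assumes e: "e1 \<in> G" "e2 \<in> G" and ne: "steeper e1 \<noteq> {}" "steeper e2 \<noteq> {}"
    and w: "wedge e1 \<noteq> {}" "wedge e2 \<noteq> {}" and eq: "apex e1 = apex e2"
  shows "\<not> height e1 (fst (apex e1)) < height e2 (fst (apex e1))"
proof
  assume lt: "height e1 (fst (apex e1)) < height e2 (fst (apex e1))"
  let ?x = "fst (apex e1)"
  have a: "apex e1 \<in> wedge e1" "apex e1 \<in> wedge e2" using apex[OF w(1)] apex[OF w(2)] eq by auto
  have "fst e2 \<in> wedge e1"
    by (rule starts_in_wedge[OF e(1) ne(1) e(2), of ?x]) (use a lt in \<open>auto simp: wedge_def\<close>)
  then have "?x \<le> fst (fst e2)" using apex(2)[OF w(1)] by blast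
  then show False using a by (auto simp: wedge_def)
qed

text \<open>An edge is charged to its left end if it is the steepest edge there, to its right end if it
  is the uppermost edge arriving there, to the right end of the next steeper edge if the latter is the
  lowest one arriving there, and otherwise to the leftmost vertex between these two edges.\<close>

theorem card_edges_le: "card G \<le> 4 * card W"
proof -
  define G1 where "G1 = {e \<in> G. steeper e = {}}"
  define G2 where "G2 = {e \<in> G. \<forall>g \<in> G. snd g = snd e \<longrightarrow> slope e \<le> slope g}"
  define G3 where "G3 = {e \<in> G. steeper e \<noteq> {} \<and> (\<forall>h \<in> G. snd h = snd (succ e) \<longrightarrow> slope h \<le> slope (succ e))}"
  define G4 where "G4 = {e \<in> G. steeper e \<noteq> {} \<and> wedge e \<noteq> {}}"
  have sub: "G \<subseteq> G1 \<union> G2 \<union> G3 \<union> G4"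
  proof
    fix e assume e: "e \<in> G"
    show "e \<in> G1 \<union> G2 \<union> G3 \<union> G4"
    proof (rule ccontr)
      assume n: "e \<notin> G1 \<union> G2 \<union> G3 \<union> G4"
      then have ne: "steeper e \<noteq> {}" using e by (auto simp: G1_def)
      from n e ne obtain g h where "g \<in> G" "snd g = snd e" "slope g < slope e"
        "h \<in> G" "snd h = snd (succ e)" "slope (succ e) < slope h"
        by (auto simp: G2_def G3_def not_le)
      then show False using wedge_nonempty[OF e ne] n e ne by (auto simp: G4_def)
    qed
  qed
  have 1: "card G1 \<le> card W"
  proof (rule card_inj_on_le[of fst])
    show "inj_on fst G1"
    proof (rule inj_onI)
      fix e e' assume "e \<in> G1" "e' \<in> G1" "fst e = fst e'"
      then have "e' \<in> G" "e' \<notin> steeper e" "e \<in> G" "e \<notin> steeper e'" by (auto simp: G1_def)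
      then have "slope e = slope e'" using \<open>fst e = fst e'\<close> by (simp add: steeper_def)
      then show "e = e'" using left_unique \<open>e \<in> G1\<close> \<open>e' \<in> G1\<close> \<open>fst e = fst e'\<close> by (auto simp: G1_def)
    qed
    show "fst ` G1 \<subseteq> W" using GW by (auto simp: G1_def)
  qed (rule finW)
  have 2: "card G2 \<le> card W"
  proof (rule card_inj_on_le[of snd])
    show "inj_on snd G2"
    proof (rule inj_onI)
      fix e e' assume "e \<in> G2" "e' \<in> G2" "snd e = snd e'"
      then have "slope e \<le> slope e'" "slope e' \<le> slope e" by (auto simp: G2_def)
      then have "slope e = slope e'" by simp
      then show "e = e'" using right_unique \<open>e \<in> G2\<close> \<open>e' \<in> G2\<close> \<open>snd e = snd e'\<close> by (auto simp: G2_def)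
    qed
    show "snd ` G2 \<subseteq> W" using GW by (auto simp: G2_def)
  qed (rule finW)
  have 3: "card G3 \<le> card W"
  proof (rule card_inj_on_le[of "\<lambda>e. snd (succ e)"])
    show "inj_on (\<lambda>e. snd (succ e)) G3"
    proof (rule inj_onI)
      fix e e' assume G: "e \<in> G3" "e' \<in> G3" and eq: "snd (succ e) = snd (succ e')"
      have s: "steeper e \<noteq> {}" "steeper e' \<noteq> {}" and eG: "e \<in> G" "e' \<in> G" using G by (auto simp: G3_def)
      have "slope (succ e) \<le> slope (succ e')" "slope (succ e') \<le> slope (succ e)"
        using G eq succ(1)[OF s(1)] succ(1)[OF s(2)] by (auto simp: G3_def)
      then have se: "succ e = succ e'"
        using right_unique[OF succ(1)[OF s(1)] succ(1)[OF s(2)] eq] by simp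
      have f: "fst e = fst e'" using succ(2)[OF s(1)] succ(2)[OF s(2)] se by simp
      have "\<not> slope e < slope e'"
        using succ(4)[OF s(1) eG(2) f[symmetric]] succ(3)[OF s(2)] se by auto
      moreover have "\<not> slope e' < slope e"
        using succ(4)[OF s(2) eG(1) f] succ(3)[OF s(1)] se by auto
      ultimately show "e = e'" using left_unique[OF eG f] by simp
    qed
    show "(\<lambda>e. snd (succ e)) ` G3 \<subseteq> W" 
    proof (rule image_subsetI)
      fix e assume "e \<in> G3"
      then have "succ e \<in> G" using succ(1) by (auto simp: G3_def)
      then show "snd (succ e) \<in> W" using GW by auto
    qed
  qed (rule finW)
  have 4: "card G4 \<le> card W"
  proof (rule card_inj_on_le[of apex])
    show "inj_on apex G4"
    proof (rule inj_onI)
      fix e e' assume G: "e \<in> G4" "e' \<in> G4" and eq: "apex e = apex e'"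
      show "e = e'"
      proof (rule ccontr)
        assume ne: "e \<noteq> e'"
        have a: "apex e \<in> wedge e" "apex e \<in> wedge e'"
          using apex(1)[of e] apex(1)[of e'] G eq by (auto simp: G4_def)
        have "height e (fst (apex e)) \<noteq> height e' (fst (apex e))"
          by (rule no_cross) (use G ne a in \<open>auto simp: G4_def wedge_def\<close>)
        then show False using apex_inj[of e e'] apex_inj[of e' e] G eq by (auto simp: G4_def)
      qed
    qed
    show "apex ` G4 \<subseteq> W"
    proof (rule image_subsetI)
      fix e assume "e \<in> G4"
      then have "apex e \<in> wedge e" using apex(1) by (auto simp: G4_def)
      then show "apex e \<in> W" by (auto simp: wedge_def)
    qed
  qed (rule finW)
  have fin: "finite (G1 \<union> G2 \<union> G3 \<union> G4)" using finG by (auto simp: G1_def G2_def G3_def G4_def)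
  have "card G \<le> card (G1 \<union> G2 \<union> G3 \<union> G4)" by (rule card_mono[OF fin sub])
  also have "\<dots> \<le> card G1 + card G2 + card G3 + card G4"
    using card_Un_le[of "G1 \<union> G2 \<union> G3" G4] card_Un_le[of "G1 \<union> G2" G3] card_Un_le[of G1 G2] by linarith
  finally show ?thesis using 1 2 3 4 by linarith
qed

end

section \<open>The Szemeredi--Trotter theorem\<close>

text \<open>The probability that a random subset, keeping each point with probability
  \<open>p\<close>, contains \<open>F\<close>. It comes from expanding the product of the factors
  \<open>p + (1 - p)\<close> with the second summand erased over \<open>F\<close>.\<close>

lemma sum_binomial_weights:
  fixes p :: real
  assumes "finite P" "F \<subseteq> P"
  shows "(\<Sum>W\<in>Pow P. if F \<subseteq> W then p ^ card W * (1 - p) ^ card (P - W) else 0) = p ^ card F"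
proof -
  let ?g = "\<lambda>i. if i \<in> F then 0 else 1 - p"
  have "(\<Prod>i\<in>P. p + ?g i) = (\<Prod>i\<in>P. if i \<in> F then p else 1)" by (rule prod.cong) auto
  also have "\<dots> = (\<Prod>i\<in>{i\<in>P. i \<in> F}. p)"
    using prod.inter_filter[OF assms(1), of "\<lambda>_. p" "\<lambda>i. i \<in> F"] by simp
  also have "{i\<in>P. i \<in> F} = F" using assms by auto
  also have "(\<Prod>i\<in>F. p) = p ^ card F" by simp
  finally have 1: "(\<Prod>i\<in>P. p + ?g i) = p ^ card F" .
  have 2: "(\<Prod>i\<in>W. p) * (\<Prod>i\<in>P - W. ?g i) = (if F \<subseteq> W then p ^ card W * (1 - p) ^ card (P - W) else 0)"
    if "W \<in> Pow P" for W
  proof (cases "F \<subseteq> W")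
    case True
    then have "(\<Prod>i\<in>P - W. ?g i) = (\<Prod>i\<in>P - W. 1 - p)" by (intro prod.cong) auto
    then show ?thesis using True by simp
  next
    case False
    then obtain i where "i \<in> F" "i \<notin> W" by blast
    then have "(\<Prod>i\<in>P - W. ?g i) = 0" using assms by (intro prod_zero) auto
    then show ?thesis using False by simp
  qed
  show ?thesis using prod_add[OF assms(1), of "\<lambda>_. p" ?g] 1 2 by simp
qed

text \<open>A line is encoded by slope and intercept. This omits vertical lines, but among points
  with distinct abscissas these carry at most one point.\<close>

definition on_line :: "real \<times> real \<Rightarrow> real \<times> real \<Rightarrow> bool" where
  "on_line l p \<longleftrightarrow> snd p = fst l * fst p + snd l"

text \<open>The edges of Szekely's drawing: each line contributes the segments between its
  neighbouring points.\<close>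

definition consecutive where
  "consecutive P l = {(p, q). p \<in> P \<and> q \<in> P \<and> on_line l p \<and> on_line l q \<and> fst p < fst q \<and>
     \<not> (\<exists>r\<in>P. on_line l r \<and> fst p < fst r \<and> fst r < fst q)}"

lemma consecutive_height:
  assumes "e \<in> consecutive P l"
  shows "height e x = fst l * x + snd l"
proof -
  obtain p q where e: "e = (p, q)" by (metis surj_pair)
  have "slope e = fst l"
    using assms by (auto simp: consecutive_def on_line_def slope_def field_simps e)
  then show ?thesis using assms by (auto simp: consecutive_def on_line_def height_def e algebra_simps)
qed

lemma finite_consecutive: "finite P \<Longrightarrow> finite (consecutive P l)"
  by (rule finite_subset[of _ "P \<times> P"]) (auto simp: consecutive_def)

text \<open>Every point on the line except the rightmost one is the left end of an edge.\<close>

lemma card_consecutive: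
  assumes "finite P" "inj_on fst P"
  shows "card {p \<in> P. on_line l p} \<le> Suc (card (consecutive P l))"
proof (cases "{p \<in> P. on_line l p} = {}")
  case True
  then show ?thesis by (simp only: card.empty)
next
  case False
  let ?Q = "{p \<in> P. on_line l p}"
  have fin: "finite ?Q" using assms by simp
  define z where "z = arg_min_on (\<lambda>p. - fst p) ?Q"
  have z: "z \<in> ?Q" "\<And>p. p \<in> ?Q \<Longrightarrow> fst p \<le> fst z"
    using arg_min_if_finite[OF fin False, of "\<lambda>p. - fst p"] by (auto simp: z_def not_less)
  have "?Q - {z} \<subseteq> fst ` consecutive P l"
  proof
    fix p assume p: "p \<in> ?Q - {z}"
    let ?R = "{q \<in> ?Q. fst p < fst q}"
    have "fst p \<noteq> fst z" using p z assms(2) by (auto simp: inj_on_def)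
    then have "z \<in> ?R" using p z(1) z(2)[of p] by auto
    then have ne: "?R \<noteq> {}" by blast
    have finR: "finite ?R" using fin by (rule rev_finite_subset) auto
    define q where "q = arg_min_on fst ?R"
    have q: "q \<in> ?R" "\<And>r. r \<in> ?R \<Longrightarrow> fst q \<le> fst r"
      using arg_min_if_finite[OF finR ne, of fst] unfolding q_def by (blast, meson not_less)
    have "(p, q) \<in> consecutive P l"
      using p q(1) q(2)[THEN leD] by (auto simp: consecutive_def simp del: split_paired_Ex)
    then show "p \<in> fst ` consecutive P l" by force
  qed
  then have "card (?Q - {z}) \<le> card (consecutive P l)"
    by (rule surj_card_le[OF finite_consecutive[OF assms(1)]])
  then show ?thesis using z fin by (simp add: card_Diff_singleton)
qed

locale incidences =
  fixes P L :: "(real \<times> real) set"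
  assumes finP: "finite P" and injP: "inj_on fst P" and finL: "finite L"
begin

definition E where "E = (\<Union>l\<in>L. consecutive P l)"

definition X where
  "X = {(e, e'). e \<in> E \<and> e' \<in> E \<and> e \<noteq> e' \<and> (\<exists>x. fst (fst e) < x \<and> x < fst (snd e)
         \<and> fst (fst e') < x \<and> x < fst (snd e') \<and> height e x = height e' x)}"

lemma finE: "finite E"
  using finL finP by (auto simp: E_def intro: finite_consecutive)

lemma finX: "finite X"
  by (rule finite_subset[of _ "E \<times> E"]) (use finE in \<open>auto simp: X_def\<close>)

lemma line_unique:
  assumes "on_line l p" "on_line l q" "on_line l' p" "on_line l' q" "fst p \<noteq> fst q"
  shows "l = l'"
proof -
  have "(fst l - fst l') * (fst p - fst q) = 0"
    using assms unfolding on_line_def by (simp add: algebra_simps)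
  then have "fst l = fst l'" using assms by simp
  then show ?thesis using assms by (simp add: on_line_def prod_eq_iff)
qed

lemma edge_line_unique:
  "e \<in> consecutive P l \<Longrightarrow> e \<in> consecutive P l' \<Longrightarrow> l = l'"
  using line_unique[of l "fst e" "snd e" l'] by (auto simp: consecutive_def)

lemma edge_through_unique:
  assumes "e \<in> consecutive P l" "e' \<in> consecutive P l"
    "fst (fst e) < x" "x < fst (snd e)" "fst (fst e') < x" "x < fst (snd e')"
  shows "e = e'"
proof -
  obtain p q p' q' where e: "e = (p, q)" "e' = (p', q')" by (metis surj_pair)
  have "\<not> fst p < fst p'" "\<not> fst p' < fst p" "\<not> fst q < fst q'" "\<not> fst q' < fst q"
    using assms by (auto simp: consecutive_def e)
  then have "fst p = fst p'" "fst q = fst q'" by auto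
  then have "p = p'" "q = q'" using assms injP by (auto simp: consecutive_def e inj_on_def)
  then show ?thesis using e by simp
qed

lemma crossing_lines_differ:
  assumes "(e, e') \<in> X" "e \<in> consecutive P l" "e' \<in> consecutive P l'"
  shows "l \<noteq> l'"
  using assms edge_through_unique unfolding X_def by blast

text \<open>Two distinct lines meet only once, and over a given abscissa a line carries at most one
  edge; so the ordered pair of lines determines the ordered pair of crossing edges.\<close>

lemma card_X: "card X \<le> card L ^ 2"
proof -
  define ln where "ln e = (THE l. e \<in> consecutive P l)" for e
  have ln: "ln e = l" if "e \<in> consecutive P l" for e l
    unfolding ln_def using that edge_line_unique by blast
  have "inj_on (map_prod ln ln) X"
  proof (rule inj_onI)
    fix a b assume a: "a \<in> X" and b: "b \<in> X" and eq: "map_prod ln ln a = map_prod ln ln b"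
    obtain e e' f f' where ab: "a = (e, e')" "b = (f, f')" by (metis surj_pair)
    obtain l l' where l: "e \<in> consecutive P l" "e' \<in> consecutive P l'"
      using a by (auto simp: ab X_def E_def)
    obtain m m' where m: "f \<in> consecutive P m" "f' \<in> consecutive P m'"
      using b by (auto simp: ab X_def E_def)
    have mm: "m = l" "m' = l'" using eq ln l m by (auto simp: ab)
    have ne: "l \<noteq> l'" using crossing_lines_differ a l by (simp add: ab)
    obtain x where x: "fst (fst e) < x" "x < fst (snd e)" "fst (fst e') < x" "x < fst (snd e')"
       "height e x = height e' x" using a by (auto simp: ab X_def)
    obtain y where y: "fst (fst f) < y" "y < fst (snd f)" "fst (fst f') < y" "y < fst (snd f')"
       "height f y = height f' y" using b by (auto simp: ab X_def)
    have "x = y"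
    proof (rule ccontr)
      assume "x \<noteq> y"
      have "on_line l (x, height e x)" "on_line l (y, height f y)"
           "on_line l' (x, height e x)" "on_line l' (y, height f y)"
        using x(5) y(5) l m mm by (simp_all add: on_line_def consecutive_height)
      then have "l = l'" by (rule line_unique) (simp add: \<open>x \<noteq> y\<close>)
      then show False using ne by simp
    qed
    then show "a = b" using edge_through_unique x y l m mm by (auto simp: ab)
  qed
  moreover have "map_prod ln ln ` X \<subseteq> L \<times> L" using ln by (auto simp: X_def E_def)
  ultimately have "card X \<le> card (L \<times> L)" by (rule card_inj_on_le) (use finL in simp)
  then show ?thesis by (simp add: power2_eq_square card_cartesian_product)
qed

text \<open>The carrying lines meet only at the crossing, which is interior to both edges, so no end
  point is shared. A crossing therefore survives in a random subset with probability exactly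
  \<open>p ^ 4\<close>.\<close>

lemma endpoints_crossing:
  assumes "(e, e') \<in> X"
  shows "card {fst e, snd e, fst e', snd e'} = 4"
proof -
  obtain l l' where l: "e \<in> consecutive P l" "e' \<in> consecutive P l'"
    using assms by (auto simp: X_def E_def)
  have ne: "l \<noteq> l'" using crossing_lines_differ assms l by simp
  obtain x where x: "fst (fst e) < x" "x < fst (snd e)" "fst (fst e') < x" "x < fst (snd e')"
    "height e x = height e' x" using assms by (auto simp: X_def)
  have on: "on_line l (x, height e x)" "on_line l' (x, height e x)"
    using x(5) l by (simp_all add: on_line_def consecutive_height)
  have *: "r \<noteq> r'" if "r \<in> {fst e, snd e}" "r' \<in> {fst e', snd e'}" for r r'
  proof
    assume "r = r'"
    then have r: "on_line l r" "on_line l' r" "fst r \<noteq> x" using that l x by (auto simp: consecutive_def)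
    then show False using line_unique[OF on(1) r(1) on(2) r(2)] ne by simp
  qed
  have "fst e \<noteq> snd e" "fst e' \<noteq> snd e'" using x by auto
  then show ?thesis using *[of "fst e" "fst e'"] *[of "fst e" "snd e'"] *[of "snd e" "fst e'"] *[of "snd e" "snd e'"]
    by simp
qed

definition EW where "EW W = {e \<in> E. {fst e, snd e} \<subseteq> W}"
definition XW where "XW W = {a \<in> X. {fst (fst a), snd (fst a), fst (snd a), snd (snd a)} \<subseteq> W}"

text \<open>Deleting the first edge of every crossing pair leaves a plane graph; no vertex lies
  inside an edge because edges join neighbours on a line.\<close>

lemma card_EW:
  assumes "W \<subseteq> P"
  shows "card (EW W) \<le> 4 * card W + card (XW W)"
proof -
  let ?G = "EW W - fst ` XW W"
  interpret plane_graph W ?G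
  proof
    show "finite W" using assms finP finite_subset by blast
    show "inj_on fst W" using assms injP inj_on_subset by blast
    show "?G \<subseteq> W \<times> W" by (auto simp: EW_def)
    show "fst (fst e) < fst (snd e)" if "e \<in> ?G" for e
      using that by (auto simp: EW_def E_def consecutive_def)
    show "height e (fst w) \<noteq> snd w"
      if w: "e \<in> ?G" "w \<in> W" "fst (fst e) < fst w" "fst w < fst (snd e)" for e w
    proof
      assume eq: "height e (fst w) = snd w"
      obtain l where l: "e \<in> consecutive P l" using w(1) unfolding EW_def E_def by blast
      then have "on_line l w" using eq by (simp add: on_line_def consecutive_height)
      then show False using l w assms by (auto simp: consecutive_def)
    qed
    show "height e x \<noteq> height e' x"
      if "e \<in> ?G" "e' \<in> ?G" "e \<noteq> e'" "fst (fst e) < x" "x < fst (snd e)"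
        "fst (fst e') < x" "x < fst (snd e')" for e e' x
    proof
      assume "height e x = height e' x"
      then have "(e, e') \<in> X" using that by (auto simp: X_def EW_def)
      then have "(e, e') \<in> XW W" using that by (auto simp: XW_def EW_def)
      then show False using that by force
    qed
  qed
  have fin: "finite (XW W)" "finite (EW W)" using finX finE by (auto simp: XW_def EW_def)
  have "card (EW W) \<le> card ?G + card (fst ` XW W)"
    
  proof -
    have "EW W \<subseteq> ?G \<union> fst ` XW W" by blast
    then have "card (EW W) \<le> card (?G \<union> fst ` XW W)" using fin by (intro card_mono) auto
    then show ?thesis using card_Un_le[of ?G "fst ` XW W"] by linarith
  qed
  also have "card (fst ` XW W) \<le> card (XW W)" by (rule card_image_le[OF fin(1)])
  finally show ?thesis using card_edges_le by linarith
qed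

text \<open>The expectation over a random subset of \<open>P\<close> that contains each point independently with probability \<open>p\<close>.\<close>

lemma weighted_count:
  fixes p :: real and F :: "'a \<Rightarrow> (real \<times> real) set"
  assumes "finite Y" "\<And>y. y \<in> Y \<Longrightarrow> F y \<subseteq> P" "\<And>y. y \<in> Y \<Longrightarrow> card (F y) = k"
  shows "(\<Sum>W\<in>Pow P. p ^ card W * (1 - p) ^ card (P - W) * card {y \<in> Y. F y \<subseteq> W}) = card Y * p ^ k"
proof -
  have "(\<Sum>W\<in>Pow P. p ^ card W * (1 - p) ^ card (P - W) * card {y \<in> Y. F y \<subseteq> W})
      = (\<Sum>W\<in>Pow P. \<Sum>y\<in>Y. if F y \<subseteq> W then p ^ card W * (1 - p) ^ card (P - W) else 0)"
    using assms(1) by (intro sum.cong refl) (simp flip: sum.inter_filter)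
  also have "\<dots> = (\<Sum>y\<in>Y. \<Sum>W\<in>Pow P. if F y \<subseteq> W then p ^ card W * (1 - p) ^ card (P - W) else 0)"
    by (rule sum.swap)
  also have "\<dots> = (\<Sum>y\<in>Y. p ^ k)"
    using assms by (intro sum.cong refl) (simp add: sum_binomial_weights[OF finP])
  finally show ?thesis by simp
qed

lemma crossing_inequality:
  fixes p :: real
  assumes "0 \<le> p" "p \<le> 1"
  shows "card E * p ^ 2 \<le> 4 * (card P * p) + card X * p ^ 4"
proof -
  let ?w = "\<lambda>W. p ^ card W * (1 - p) ^ card (P - W)"
  have "card E * p ^ 2 = (\<Sum>W\<in>Pow P. ?w W * card (EW W))"
    unfolding EW_def
    by (rule weighted_count[symmetric, OF finE]) (auto simp: E_def consecutive_def)
  also have "\<dots> \<le> (\<Sum>W\<in>Pow P. 4 * (?w W * card {y \<in> P. {y} \<subseteq> W}) + ?w W * card (XW W))"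
  proof (rule sum_mono)
    fix W assume W: "W \<in> Pow P"
    have "{y \<in> P. {y} \<subseteq> W} = W" using W by auto
    moreover have "real (card (EW W)) \<le> 4 * card W + card (XW W)" using card_EW[of W] W by auto
    then have "?w W * card (EW W) \<le> ?w W * (4 * card W + card (XW W))"
      using assms by (intro mult_left_mono) auto
    ultimately show "?w W * card (EW W) \<le> 4 * (?w W * card {y \<in> P. {y} \<subseteq> W}) + ?w W * card (XW W)"
      by (simp add: algebra_simps)
  qed
  also have "\<dots> = 4 * (\<Sum>W\<in>Pow P. ?w W * card {y \<in> P. {y} \<subseteq> W}) + (\<Sum>W\<in>Pow P. ?w W * card (XW W))"
    by (simp add: sum.distrib sum_distrib_left)
  also have "(\<Sum>W\<in>Pow P. ?w W * card {y \<in> P. {y} \<subseteq> W}) = card P * p ^ 1"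
    by (rule weighted_count[OF finP]) auto
  also have "(\<Sum>W\<in>Pow P. ?w W * card (XW W)) = card X * p ^ 4"
    unfolding XW_def
    by (rule weighted_count[OF finX])
      (use endpoints_crossing in \<open>auto simp: X_def E_def consecutive_def split: prod.splits\<close>)
  finally show ?thesis by simp
qed

lemma card_E_bound:
  "real (card E) \<le> 8 * card P + 6 * (real (card P) * card L) powr (2/3)"
proof (cases "card E > 8 * card P")
  case True
  define g where "g = real (card E)"
  define n where "n = real (card P)"
  define k where "k = real (card L)"
  have g: "g > 8 * n" "g > 0" "n \<ge> 0" "k \<ge> 0" using True by (auto simp: g_def n_def k_def)
  \<comment> \<open>With this \<open>p\<close> the term \<open>4 * (n * p)\<close> is half of
    \<open>g * p ^ 2\<close>, and \<open>p \<le> 1\<close> since \<open>g > 8 * n\<close>.\<close>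
  define p where "p = 8 * n / g"
  have p: "0 \<le> p" "p \<le> 1" using g by (auto simp: p_def)
  have "g * p ^ 2 \<le> 4 * (n * p) + real (card X) * p ^ 4"
    using crossing_inequality[OF p] by (simp add: g_def n_def)
  also have "real (card X) * p ^ 4 \<le> k ^ 2 * p ^ 4"
    using card_X p by (intro mult_right_mono) (auto simp: k_def simp flip: of_nat_power)
  finally have *: "g * p ^ 2 \<le> 4 * (n * p) + k ^ 2 * p ^ 4" by simp
  have "g ^ 3 \<le> 128 * (n * k) ^ 2"
  proof (cases "n = 0")
    case True
    then have "P = {}" using finP by (simp add: n_def)
    have "consecutive P l = {}" for l using \<open>P = {}\<close> by (auto simp: consecutive_def)
    then have "E = {}" by (simp add: E_def)
    then show ?thesis using g by (simp add: g_def)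
  next
    case False
    have e: "g * p ^ 2 = 64 * n ^ 2 / g" "n * p = 8 * n ^ 2 / g" "k ^ 2 * p ^ 4 = 4096 * n ^ 4 * k ^ 2 / g ^ 4"
      using g by (simp_all add: p_def power2_eq_square power_mult_distrib power_divide)
    have "32 * n ^ 2 / g \<le> 4096 * n ^ 4 * k ^ 2 / g ^ 4" using * unfolding e by simp
    then have "32 * n ^ 2 / g * g ^ 4 \<le> 4096 * n ^ 4 * k ^ 2" using g by (simp add: pos_le_divide_eq)
    then have "(32 * n ^ 2) * g ^ 3 \<le> (32 * n ^ 2) * (128 * (n * k) ^ 2)"
      using g by (simp add: power4_eq_xxxx power3_eq_cube power2_eq_square algebra_simps)
    then show ?thesis using False by (simp add: zero_less_power2)
  qed
  also have "\<dots> \<le> (6 * (n * k) powr (2/3)) ^ 3"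
  proof -
    have "((n * k) powr (2/3)) ^ 3 = (n * k) ^ 2"
    proof (cases "n * k = 0")
      case False
      then have "n * k > 0" using g by (simp add: less_le)
      then show ?thesis by (simp add: powr_powr flip: powr_numeral powr_realpow)
    qed auto
    then have "(6 * (n * k) powr (2/3)) ^ 3 = 216 * (n * k) ^ 2" by (simp add: power_mult_distrib)
    then show ?thesis by simp
  qed
  finally have "g \<le> 6 * (n * k) powr (2/3)" by (subst (asm) power_mono_iff) (use g in auto)
  then show ?thesis using g by (simp add: g_def n_def k_def)
next
  case False
  then have "real (card E) \<le> real (8 * card P)" by (simp only: of_nat_le_iff not_less)
  then show ?thesis by (simp add: add_increasing2)
qed

theorem szemeredi_trotter:
  "real (\<Sum>l\<in>L. card {p \<in> P. on_line l p}) \<le> card L + 8 * card P + 6 * (real (card P) * card L) powr (2/3)"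
proof -
  have "(\<Sum>l\<in>L. card {p \<in> P. on_line l p}) \<le> (\<Sum>l\<in>L. 1 + card (consecutive P l))"
    using card_consecutive[OF finP injP] by (intro sum_mono) auto
  also have "\<dots> = card L + (\<Sum>l\<in>L. card (consecutive P l))" by (simp only: sum.distrib) simp
  also have "(\<Sum>l\<in>L. card (consecutive P l)) = card E"
    unfolding E_def using finL finite_consecutive[OF finP] edge_line_unique
    by (intro card_UN_disjoint[symmetric]) (auto simp del: split_paired_All)
  finally show ?thesis using card_E_bound by linarith
qed

end

section \<open>Lattice points and lines\<close>

type_synonym pt = "int \<times> int"

definition cross :: "pt \<Rightarrow> pt \<Rightarrow> int" where
  "cross u v = fst u * snd v - snd u * fst v"

definition dot :: "pt \<Rightarrow> pt \<Rightarrow> int" where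
  "dot u v = fst u * fst v + snd u * snd v"

definition line :: "pt \<Rightarrow> pt \<Rightarrow> pt set" where
  "line p q = {r. cross (q - p) (r - p) = 0}"

definition lines :: "pt set set" where
  "lines = {line p q | p q. p \<noteq> q}"

lemma mult_cancel_pair:
  fixes a b s t :: int
  assumes "(a, b) \<noteq> (0, 0)" "a * s = 0" "b * s = 0"
  shows "s = 0"
  using assms by auto

lemma cross_parallel_aux:
  fixes u v w :: pt
  assumes "u \<noteq> 0" "cross u v = 0" "cross u w = 0"
  shows "cross v w = 0"
proof -
  obtain a b where u: "u = (a, b)" by (metis surj_pair)
  obtain c d where v: "v = (c, d)" by (metis surj_pair)
  obtain e f where w: "w = (e, f)" by (metis surj_pair)
  have 1: "a * d = b * c" "a * f = b * e" using assms by (simp_all add: cross_def u v w)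
  have "a * (c * f - d * e) = c * (a * f) - e * (a * d)" by (simp add: algebra_simps)
  then have 2: "a * (c * f - d * e) = 0" unfolding 1 by (simp add: algebra_simps)
  have "b * (c * f - d * e) = f * (b * c) - d * (b * e)" by (simp add: algebra_simps)
  then have 3: "b * (c * f - d * e) = 0" unfolding 1[symmetric] by (simp add: algebra_simps)
  have "(a, b) \<noteq> (0, 0)" using assms(1) u by (simp add: zero_prod_def)
  from mult_cancel_pair[OF this 2 3] show ?thesis by (simp add: cross_def v w)
qed

lemma line_points: "p \<in> line p q" "q \<in> line p q"
  by (simp_all add: line_def cross_def)

lemma line_eqI:
  assumes "p \<noteq> q" "r \<in> line p q" "s \<in> line p q" "r \<noteq> s"
  shows "line r s = line p q"
proof -
  have u: "q - p \<noteq> 0" "s - r \<noteq> 0" using assms by auto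
  have rs: "cross (q - p) (r - p) = 0" "cross (q - p) (s - p) = 0" using assms by (simp_all add: line_def)
  then have d: "cross (q - p) (s - r) = 0"
    by (simp add: cross_def algebra_simps)
  have d': "cross (s - r) (q - p) = 0" using d by (simp add: cross_def algebra_simps)
  have "cross (s - r) (x - r) = 0 \<longleftrightarrow> cross (q - p) (x - p) = 0" for x
  proof
    assume "cross (s - r) (x - r) = 0"
    then have "cross (q - p) (x - r) = 0" using cross_parallel_aux[OF u(2) d'] by simp
    then show "cross (q - p) (x - p) = 0" using rs by (simp add: cross_def algebra_simps)
  next
    assume "cross (q - p) (x - p) = 0"
    then have "cross (q - p) (x - r) = 0" using rs by (simp add: cross_def algebra_simps)
    then show "cross (s - r) (x - r) = 0" using cross_parallel_aux[OF u(1) d] by simp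
  qed
  then show ?thesis by (auto simp: line_def)
qed

lemma lines_unique:
  assumes "l \<in> lines" "r \<in> l" "s \<in> l" "r \<noteq> s"
  shows "l = line r s"
proof -
  obtain p q where "p \<noteq> q" "l = line p q" using assms(1) by (auto simp only: lines_def)
  then show ?thesis using line_eqI[of p q r s] assms by simp
qed

lemma card_Int_lines:
  assumes "l \<in> lines" "l' \<in> lines" "l \<noteq> l'"
  shows "card (S \<inter> l \<inter> l') \<le> 1"
proof (rule ccontr)
  assume "\<not> ?thesis"
  then have "\<not> (\<exists>x. S \<inter> l \<inter> l' \<subseteq> {x})" by (metis One_nat_def card.empty card_insert_disjoint
      card_mono empty_iff finite.emptyI finite_insert)
  then obtain r s where "r \<in> l" "s \<in> l" "r \<in> l'" "s \<in> l'" "r \<noteq> s" by blast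
  then show False using lines_unique assms by metis
qed

text \<open>The linear map (x, y) -> (K x + y, y) preserves collinearity and, for large
  \<open>K\<close>, gives the points of \<open>P\<close> distinct abscissas, so a line with two
  points of \<open>P\<close> becomes a graph. The lines with at most one point account for the
  second \<open>card L\<close>.\<close>

theorem lattice_szemeredi_trotter:
  assumes P: "finite P" and L: "finite L" "L \<subseteq> lines"
  shows "real (\<Sum>l\<in>L. card (P \<inter> l)) \<le> 2 * card L + 8 * card P + 6 * (real (card P) * card L) powr (2/3)"
proof -
  define K where "K = 1 + 2 * (\<Sum>p\<in>P. \<bar>snd p\<bar>)"
  have K: "2 * \<bar>snd p\<bar> < K" if "p \<in> P" for p
    using member_le_sum[of p P "\<lambda>p. \<bar>snd p\<bar>"] that P by (simp add: K_def)
  have "(\<Sum>p\<in>P. \<bar>snd p\<bar>) \<ge> 0" by (rule sum_nonneg) simp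
  then have K0: "K > 0" unfolding K_def by linarith
  define X where "X p = real_of_int (K * fst p + snd p)" for p :: pt
  define \<phi> where "\<phi> p = (X p, real_of_int (snd p))" for p :: pt
  have injX: "p = q" if "p \<in> P" "q \<in> P" "X p = X q" for p q
  proof -
    have "K * (fst p - fst q) = snd q - snd p" using that(3) unfolding X_def of_int_eq_iff
      by (simp add: algebra_simps)
    moreover have "\<bar>snd q - snd p\<bar> < K" using K[OF that(1)] K[OF that(2)] by linarith
    ultimately have *: "\<bar>K * (fst p - fst q)\<bar> < K * 1" by simp
    then have "K * \<bar>fst p - fst q\<bar> < K * 1" using K0 by (simp add: abs_mult)
    then have "fst p = fst q" using K0 by (simp del: mult_1_right)
    then show ?thesis using \<open>K * (fst p - fst q) = _\<close> by (simp add: prod_eq_iff)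
  qed
  define L2 where "L2 = {l \<in> L. card (P \<inter> l) \<ge> 2}"
  have fin2: "finite L2" using L by (simp add: L2_def)
  have "\<exists>g. \<forall>p \<in> P \<inter> l. on_line g (\<phi> p)" if "l \<in> L2" for l
  proof -
    have "\<not> (\<exists>x. P \<inter> l \<subseteq> {x})"
    proof
      assume "\<exists>x. P \<inter> l \<subseteq> {x}"
      then obtain x where "P \<inter> l \<subseteq> {x}" ..
      then have "card (P \<inter> l) \<le> card {x}" by (intro card_mono) auto
      then show False using that by (simp add: L2_def)
    qed
    then obtain p q where pq: "p \<in> P" "q \<in> P" "p \<in> l" "q \<in> l" "p \<noteq> q" by blast
    have l: "l = line p q" using lines_unique[of l p q] pq L that unfolding L2_def by blast
    have ne: "X q - X p \<noteq> 0" using injX[OF pq(1,2)] pq by auto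
    define s where "s = real_of_int (snd q - snd p) / (X q - X p)"
    show ?thesis
    proof (intro exI ballI)
      fix r assume "r \<in> P \<inter> l"
      then have "cross (q - p) (r - p) = 0" by (simp add: l line_def)
      then have "(snd q - snd p) * (fst r - fst p) = (fst q - fst p) * (snd r - snd p)"
        by (simp add: cross_def)
      then have "(snd q - snd p) * (K * (fst r - fst p) + (snd r - snd p))
          = (K * (fst q - fst p) + (snd q - snd p)) * (snd r - snd p)"
        by (simp add: distrib_left distrib_right mult.left_commute mult.assoc)
      then have "real_of_int ((snd q - snd p) * (K * (fst r - fst p) + (snd r - snd p)))
          = real_of_int ((K * (fst q - fst p) + (snd q - snd p)) * (snd r - snd p))" by simp
      then have "real_of_int (snd q - snd p) * (X r - X p) = (X q - X p) * real_of_int (snd r - snd p)"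
        unfolding X_def by (simp add: algebra_simps)
      then have "s * (X r - X p) = real_of_int (snd r - snd p)" using ne by (simp add: s_def field_simps)
      then show "on_line (s, real_of_int (snd p) - s * X p) (\<phi> r)"
        by (simp add: on_line_def \<phi>_def algebra_simps)
    qed
  qed
  then obtain g where g: "\<And>l p. l \<in> L2 \<Longrightarrow> p \<in> P \<Longrightarrow> p \<in> l \<Longrightarrow> on_line (g l) (\<phi> p)" by (metis IntI)
  have injg: "inj_on g L2"
  proof (rule inj_onI)
    fix l l' assume l: "l \<in> L2" "l' \<in> L2" "g l = g l'"
    show "l = l'"
    proof (rule ccontr)
      assume "l \<noteq> l'"
      have two: "\<exists>p q. p \<in> P \<inter> k \<and> q \<in> P \<inter> k \<and> p \<noteq> q" if "k \<in> L2" for k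
      proof (rule ccontr)
        assume a: "\<not> ?thesis"
        have "card (P \<inter> k) \<le> 1"
        proof (cases "P \<inter> k = {}")
          case False
          then obtain x where "P \<inter> k = {x}" using a by blast
          then show ?thesis by simp
        qed simp
        then show False using that by (simp add: L2_def)
      qed
      obtain p q where pq: "p \<in> P \<inter> l" "q \<in> P \<inter> l" "p \<noteq> q" using two l by blast
      have "r \<in> l" if r: "r \<in> P \<inter> l'" for r
      proof -
        have on: "on_line (g l) (\<phi> p)" "on_line (g l) (\<phi> q)" "on_line (g l) (\<phi> r)"
          using g l pq r by (metis IntE)+
        define s where "s = fst (g l)"
        have e: "real_of_int (snd q - snd p) = s * (X q - X p)" "real_of_int (snd r - snd p) = s * (X r - X p)"
          using on by (simp_all add: on_line_def \<phi>_def s_def algebra_simps)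
        have "real_of_int (snd q - snd p) * (X r - X p) = (X q - X p) * real_of_int (snd r - snd p)"
          unfolding e by simp
        then have "real_of_int (K * cross (q - p) (r - p)) = 0"
          by (simp add: X_def cross_def algebra_simps)
        then have "cross (q - p) (r - p) = 0" using K0 by (simp only: of_int_eq_0_iff mult_eq_0_iff) auto
        then have "r \<in> line p q" by (simp add: line_def)
        then show ?thesis using lines_unique[of l p q] l pq L by (auto simp: L2_def)
      qed
      then have "P \<inter> l' = P \<inter> l \<inter> l'" by auto
      then have "card (P \<inter> l') \<le> 1" using card_Int_lines[of l l' P] l \<open>l \<noteq> l'\<close> L
        by (auto simp: L2_def)
      then show False using l by (simp add: L2_def)
    qed
  qed
  interpret incidences "\<phi> ` P" "g ` L2"
  proof
    show "inj_on fst (\<phi> ` P)" using injX by (auto simp: inj_on_def \<phi>_def)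
  qed (use P fin2 in auto)
  have inj\<phi>: "inj_on \<phi> P" using injX by (auto simp: inj_on_def \<phi>_def)
  have "(\<Sum>l\<in>L. card (P \<inter> l)) = (\<Sum>l\<in>L - L2. card (P \<inter> l)) + (\<Sum>l\<in>L2. card (P \<inter> l))"
    using L by (intro sum.subset_diff) (auto simp: L2_def)
  also have "(\<Sum>l\<in>L - L2. card (P \<inter> l)) \<le> (\<Sum>l\<in>L - L2. 1)"
    by (rule sum_mono) (auto simp: L2_def)
  also have "(\<Sum>l\<in>L - L2. 1) \<le> card L" using L by (simp add: card_mono)
  also have "(\<Sum>l\<in>L2. card (P \<inter> l)) \<le> (\<Sum>l\<in>L2. card {p \<in> \<phi> ` P. on_line (g l) p})"
  proof (rule sum_mono)
    fix l assume l: "l \<in> L2"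
    have "card (P \<inter> l) = card (\<phi> ` (P \<inter> l))" using inj\<phi> by (metis card_image inj_on_Int)
    also have "\<dots> \<le> card {p \<in> \<phi> ` P. on_line (g l) p}"
      using P g l by (intro card_mono) auto
    finally show "card (P \<inter> l) \<le> card {p \<in> \<phi> ` P. on_line (g l) p}" .
  qed
  also have "(\<Sum>l\<in>L2. card {p \<in> \<phi> ` P. on_line (g l) p}) = (\<Sum>l\<in>g ` L2. card {p \<in> \<phi> ` P. on_line l p})"
    using injg by (simp add: sum.reindex)
  finally have "real (\<Sum>l\<in>L. card (P \<inter> l)) \<le> card L + real (\<Sum>l\<in>g ` L2. card {p \<in> \<phi> ` P. on_line l p})"
    by (simp flip: of_nat_add add: of_nat_mono del: of_nat_sum)
  also have "\<dots> \<le> card L + (card (g ` L2) + 8 * card (\<phi> ` P) + 6 * (real (card (\<phi> ` P)) * card (g ` L2)) powr (2/3))"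
    using szemeredi_trotter by simp
  also have "card (\<phi> ` P) = card P" using inj\<phi> by (rule card_image)
  also have "card (g ` L2) = card L2" using injg by (rule card_image)
  also have "real (card L) + (card L2 + 8 * card P + 6 * (real (card P) * card L2) powr (2/3))
     \<le> 2 * card L + 8 * card P + 6 * (real (card P) * card L) powr (2/3)"
  proof -
    have "card L2 \<le> card L" using L by (intro card_mono) (auto simp: L2_def)
    then have "real (card L2) \<le> real (card L)" by simp
    moreover from this have "(real (card P) * card L2) powr (2/3) \<le> (real (card P) * card L) powr (2/3)"
      by (intro powr_mono2 mult_left_mono) auto
    ultimately show ?thesis by simp
  qed
  finally show ?thesis .
qed

section \<open>Right angles and perpendicular lines\<close>

definition right_angle :: "pt \<Rightarrow> pt \<Rightarrow> pt \<Rightarrow> bool" where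
  "right_angle b c d \<longleftrightarrow> b \<noteq> c \<and> d \<noteq> c \<and> dot (b - c) (d - c) = 0"

text \<open>Quantifying over all points of \<open>l\<close> makes the perpendicular a function of
  the line and not of the point used to span it.\<close>

definition perp :: "pt \<Rightarrow> pt set \<Rightarrow> pt set" where
  "perp c l = {x. \<forall>q \<in> l. dot (q - c) (x - c) = 0}"

lemma right_angle_sym: "right_angle b c d \<longleftrightarrow> right_angle d c b"
  by (auto simp: right_angle_def dot_def mult.commute)

lemma line_in_lines: "p \<noteq> q \<Longrightarrow> line p q \<in> lines"
  unfolding lines_def by blast

text \<open>A quarter turn of \<open>w\<close> turns \<open>dot\<close> into \<open>cross\<close>,
  which reduces this to \<open>cross_parallel_aux\<close>.\<close>

lemma dot_cross_aux:
  fixes u v w :: pt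
  assumes "u \<noteq> 0" "cross u v = 0" "dot u w = 0"
  shows "dot v w = 0"
proof -
  have "cross u (- snd w, fst w) = 0" using assms(3) by (simp add: cross_def dot_def)
  from cross_parallel_aux[OF assms(1,2) this] show ?thesis by (simp add: cross_def dot_def algebra_simps)
qed

lemma dot_dot_aux:
  fixes u v w :: pt
  assumes "u \<noteq> 0" "dot u v = 0" "dot u w = 0"
  shows "cross v w = 0"
proof -
  have "cross u (- snd v, fst v) = 0" "cross u (- snd w, fst w) = 0"
    using assms(2,3) by (simp_all add: cross_def dot_def)
  from cross_parallel_aux[OF assms(1) this] show ?thesis by (simp add: cross_def algebra_simps)
qed

lemma cross_dot_zero:
  fixes u v :: pt
  assumes "u \<noteq> 0" "cross u v = 0" "dot u v = 0"
  shows "v = 0"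
proof -
  have "dot v v = 0" using dot_cross_aux[OF assms] .
  then have "fst v * fst v + snd v * snd v = 0" by (simp add: dot_def)
  then have "fst v = 0" "snd v = 0" using sum_squares_eq_zero_iff by auto
  then show ?thesis by (simp add: prod_eq_iff)
qed

lemma perp_line:
  assumes "right_angle b c d"
  shows "perp c (line c b) = line c d"
proof -
  have u: "b - c \<noteq> 0" "d - c \<noteq> 0" and bd: "dot (b - c) (d - c) = 0" "dot (d - c) (b - c) = 0"
    using assms by (auto simp: right_angle_def dot_def mult.commute)
  show ?thesis
  proof (intro equalityI subsetI)
    fix x assume "x \<in> perp c (line c b)"
    then have "dot (b - c) (x - c) = 0" using line_points by (auto simp: perp_def)
    then have "cross (d - c) (x - c) = 0" using dot_dot_aux[OF u(1) bd(1)] by simp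
    then show "x \<in> line c d" by (simp add: line_def)
  next
    fix x assume "x \<in> line c d"
    then have "cross (d - c) (x - c) = 0" by (simp add: line_def)
    then have xb: "dot (x - c) (b - c) = 0" by (rule dot_cross_aux[OF u(2) _ bd(2)])
    show "x \<in> perp c (line c b)" unfolding perp_def
    proof (intro CollectI ballI)
      fix q assume "q \<in> line c b"
      then have "cross (b - c) (q - c) = 0" by (simp add: line_def)
      then show "dot (q - c) (x - c) = 0"
        by (rule dot_cross_aux[OF u(1)]) (use xb in \<open>simp add: dot_def mult.commute\<close>)
    qed
  qed
qed

lemma line_dir:
  assumes "c \<noteq> b" "x \<in> line c b" "y \<in> line c b"
  shows "cross (b - c) (x - y) = 0"
  using assms by (simp add: line_def cross_def algebra_simps)

text \<open>The vector \<open>b - b'\<close> is parallel to the common leg line and, being equal to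
  \<open>d' - d\<close>, also perpendicular to it, so it vanishes.\<close>

lemma fourth_vertex_inj:
  assumes "right_angle b c d" "right_angle b' c d'" "line c b = line c b'" "b + d - c = b' + d' - c"
  shows "b = b' \<and> d = d'"
proof -
  have u: "b - c \<noteq> 0" using assms by (auto simp: right_angle_def)
  have 1: "cross (b - c) (b - b') = 0"
    using line_dir[of c b b b'] line_points[of b' c] line_points[of b c] line_points[of c b']
      line_points[of c b] assms by (auto simp: right_angle_def)
  have "d' \<in> perp c (line c b)" using perp_line[OF assms(2)] assms(3) line_points by simp
  moreover have "d \<in> perp c (line c b)" using perp_line[OF assms(1)] line_points by simp
  ultimately have "dot (b - c) (d - c) = 0" "dot (b - c) (d' - c) = 0"
    using line_points by (auto simp: perp_def)
  then have "dot (b - c) (d' - d) = 0" by (simp add: dot_def algebra_simps)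
  moreover have e: "d' - d = b - b'" using assms(4) by (simp add: algebra_simps)
  ultimately have "b - b' = 0" using cross_dot_zero[OF u 1] by simp
  then show ?thesis using e by simp
qed

text \<open>Both corners are the foot of the perpendicular from \<open>b\<close> to the common
  line.\<close>

lemma foot_unique:
  assumes "right_angle b c d" "right_angle b c' d" "line c d = line c' d"
  shows "c = c'"
proof -
  have u: "d - c \<noteq> 0" using assms by (auto simp: right_angle_def)
  have "c' \<in> line c d" using assms(3) line_points(1)[of c' d] by simp
  then have 1: "cross (d - c) (c' - c) = 0" by (simp add: line_def)
  have "d - c' \<noteq> 0" using assms by (auto simp: right_angle_def)
  moreover have "c \<in> line c' d" using assms(3) line_points(1)[of c d] by simp
  moreover have "d \<in> line c' d" by (rule line_points)
  ultimately have "cross (d - c') (d - c) = 0" by (simp add: line_def cross_def algebra_simps)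
  moreover have "dot (d - c') (b - c') = 0" using assms(2) by (simp add: right_angle_def dot_def mult.commute)
  ultimately have "dot (d - c) (b - c') = 0" by (rule dot_cross_aux[OF \<open>d - c' \<noteq> 0\<close>])
  moreover have "dot (d - c) (b - c) = 0" using assms(1) by (simp add: right_angle_def dot_def mult.commute)
  ultimately have "dot (d - c) (c' - c) = 0" by (simp add: dot_def algebra_simps)
  then have "c' - c = 0" by (rule cross_dot_zero[OF u 1])
  then show ?thesis by simp
qed

lemma right_angle_opposite:
  assumes "right_angle b c d"
  shows "right_angle c d (b + d - c)" "right_angle c b (b + d - c)"
  using assms by (auto simp: right_angle_def dot_def algebra_simps)

lemma parallel_line:
  assumes "right_angle b c d" "right_angle b' c d" "line c b = line c b'"
  shows "line d (b + d - c) = line d (b' + d - c)"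
proof -
  have "line d (b + d - c) = perp d (line d c)"
    using perp_line[OF right_angle_opposite(1)[OF assms(1)]] by simp
  also have "\<dots> = line d (b' + d - c)"
    using perp_line[OF right_angle_opposite(1)[OF assms(2)]] by simp
  finally show ?thesis .
qed

section \<open>Rich lines\<close>

lemma sum_Int_swap:
  assumes "finite X" "finite L"
  shows "(\<Sum>l\<in>L. card (X \<inter> l)) = (\<Sum>x\<in>X. card {l \<in> L. x \<in> l})"
proof -
  have "(\<Sum>l\<in>L. card (X \<inter> l)) = (\<Sum>l\<in>L. \<Sum>x\<in>X. if x \<in> l then 1 else 0)"
    using assms by (intro sum.cong refl) (simp add: sum.If_cases)
  also have "\<dots> = (\<Sum>x\<in>X. \<Sum>l\<in>L. if x \<in> l then 1 else 0)" by (rule sum.swap)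
  also have "\<dots> = (\<Sum>x\<in>X. card {l \<in> L. x \<in> l})"
    using assms by (intro sum.cong refl) (simp add: sum.If_cases Int_def)
  finally show ?thesis .
qed

text \<open>Double counting of pairs of lines through a point of \<open>X\<close>: the diagonal
  gives the incidences, and two distinct lines share at most one point.\<close>

lemma sum_deg_square:
  assumes X: "finite X" and L: "finite L" "L \<subseteq> lines"
  shows "(\<Sum>x\<in>X. (card {l \<in> L. x \<in> l})\<^sup>2) \<le> (\<Sum>l\<in>L. card (X \<inter> l)) + (card L)\<^sup>2"
proof -
  have "(\<Sum>x\<in>X. (card {l \<in> L. x \<in> l})\<^sup>2) = (\<Sum>x\<in>X. card {a \<in> L \<times> L. x \<in> fst a \<inter> snd a})"
  proof (rule sum.cong)
    fix x
    have "{a \<in> L \<times> L. x \<in> fst a \<inter> snd a} = {l \<in> L. x \<in> l} \<times> {l \<in> L. x \<in> l}" by auto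
    then show "(card {l \<in> L. x \<in> l})\<^sup>2 = card {a \<in> L \<times> L. x \<in> fst a \<inter> snd a}"
      by (simp add: card_cartesian_product power2_eq_square)
  qed simp
  also have "\<dots> = (\<Sum>x\<in>X. \<Sum>a\<in>L \<times> L. if x \<in> fst a \<inter> snd a then 1 else 0)"
    using L by (intro sum.cong refl) (simp add: sum.If_cases Int_def)
  also have "\<dots> = (\<Sum>a\<in>L \<times> L. \<Sum>x\<in>X. if x \<in> fst a \<inter> snd a then 1 else 0)" by (rule sum.swap)
  also have "\<dots> = (\<Sum>a\<in>L \<times> L. card (X \<inter> (fst a \<inter> snd a)))"
    using X by (intro sum.cong refl) (simp add: sum.If_cases Int_def)
  also have "\<dots> \<le> (\<Sum>a\<in>L \<times> L. (if fst a = snd a then card (X \<inter> fst a) else 0) + 1)"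
  proof (rule sum_mono)
    fix a assume "a \<in> L \<times> L"
    then have "fst a \<in> lines" "snd a \<in> lines" using L by auto
    then show "card (X \<inter> (fst a \<inter> snd a)) \<le> (if fst a = snd a then card (X \<inter> fst a) else 0) + 1"
      using card_Int_lines[of "fst a" "snd a" X] by (simp add: Int_assoc)
  qed
  also have "\<dots> = (\<Sum>l\<in>L. card (X \<inter> l)) + (card L)\<^sup>2"
  proof -
    have "(\<Sum>a\<in>L \<times> L. if fst a = snd a then card (X \<inter> fst a) else 0)
        = (\<Sum>l\<in>L. \<Sum>l'\<in>L. if l = l' then card (X \<inter> l) else 0)"
      by (simp add: sum.cartesian_product split_beta)
    also have "\<dots> = (\<Sum>l\<in>L. card (X \<inter> l))" using L by simp
    finally have "(\<Sum>a\<in>L \<times> L. if fst a = snd a then card (X \<inter> fst a) else 0) = (\<Sum>l\<in>L. card (X \<inter> l))" .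
    moreover have "(\<Sum>a\<in>L \<times> L. 1) = (card L)\<^sup>2"
      by (simp add: card_cartesian_product power2_eq_square)
    ultimately show ?thesis by (simp only: sum.distrib)
  qed
  finally show ?thesis .
qed

text \<open>From \<open>2 * d \<le> 1 + d\<^sup>2\<close> at each point and
  \<open>sum_deg_square\<close>; one copy of the incidences cancels.\<close>

lemma incidences_le:
  assumes X: "finite X" and L: "finite L" "L \<subseteq> lines"
  shows "(\<Sum>l\<in>L. card (X \<inter> l)) \<le> card X + (card L)\<^sup>2"
proof -
  let ?d = "\<lambda>x. card {l \<in> L. x \<in> l}"
  have "2 * d \<le> 1 + d\<^sup>2" for d :: nat
    by (cases d) (auto simp: power2_eq_square)
  then have "(\<Sum>x\<in>X. 2 * ?d x) \<le> (\<Sum>x\<in>X. 1 + (?d x)\<^sup>2)" by (intro sum_mono)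
  also have "\<dots> = card X + (\<Sum>x\<in>X. (?d x)\<^sup>2)" by (simp only: sum.distrib) simp
  also have "\<dots> \<le> card X + ((\<Sum>l\<in>L. card (X \<inter> l)) + (card L)\<^sup>2)" using sum_deg_square[OF assms] by simp
  finally show ?thesis using sum_Int_swap[OF X L(1)] by (simp flip: sum_distrib_left)
qed

text \<open>Cauchy-Schwarz over \<open>X\<close> gives
  \<open>I\<^sup>2 \<le> s * (I + (card L)\<^sup>2)\<close>. Heaviness gives
  \<open>s * (card L)\<^sup>2 \<le> I\<^sup>2 / 4\<close>, which is absorbed on the left.\<close>

lemma heavy_sum:
  fixes s :: real
  assumes X: "finite X" "card X \<le> s" and L: "finite L" "L \<subseteq> lines"
    and heavy: "\<And>l. l \<in> L \<Longrightarrow> 4 * s \<le> (real (card (X \<inter> l)))\<^sup>2"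
  shows "real (\<Sum>l\<in>L. card (X \<inter> l)) \<le> 2 * s"
proof (cases "s > 0")
  case False
  then have "card X = 0" using X(2) by linarith
  then have "X = {}" using X(1) by simp
  then show ?thesis using X \<open>card X = 0\<close> by simp
next
  case True
  let ?d = "\<lambda>x. real (card {l \<in> L. x \<in> l})"
  define I where "I = real (\<Sum>l\<in>L. card (X \<inter> l))"
  have I: "I = (\<Sum>x\<in>X. ?d x)" using sum_Int_swap[OF X(1) L(1)] by (simp add: I_def)
  have "2 * sqrt s \<le> real (card (X \<inter> l))" if "l \<in> L" for l
    using real_sqrt_le_mono[OF heavy[OF that]] by (simp add: real_sqrt_mult)
  then have "(\<Sum>l\<in>L. 2 * sqrt s) \<le> I" unfolding I_def of_nat_sum by (intro sum_mono)
  then have "(real (card L) * (2 * sqrt s))\<^sup>2 \<le> I\<^sup>2" using True by (intro power_mono) auto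
  then have n: "(real (card L))\<^sup>2 * s \<le> I\<^sup>2 / 4" using True by (simp add: power_mult_distrib)
  have "(\<Sum>x\<in>X. (?d x)\<^sup>2) = real (\<Sum>x\<in>X. (card {l \<in> L. x \<in> l})\<^sup>2)" by simp
  also have "\<dots> \<le> real ((\<Sum>l\<in>L. card (X \<inter> l)) + (card L)\<^sup>2)"
    using sum_deg_square[OF X(1) L] by (intro of_nat_mono)
  also have "\<dots> = I + (real (card L))\<^sup>2" by (simp add: I_def)
  finally have D: "(\<Sum>x\<in>X. (?d x)\<^sup>2) \<le> I + (real (card L))\<^sup>2" .
  have "I\<^sup>2 \<le> (\<Sum>x\<in>X. (?d x)\<^sup>2) * (\<Sum>x\<in>X. 1\<^sup>2)"
    unfolding I using Cauchy_Schwarz_ineq_sum[of ?d "\<lambda>_. 1" X] by simp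
  also have "\<dots> \<le> (I + (real (card L))\<^sup>2) * s"
    using X D by (intro mult_mono) (auto intro: order_trans[OF sum_nonneg D])
  finally have "I\<^sup>2 \<le> I * s + (real (card L))\<^sup>2 * s" by (simp only: distrib_right)
  then have "I\<^sup>2 \<le> I * s + I\<^sup>2 / 4" using n by linarith
  then have "I * (3 / 4 * I) \<le> I * s" by (simp add: power2_eq_square)
  moreover have "I \<ge> 0" unfolding I_def by (rule of_nat_0_le_iff)
  ultimately have "I = 0 \<or> 3 / 4 * I \<le> s" by (metis less_le mult_left_le_imp_le)
  then show ?thesis unfolding I_def[symmetric] using True by auto
qed

text \<open>The incidence theorem bounds \<open>2 ^ k * n\<close> by multiples of \<open>s\<close>
  and \<open>(s * n) powr (2/3)\<close>. If the second dominates, solving for \<open>n\<close> gives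
  the cubic decay with \<open>13824 = 24 ^ 3\<close>; if the first does,
  \<open>4 ^ k \<le> 4 * s\<close> converts it into the same form.\<close>

lemma card_rich_lines_le:
  fixes s :: real
  assumes X: "finite X" "card X \<le> s" and L: "finite L" "L \<subseteq> lines"
    and rich: "\<And>l. l \<in> L \<Longrightarrow> 2 ^ k \<le> card (X \<inter> l)" and k: "k \<ge> 1" "4 ^ k \<le> 4 * s"
  shows "real (card L) \<le> 13824 * s\<^sup>2 / 8 ^ k"
proof (cases "k = 1")
  case True
  \<comment> \<open>For \<open>k = 1\<close> the term \<open>2 * card L\<close> of the incidence
    theorem cannot be absorbed by the left side; a line is instead encoded by two points of
    \<open>X\<close> on it.\<close>
  define two where "two l = {p \<in> X \<times> X. fst p \<noteq> snd p \<and> fst p \<in> l \<and> snd p \<in> l}" for l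
  have "\<exists>p. p \<in> two l" if "l \<in> L" for l
  proof -
    have "\<not> card (X \<inter> l) \<le> Suc 0" using rich[OF that] True by simp
    then obtain p q where "p \<in> X \<inter> l" "q \<in> X \<inter> l" "p \<noteq> q"
      using X by (auto simp: card_le_Suc0_iff_eq)
    then have "(p, q) \<in> two l" by (simp add: two_def)
    then show ?thesis ..
  qed
  then obtain g where g: "\<And>l. l \<in> L \<Longrightarrow> g l \<in> two l" by metis
  have "inj_on g L"
  proof (rule inj_onI)
    fix l l' assume l: "l \<in> L" "l' \<in> L" "g l = g l'"
    have "l = line (fst (g l)) (snd (g l))" if "l \<in> L" for l
      using lines_unique[of l "fst (g l)" "snd (g l)"] g[OF that] L that unfolding two_def by blast
    then show "l = l'" using l by metis
  qed
  moreover have "g ` L \<subseteq> X \<times> X" using g by (intro image_subsetI) (simp add: two_def)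
  ultimately have "card L \<le> card (X \<times> X)" using X by (intro card_inj_on_le) auto
  then have "real (card L) \<le> real (card X) * real (card X)"
    by (simp add: card_cartesian_product flip: of_nat_mult)
  also have "\<dots> \<le> s * s" using X by (intro mult_mono) auto
  finally show ?thesis using True by (simp add: power2_eq_square)
next
  case False
  then have k2: "k \<ge> 2" using k by simp
  define n where "n = real (card L)"
  have s0: "s \<ge> 0" using X by linarith
  have p4: "(4::real) \<le> 2 ^ k" using power_increasing[OF k2, of "2::real"] by simp
  have "2 ^ k * n = real (\<Sum>l\<in>L. 2 ^ k)" by (simp add: n_def)
  also have "\<dots> \<le> real (\<Sum>l\<in>L. card (X \<inter> l))" using rich by (intro of_nat_mono sum_mono)
  also have "\<dots> \<le> 2 * n + 8 * card X + 6 * (real (card X) * n) powr (2/3)"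
    using lattice_szemeredi_trotter[OF X(1) L] by (simp add: n_def)
  also have "\<dots> \<le> 2 * n + 8 * s + 6 * (s * n) powr (2/3)"
    using X by (intro add_mono mult_left_mono powr_mono2 mult_right_mono) (auto simp: n_def)
  finally have *: "2 ^ k * n \<le> 2 * n + 8 * s + 6 * (s * n) powr (2/3)" .
  have n0: "n \<ge> 0" by (simp add: n_def)
  have "2 * n \<le> 2 ^ k * n / 2" using mult_right_mono[OF p4 n0] by simp
  then have **: "2 ^ k * n \<le> 16 * s + 12 * (s * n) powr (2/3)" using * by linarith
  have e8: "(8::real) ^ k = 2 ^ k * 4 ^ k" by (simp flip: power_mult_distrib)
  show ?thesis
  proof (cases "2 ^ k * n \<le> 32 * s")
    case True
    then have "2 ^ k * n * 4 ^ k \<le> 32 * s * (4 * s)" using k s0 by (intro mult_mono[OF True]) auto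
    then have "n * 8 ^ k \<le> 128 * s\<^sup>2" by (simp add: e8 power2_eq_square algebra_simps)
    also have "\<dots> \<le> 13824 * s\<^sup>2" by simp
    finally show ?thesis by (simp add: n_def pos_le_divide_eq)
  next
    case False
    then have "2 ^ k * n \<le> 24 * (s * n) powr (2/3)" using ** by linarith
    then have "(2 ^ k * n) ^ 3 \<le> (24 * (s * n) powr (2/3)) ^ 3" using n0 by (intro power_mono) auto
    moreover have npos: "n > 0" "s > 0" using False s0 n0 p4 ** by (auto simp: less_le)
    then have "((s * n) powr (2/3)) ^ 3 = (s * n)\<^sup>2"
      by (simp add: powr_powr flip: powr_numeral powr_realpow)
    moreover have "((2::real) ^ k) ^ 3 = (2 ^ 3) ^ k" by (simp only: power_mult[symmetric] mult.commute)
    ultimately have "8 ^ k * n ^ 3 \<le> 13824 * (s * n)\<^sup>2"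
      by (simp add: power_mult_distrib)
    then have "n\<^sup>2 * (n * 8 ^ k) \<le> n\<^sup>2 * (13824 * s\<^sup>2)"
      by (simp add: power2_eq_square power3_eq_cube algebra_simps)
    then have "n * 8 ^ k \<le> 13824 * s\<^sup>2" using npos by simp
    then show ?thesis by (simp add: n_def pos_le_divide_eq)
  qed
qed

section \<open>Counting rectangles\<close>

type_synonym triple = "pt \<times> pt \<times> pt"

text \<open>A triple \<open>(b, c, d)\<close> encodes the rectangle with the right angle at \<open>c\<close> between the legs \<open>c b\<close> and
  \<open>c d\<close>; in \<open>corners A B C D\<close> the corners, in cyclic order from the fourth one, lie in \<open>A\<close>, \<open>B\<close>, \<open>C\<close>, \<open>D\<close>.\<close>

definition leg1 :: "triple \<Rightarrow> pt set" where "leg1 t = line (fst (snd t)) (fst t)"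
definition leg2 :: "triple \<Rightarrow> pt set" where "leg2 t = line (fst (snd t)) (snd (snd t))"
definition fourth :: "triple \<Rightarrow> pt" where "fourth t = fst t + snd (snd t) - fst (snd t)"
definition opp1 :: "triple \<Rightarrow> pt set" where "opp1 t = line (snd (snd t)) (fourth t)"

definition corners :: "pt set \<Rightarrow> pt set \<Rightarrow> pt set \<Rightarrow> pt set \<Rightarrow> triple set" where
  "corners A B C D = {t. fst t \<in> B \<and> fst (snd t) \<in> C \<and> snd (snd t) \<in> D \<and>
     right_angle (fst t) (fst (snd t)) (snd (snd t)) \<and> fourth t \<in> A}"

definition flip :: "triple \<Rightarrow> triple" where "flip t = (snd (snd t), fst (snd t), fst t)"

lemma flip_flip [simp]: "flip (flip t) = t"
  by (simp add: flip_def)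

lemma leg_flip [simp]: "leg1 (flip t) = leg2 t" "leg2 (flip t) = leg1 t" "fourth (flip t) = fourth t"
  "fst (snd (flip t)) = fst (snd t)"
  by (simp_all add: flip_def leg1_def leg2_def fourth_def add.commute)

lemma inj_flip: "inj_on flip T"
  by (metis flip_flip inj_onI)

lemma card_flip: "card (flip ` T) = card T"
  by (rule card_image[OF inj_flip])

lemma flip_corners: "T \<subseteq> corners A B C D \<Longrightarrow> flip ` T \<subseteq> corners A D C B"
proof (rule image_subsetI)
  fix t assume "T \<subseteq> corners A B C D" "t \<in> T"
  then have t: "t \<in> corners A B C D" by blast
  obtain x y z where [simp]: "t = (x, y, z)" by (rule prod_cases3)
  show "flip t \<in> corners A D C B"
    using t right_angle_sym[of x y z] by (simp add: corners_def flip_def fourth_def add.commute)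
qed

lemma finite_corners:
  assumes "finite B" "finite C" "finite D" "T \<subseteq> corners A B C D"
  shows "finite T"
proof (rule finite_subset[OF assms(4)], rule finite_subset)
  show "corners A B C D \<subseteq> B \<times> C \<times> D" by (auto simp: corners_def)
qed (use assms in simp)

lemma leg_lines: "T \<subseteq> corners A B C D \<Longrightarrow> t \<in> T \<Longrightarrow> leg1 t \<in> lines"
  "T \<subseteq> corners A B C D \<Longrightarrow> t \<in> T \<Longrightarrow> leg2 t \<in> lines"
  "T \<subseteq> corners A B C D \<Longrightarrow> t \<in> T \<Longrightarrow> opp1 t \<in> lines"
  by (auto simp: leg1_def leg2_def opp1_def fourth_def corners_def right_angle_def intro!: line_in_lines
      dest!: subsetD[of T])

lemma card_triples_sum:
  assumes fin: "finite T" and X: "finite X"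
    and f: "inj_on (\<lambda>t. (f t, g t, h t)) T"
    and mem: "\<And>t. t \<in> T \<Longrightarrow> g t \<in> X \<inter> f t" "\<And>t. t \<in> T \<Longrightarrow> h t \<in> Y" "finite Y"
  shows "card T \<le> (\<Sum>l\<in>f ` T. card (X \<inter> l)) * card Y"
proof -
  have "card T \<le> card (Sigma (f ` T) (\<lambda>l. (X \<inter> l) \<times> Y))"
  proof (rule card_inj_on_le[OF f])
    show "(\<lambda>t. (f t, g t, h t)) ` T \<subseteq> (SIGMA l:f ` T. (X \<inter> l) \<times> Y)"
      using mem by (intro image_subsetI) simp
    show "finite (SIGMA l:f ` T. (X \<inter> l) \<times> Y)" using fin X mem(3) by (intro finite_SigmaI) auto
  qed
  also have "\<dots> = (\<Sum>l\<in>f ` T. card ((X \<inter> l) \<times> Y))"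
    using fin X mem(3) by (intro card_SigmaI) auto
  finally show ?thesis by (simp add: card_cartesian_product sum_distrib_right)
qed

section \<open>Rectangles with heavy legs\<close>

context
  fixes A B C D :: "pt set" and a b c d :: real and T :: "triple set"
  assumes fin: "finite A" "finite B" "finite C" "finite D"
    and cards: "card A \<le> 2 powr a" "card B \<le> 2 powr b" "card C \<le> 2 powr c" "card D \<le> 2 powr d"
    and T: "T \<subseteq> corners A B C D"
begin

lemma finT: "finite T"
  using finite_corners fin T by blast

lemma memT:
  assumes "t \<in> T"
  shows "fst t \<in> B" "fst (snd t) \<in> C" "snd (snd t) \<in> D" "fourth t \<in> A"
    "right_angle (fst t) (fst (snd t)) (snd (snd t))"
  using T assms by (auto simp: corners_def)

text \<open>A side line, a corner on it and the diagonally opposite corner determine the rectangle.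
  \<open>count_BD\<close> and \<open>count_CA\<close> rest on the same fact for other choices of
  side and diagonal.\<close>

lemma count_AC: "card T \<le> (\<Sum>l\<in>leg2 ` T. card (C \<inter> l)) * card A"
proof (rule card_triples_sum[OF finT fin(3), where g = "\<lambda>t. fst (snd t)" and h = fourth])
  show "inj_on (\<lambda>t. (leg2 t, fst (snd t), fourth t)) T"
  proof (rule inj_onI)
    fix t t' assume t: "t \<in> T" "t' \<in> T" and eq: "(leg2 t, fst (snd t), fourth t) = (leg2 t', fst (snd t'), fourth t')"
    obtain x y z where xyz: "t = (x, y, z)" by (rule prod_cases3)
    obtain x' y' z' where xyz': "t' = (x', y', z')" by (rule prod_cases3)
    have "right_angle z y x" "right_angle z' y x'" "line y z = line y z'" "z + x - y = z' + x' - y"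
      using memT(5)[OF t(1)] memT(5)[OF t(2)] eq right_angle_sym[of x y z] right_angle_sym[of x' y' z']
      by (auto simp: xyz xyz' leg2_def fourth_def add.commute)
    then show "t = t'" using fourth_vertex_inj eq xyz xyz' by auto
  qed
qed (use memT fin in \<open>auto simp: leg2_def line_points\<close>)

lemma count_BD: "card T \<le> (\<Sum>l\<in>leg2 ` T. card (D \<inter> l)) * card B"
proof (rule card_triples_sum[OF finT fin(4), where g = "\<lambda>t. snd (snd t)" and h = fst])
  show "inj_on (\<lambda>t. (leg2 t, snd (snd t), fst t)) T"
  proof (rule inj_onI)
    fix t t' assume t: "t \<in> T" "t' \<in> T" and eq: "(leg2 t, snd (snd t), fst t) = (leg2 t', snd (snd t'), fst t')"
    obtain x y z where xyz: "t = (x, y, z)" by (rule prod_cases3)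
    obtain x' y' z' where xyz': "t' = (x', y', z')" by (rule prod_cases3)
    have "right_angle x y z" "right_angle x y' z" "line y z = line y' z"
      using memT(5)[OF t(1)] memT(5)[OF t(2)] eq by (auto simp: xyz xyz' leg2_def)
    then show "t = t'" using foot_unique[of x y z y'] eq xyz xyz' by simp
  qed
qed (use memT fin in \<open>auto simp: leg2_def line_points\<close>)

lemma count_CA: "card T \<le> (\<Sum>l\<in>opp1 ` T. card (A \<inter> l)) * card C"
proof (rule card_triples_sum[OF finT fin(1), where g = fourth and h = "\<lambda>t. fst (snd t)"])
  show "inj_on (\<lambda>t. (opp1 t, fourth t, fst (snd t))) T"
  proof (rule inj_onI)
    fix t t' assume t: "t \<in> T" "t' \<in> T" and eq: "(opp1 t, fourth t, fst (snd t)) = (opp1 t', fourth t', fst (snd t'))"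
    obtain x y z where xyz: "t = (x, y, z)" by (rule prod_cases3)
    obtain x' y' z' where xyz': "t' = (x', y', z')" by (rule prod_cases3)
    have f: "fourth t' = fourth t" using eq by (simp only: prod.inject)
    have "opp1 t = opp1 t'" using eq by (simp only: prod.inject)
    then have "line (snd (snd t)) (fourth t) = line (snd (snd t')) (fourth t')" unfolding opp1_def .
    moreover have zz: "snd (snd t) = z" "snd (snd t') = z'" by (simp_all add: xyz xyz')
    ultimately have l: "line z (fourth t) = line z' (fourth t)" by (simp only: f)
    have y: "y' = y" using eq by (simp add: xyz xyz')
    have "right_angle y z (fourth t)" "right_angle y' z' (fourth t')"
      using right_angle_opposite(1)[OF memT(5)[OF t(1)]] right_angle_opposite(1)[OF memT(5)[OF t(2)]]
      unfolding fourth_def by (simp_all add: xyz xyz')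
    then have "z = z'" using foot_unique[of y z "fourth t" z'] f l y by simp
    then show "t = t'" using f y xyz xyz' by (simp add: fourth_def)
  qed
qed (use memT fin in \<open>auto simp: opp1_def line_points\<close>)

lemma heavy_D:
  assumes "\<And>t. t \<in> T \<Longrightarrow> 4 * 2 powr d \<le> (real (card (D \<inter> leg2 t)))\<^sup>2"
  shows "card T \<le> 2 * 2 powr (b + d)"
proof -
  have "real (card T) \<le> real (\<Sum>l\<in>leg2 ` T. card (D \<inter> l)) * card B"
    using of_nat_mono[OF count_BD, where 'a = real] by (simp only: of_nat_mult)
  also have "\<dots> \<le> (2 * 2 powr d) * 2 powr b"
    by (intro mult_mono heavy_sum) (use fin cards finT leg_lines[OF T] assms in auto)
  finally show ?thesis by (simp add: powr_add mult_ac)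
qed

lemma heavy_A:
  assumes "\<And>t. t \<in> T \<Longrightarrow> 4 * 2 powr a \<le> (real (card (A \<inter> opp1 t)))\<^sup>2"
  shows "card T \<le> 2 * 2 powr (a + c)"
proof -
  have "real (card T) \<le> real (\<Sum>l\<in>opp1 ` T. card (A \<inter> l)) * card C"
    using of_nat_mono[OF count_CA, where 'a = real] by (simp only: of_nat_mult)
  also have "\<dots> \<le> (2 * 2 powr a) * 2 powr c"
    by (intro mult_mono heavy_sum) (use fin cards finT leg_lines[OF T] assms in auto)
  finally show ?thesis by (simp add: powr_add mult_ac)
qed

text \<open>Dividing the bound of \<open>heavy_sum\<close> by the richness shows that
  \<open>(card L)\<^sup>2\<close> is at most a quarter of \<open>2 powr c\<close>, so
  \<open>incidences_le\<close> makes the incidences with \<open>C\<close> linear;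
  \<open>count_AC\<close> then replaces the diagonal \<open>B\<close>, \<open>D\<close> of
  \<open>heavy_D\<close> by \<open>A\<close>, \<open>C\<close>.\<close>

lemma top_D:
  assumes heavy: "\<And>t. t \<in> T \<Longrightarrow> 4 * 2 powr d \<le> (real (card (D \<inter> leg2 t)))\<^sup>2"
    and top: "\<And>t. t \<in> T \<Longrightarrow> 16 * 2 powr (2 * d) \<le> 2 powr c * (real (card (D \<inter> leg2 t)))\<^sup>2"
  shows "card T \<le> 2 * 2 powr (a + c)"
proof -
  define L where "L = leg2 ` T"
  have L: "finite L" "L \<subseteq> lines" using finT leg_lines[OF T] by (auto simp: L_def)
  have "4 * 2 powr d / 2 powr (c / 2) \<le> real (card (D \<inter> l))" if "l \<in> L" for l
  proof -
    have "(4 * 2 powr d / 2 powr (c / 2))\<^sup>2 = 16 * 2 powr (2 * d) / 2 powr c"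
      by (simp add: power_divide power_mult_distrib powr_add[symmetric] power2_eq_square)
    also have "\<dots> \<le> (real (card (D \<inter> l)))\<^sup>2"
      using top that by (auto simp: L_def divide_le_eq mult.commute)
    finally show ?thesis by (rule power2_le_imp_le) simp
  qed
  then have "real (card L) * (4 * 2 powr d / 2 powr (c / 2)) \<le> real (\<Sum>l\<in>L. card (D \<inter> l))"
    using sum_mono[of L "\<lambda>_. 4 * 2 powr d / 2 powr (c / 2)"] by simp
  also have "\<dots> \<le> 2 * 2 powr d"
    by (intro heavy_sum) (use fin cards L heavy in \<open>auto simp: L_def\<close>)
  finally have n: "real (card L) \<le> 2 powr (c / 2) / 2" by (simp add: field_simps)
  then have "(real (card L))\<^sup>2 \<le> (2 powr (c / 2) / 2)\<^sup>2" by (intro power_mono) auto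
  then have n2: "(real (card L))\<^sup>2 \<le> 2 powr c / 4"
    by (simp add: power_divide powr_add[symmetric] power2_eq_square)
  have "real (\<Sum>l\<in>L. card (C \<inter> l)) \<le> real (card C + (card L)\<^sup>2)"
    using incidences_le[OF fin(3) L] by (intro of_nat_mono)
  also have "\<dots> \<le> 2 * 2 powr c" using n2 cards by simp
  finally have I: "real (\<Sum>l\<in>L. card (C \<inter> l)) \<le> 2 * 2 powr c" .
  have "real (card T) \<le> real (\<Sum>l\<in>L. card (C \<inter> l)) * card A"
    using of_nat_mono[OF count_AC, where 'a = real] by (simp only: L_def of_nat_mult)
  also have "\<dots> \<le> (2 * 2 powr c) * 2 powr a"
    by (intro mult_mono I) (use cards in auto)
  finally show ?thesis by (simp add: powr_add mult_ac)
qed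

text \<open>Lines light for \<open>C\<close> carry at most \<open>2 * 2 powr (c / 2)\<close> points
  of \<open>C\<close>, and \<open>heavy_sum\<close> applies to \<open>D\<close>. On lines heavy for
  \<open>C\<close> the hypothesis \<open>mid\<close> bounds the points of \<open>D\<close>, and
  \<open>heavy_sum\<close> applies to \<open>C\<close>. The two parts give 4 + 8 = 12.\<close>

lemma mid_incidences:
  assumes heavy: "\<And>l. l \<in> L \<Longrightarrow> 4 * 2 powr d \<le> (real (card (D \<inter> l)))\<^sup>2"
    and mid: "\<And>l. l \<in> L \<Longrightarrow> 2 powr c * (real (card (D \<inter> l)))\<^sup>2 < 16 * 2 powr (2 * d)"
    and L: "finite L" "L \<subseteq> lines"
  shows "(\<Sum>l\<in>L. real (card (C \<inter> l)) * card (D \<inter> l)) \<le> 12 * 2 powr (c / 2 + d)"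
proof -
  define H where "H = {l \<in> L. 4 * 2 powr c \<le> (real (card (C \<inter> l)))\<^sup>2}"
  have up: "real (card (D \<inter> l)) \<le> 4 * 2 powr (d - c / 2)" if "l \<in> L" for l
  proof (rule power2_le_imp_le)
    have "(4 * 2 powr (d - c / 2))\<^sup>2 = 16 * 2 powr (2 * d) / 2 powr c"
      unfolding powr_diff[of 2 "2 * d" c, symmetric] times_divide_eq_right[symmetric]
      by (simp add: power_mult_distrib power2_eq_square powr_add[symmetric])
    then show "(real (card (D \<inter> l)))\<^sup>2 \<le> (4 * 2 powr (d - c / 2))\<^sup>2"
      using mid[OF that] by (simp add: le_divide_eq mult.commute)
  qed simp
  have low: "real (card (C \<inter> l)) \<le> 2 * 2 powr (c / 2)" if "l \<in> L - H" for l
  proof (rule power2_le_imp_le)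
    show "(real (card (C \<inter> l)))\<^sup>2 \<le> (2 * 2 powr (c / 2))\<^sup>2"
      using that by (auto simp: H_def power_mult_distrib power2_eq_square powr_add[symmetric])
  qed simp
  have "(\<Sum>l\<in>L. real (card (C \<inter> l)) * card (D \<inter> l))
      = (\<Sum>l\<in>L - H. real (card (C \<inter> l)) * card (D \<inter> l)) + (\<Sum>l\<in>H. real (card (C \<inter> l)) * card (D \<inter> l))"
    using L by (intro sum.subset_diff) (auto simp: H_def)
  also have "(\<Sum>l\<in>L - H. real (card (C \<inter> l)) * card (D \<inter> l)) \<le> (\<Sum>l\<in>L - H. 2 * 2 powr (c / 2) * card (D \<inter> l))"
    using low by (intro sum_mono mult_right_mono) auto
  also have "\<dots> = 2 * 2 powr (c / 2) * real (\<Sum>l\<in>L - H. card (D \<inter> l))" by (simp add: sum_distrib_left)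
  also have "\<dots> \<le> 2 * 2 powr (c / 2) * (2 * 2 powr d)"
    by (intro mult_left_mono heavy_sum) (use fin cards L heavy in auto)
  also have "(\<Sum>l\<in>H. real (card (C \<inter> l)) * card (D \<inter> l)) \<le> (\<Sum>l\<in>H. real (card (C \<inter> l)) * (4 * 2 powr (d - c / 2)))"
    using up by (intro sum_mono mult_left_mono) (auto simp: H_def)
  also have "\<dots> = real (\<Sum>l\<in>H. card (C \<inter> l)) * (4 * 2 powr (d - c / 2))" by (simp add: sum_distrib_right)
  also have "\<dots> \<le> (2 * 2 powr c) * (4 * 2 powr (d - c / 2))"
    by (intro mult_right_mono heavy_sum) (use fin cards L in \<open>auto simp: H_def\<close>)
  also have "2 * 2 powr (c / 2) * (2 * 2 powr d) + (2 * 2 powr c) * (4 * 2 powr (d - c / 2)) = 12 * 2 powr (c / 2 + d)"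
    by (simp add: powr_add[symmetric] algebra_simps)
  finally show ?thesis by simp
qed

end

section \<open>Fibres over pairs of a corner and a leg line\<close>

lemma card_le_fibers:
  fixes M :: real
  assumes "finite T" "\<And>q. q \<in> f ` T \<Longrightarrow> real (card {t \<in> T. f t = q}) \<le> M"
  shows "real (card T) \<le> card (f ` T) * M"
proof -
  have "T = (\<Union>q\<in>f ` T. {t \<in> T. f t = q})" by auto
  then have "card T \<le> (\<Sum>q\<in>f ` T. card {t \<in> T. f t = q})"
    using card_UN_le[of "f ` T" "\<lambda>q. {t \<in> T. f t = q}"] assms(1) by simp
  then have "real (card T) \<le> (\<Sum>q\<in>f ` T. real (card {t \<in> T. f t = q}))" by (simp flip: of_nat_sum)
  also have "\<dots> \<le> (\<Sum>q\<in>f ` T. M)" by (rule sum_mono[OF assms(2)])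
  finally show ?thesis by simp
qed

lemma leg1_perp: "T \<subseteq> corners A B C D \<Longrightarrow> t \<in> T \<Longrightarrow> leg1 t = perp (fst (snd t)) (leg2 t)"
  unfolding leg1_def leg2_def corners_def using perp_line right_angle_sym by blast

lemma leg2_perp: "T \<subseteq> corners A B C D \<Longrightarrow> t \<in> T \<Longrightarrow> leg2 t = perp (fst (snd t)) (leg1 t)"
  unfolding leg1_def leg2_def corners_def using perp_line right_angle_sym by blast

abbreviation pairs1 :: "triple set \<Rightarrow> (pt \<times> pt set) set" where
  "pairs1 T \<equiv> (\<lambda>t. (fst (snd t), leg1 t)) ` T"

abbreviation pairs2 :: "triple set \<Rightarrow> (pt \<times> pt set) set" where
  "pairs2 T \<equiv> (\<lambda>t. (fst (snd t), leg2 t)) ` T"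

lemma pairs_flip: "pairs1 (flip ` T) = pairs2 T" "pairs2 (flip ` T) = pairs1 T"
  by (simp_all add: image_image)

text \<open>At a given corner each leg line is the perpendicular of the other. This allows one
  quantity to be bounded through the richness of either leg.\<close>

lemma card_pairs_eq:
  assumes "finite T" "T \<subseteq> corners A B C D"
  shows "card (pairs1 T) = card (pairs2 T)"
proof (rule antisym)
  have "pairs1 T = (\<lambda>p. (fst p, perp (fst p) (snd p))) ` pairs2 T"
    using leg1_perp[OF assms(2)] by (simp add: image_image)
  then show "card (pairs1 T) \<le> card (pairs2 T)" using card_image_le[of "pairs2 T"] assms(1) by simp
  have "pairs2 T = (\<lambda>p. (fst p, perp (fst p) (snd p))) ` pairs1 T"
    using leg2_perp[OF assms(2)] by (simp add: image_image)
  then show "card (pairs2 T) \<le> card (pairs1 T)" using card_image_le[of "pairs1 T"] assms(1) by simp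
qed

lemma card_pairs2_le:
  assumes "finite T" "finite C" "T \<subseteq> corners A B C D"
  shows "card (pairs2 T) \<le> (\<Sum>l\<in>leg2 ` T. card (C \<inter> l))"
proof -
  have "card (pairs2 T) \<le> card (Sigma (leg2 ` T) (\<lambda>l. C \<inter> l))"
  proof (rule card_inj_on_le[of prod.swap])
    show "prod.swap ` pairs2 T \<subseteq> Sigma (leg2 ` T) (\<lambda>l. C \<inter> l)"
    proof (rule image_subsetI)
      fix p assume "p \<in> pairs2 T"
      then obtain t where t: "t \<in> T" "p = (fst (snd t), leg2 t)" by blast
      have "fst (snd t) \<in> C" using subsetD[OF assms(3) t(1)] by (simp add: corners_def)
      moreover have "fst (snd t) \<in> leg2 t" by (simp add: leg2_def line_points)
      ultimately show "prod.swap p \<in> Sigma (leg2 ` T) (\<lambda>l. C \<inter> l)" using t by simp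
    qed
    show "finite (Sigma (leg2 ` T) (\<lambda>l. C \<inter> l))" using assms by (intro finite_SigmaI) auto
  qed simp
  then show ?thesis using assms by simp
qed

lemma power_light:
  fixes d :: real
  assumes "2 ^ k \<le> r" "(real r)\<^sup>2 < 4 * 2 powr d"
  shows "4 ^ k \<le> 4 * 2 powr d" "2 * real k < 2 + d"
proof -
  have "(2::real) ^ k \<le> real r" using assms(1) by (simp flip: of_nat_le_iff)
  then have "((2::real) ^ k)\<^sup>2 \<le> (real r)\<^sup>2" by (rule power_mono) simp
  moreover have e: "((2::real) ^ k)\<^sup>2 = 4 ^ k" by (simp add: power2_eq_square flip: power_mult_distrib)
  ultimately have *: "4 ^ k < 4 * 2 powr d" using assms(2) by linarith
  then show "4 ^ k \<le> 4 * 2 powr d" by simp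
  have "2 powr (2 * real k) < 2 powr (2 + d)"
    using * e by (simp add: powr_add powr_realpow[symmetric] power2_eq_square flip: powr_add) (simp add: powr_add)
  then show "2 * real k < 2 + d" by simp
qed

text \<open>For \<open>k \<ge> 1\<close> these are the two lower-order terms of the incidence
  theorem, the number of points and the number of rich lines, for sets of sizes
  \<open>2 powr x\<close> and \<open>2 powr z\<close>. Each is paired by \<open>min\<close> with a
  second bound that makes the later sums over \<open>k\<close> converge. For light legs
  \<open>4 + 2 * z - 4 * k\<close> is positive, so the first \<open>min\<close> equals
  \<open>2 powr x\<close>; \<open>2 powr (x + z - k)\<close> is the trivial count, which also serves
  for \<open>k = 0\<close>.\<close>

definition light_bound :: "real \<Rightarrow> real \<Rightarrow> nat \<Rightarrow> real" where
  "light_bound x z k = (if k = 0 then 2 powr (x + z) else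
     min (2 powr x) (2 powr (x + 4 + 2 * z - 4 * k)) + min (2 powr (x + z - k)) (2 powr (2 * z - 3 * k)))"

context
  fixes A B C D :: "pt set" and a b c d :: real and T :: "triple set"
  assumes fin: "finite A" "finite B" "finite C" "finite D"
    and cards: "card A \<le> 2 powr a" "card B \<le> 2 powr b" "card C \<le> 2 powr c" "card D \<le> 2 powr d"
    and T: "T \<subseteq> corners A B C D"
begin

lemma mid_incidences_legs:
  assumes heavy: "\<And>t. t \<in> T \<Longrightarrow> 4 * 2 powr d \<le> (real (card (D \<inter> leg2 t)))\<^sup>2"
    and mid: "\<And>t. t \<in> T \<Longrightarrow> 2 powr c * (real (card (D \<inter> leg2 t)))\<^sup>2 < 16 * 2 powr (2 * d)"
  shows "(\<Sum>l\<in>leg2 ` T. real (card (C \<inter> l)) * card (D \<inter> l)) \<le> 12 * 2 powr (c / 2 + d)"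
proof (rule mid_incidences[OF fin cards T])
  show "finite (leg2 ` T)" using finT[OF fin cards T] by simp
  show "leg2 ` T \<subseteq> lines" using leg_lines(2)[OF T] by blast
qed (use heavy mid in blast)+

text \<open>The second leg line with its corners in \<open>C\<close> and \<open>D\<close> is counted
  by \<open>mid_incidences\<close>; these data fix the first leg line, which is light and so offers
  at most \<open>2 * 2 powr (b / 2)\<close> choices for the last corner.\<close>

lemma mid_light:
  assumes heavy: "\<And>t. t \<in> T \<Longrightarrow> 4 * 2 powr d \<le> (real (card (D \<inter> leg2 t)))\<^sup>2"
    and mid: "\<And>t. t \<in> T \<Longrightarrow> 2 powr c * (real (card (D \<inter> leg2 t)))\<^sup>2 < 16 * 2 powr (2 * d)"
    and light: "\<And>t. t \<in> T \<Longrightarrow> (real (card (B \<inter> leg1 t)))\<^sup>2 < 4 * 2 powr b"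
  shows "card T \<le> 24 * 2 powr ((b + c) / 2 + d)"
proof -
  let ?f = "\<lambda>t. (leg2 t, fst (snd t), snd (snd t))"
  have "real (card T) \<le> card (?f ` T) * (2 * 2 powr (b / 2))"
  proof (rule card_le_fibers[OF finT[OF fin cards T]])
    fix q assume "q \<in> ?f ` T"
    then obtain t0 where t0: "t0 \<in> T" "q = ?f t0" by blast
    have "card {t \<in> T. ?f t = q} \<le> card (B \<inter> leg1 t0)"
    proof (rule card_inj_on_le[of fst])
      show "inj_on fst {t \<in> T. ?f t = q}" by (auto simp: inj_on_def prod_eq_iff t0)
      show "fst ` {t \<in> T. ?f t = q} \<subseteq> B \<inter> leg1 t0"
      proof (rule image_subsetI)
        fix t assume "t \<in> {t \<in> T. ?f t = q}"
        then have t: "t \<in> T" "leg2 t = leg2 t0" "fst (snd t) = fst (snd t0)" by (auto simp: t0)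
        then have "leg1 t = leg1 t0" using leg1_perp[OF T] t0(1) by metis
        moreover have "fst t \<in> leg1 t" by (simp add: leg1_def line_points)
        ultimately show "fst t \<in> B \<inter> leg1 t0" using memT(1)[OF fin cards T t(1)] by simp
      qed
    qed (use fin in simp)
    moreover have "real (card (B \<inter> leg1 t0)) \<le> 2 * 2 powr (b / 2)"
    proof (rule power2_le_imp_le)
      show "(real (card (B \<inter> leg1 t0)))\<^sup>2 \<le> (2 * 2 powr (b / 2))\<^sup>2"
        using light[OF t0(1)] by (simp add: power_mult_distrib power2_eq_square powr_add[symmetric])
    qed simp
    ultimately show "real (card {t \<in> T. ?f t = q}) \<le> 2 * 2 powr (b / 2)" by linarith
  qed
  also have "card (?f ` T) \<le> card (Sigma (leg2 ` T) (\<lambda>l. (C \<inter> l) \<times> (D \<inter> l)))"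
  proof (rule card_mono)
    show "finite (Sigma (leg2 ` T) (\<lambda>l. (C \<inter> l) \<times> (D \<inter> l)))" using fin finT[OF fin cards T] by (intro finite_SigmaI) auto
    show "?f ` T \<subseteq> Sigma (leg2 ` T) (\<lambda>l. (C \<inter> l) \<times> (D \<inter> l))"
      using memT[OF fin cards T] by (intro image_subsetI) (simp add: leg2_def line_points mem_Times_iff)
  qed
  also have "\<dots> = (\<Sum>l\<in>leg2 ` T. card (C \<inter> l) * card (D \<inter> l))"
    using fin finT[OF fin cards T] by (simp add: card_cartesian_product)
  also have "real \<dots> \<le> 12 * 2 powr (c / 2 + d)"
    using mid_incidences_legs[OF heavy mid] by simp
  finally have "real (card T) \<le> 12 * 2 powr (c / 2 + d) * (2 * 2 powr (b / 2))" by simp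
  then show ?thesis by (simp add: powr_add[symmetric] add_divide_distrib algebra_simps)
qed

lemma mid_pairs:
  assumes heavy: "\<And>t. t \<in> T \<Longrightarrow> 4 * 2 powr d \<le> (real (card (D \<inter> leg2 t)))\<^sup>2"
    and mid: "\<And>t. t \<in> T \<Longrightarrow> 2 powr c * (real (card (D \<inter> leg2 t)))\<^sup>2 < 16 * 2 powr (2 * d)"
    and k: "\<And>t. t \<in> T \<Longrightarrow> 2 ^ k \<le> card (D \<inter> leg2 t)"
  shows "card (pairs2 T) \<le> 12 * 2 powr (c / 2 + d - k)"
proof -
  have "real (card (pairs2 T)) * 2 ^ k \<le> (\<Sum>l\<in>leg2 ` T. real (card (C \<inter> l))) * 2 ^ k"
    using of_nat_mono[OF card_pairs2_le[OF finT[OF fin cards T] fin(3) T], where 'a = real] by (intro mult_right_mono) auto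
  also have "\<dots> = (\<Sum>l\<in>leg2 ` T. real (card (C \<inter> l)) * 2 ^ k)" by (rule sum_distrib_right)
  also have "\<dots> \<le> (\<Sum>l\<in>leg2 ` T. real (card (C \<inter> l)) * card (D \<inter> l))"
    using of_nat_mono[OF k, where 'a = real] by (intro sum_mono mult_left_mono) auto
  also have "\<dots> \<le> 12 * 2 powr (c / 2 + d)"
    using mid_incidences_legs[OF heavy mid] by simp
  finally have "real (card (pairs2 T)) \<le> 12 * 2 powr (c / 2 + d) / 2 ^ k" by (simp add: pos_le_divide_eq)
  also have "\<dots> = 12 * 2 powr (c / 2 + d - k)" by (simp add: powr_diff[of 2 "c / 2 + d"] powr_realpow)
  finally show ?thesis .
qed

lemma fiber_legs:
  assumes one: "\<And>t. t \<in> T \<Longrightarrow> (fst (snd t), leg1 t) = (y, l)"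
    and k: "\<And>t. t \<in> T \<Longrightarrow> card (B \<inter> leg1 t) \<le> p" "\<And>t. t \<in> T \<Longrightarrow> card (D \<inter> leg2 t) \<le> q"
  shows "card T \<le> p * q"
proof (cases "T = {}")
  case False
  then obtain t0 where t0: "t0 \<in> T" by blast
  have "leg2 t = leg2 t0" if "t \<in> T" for t using leg2_perp[OF T] one[OF that] one[OF t0] that t0 by simp
  then have legs: "leg2 t = leg2 t0" "leg1 t = leg1 t0" if "t \<in> T" for t using one[OF that] one[OF t0] that by auto
  have "card T \<le> card ((B \<inter> leg1 t0) \<times> (D \<inter> leg2 t0))"
  proof (rule card_inj_on_le[of "\<lambda>t. (fst t, snd (snd t))"])
    show "inj_on (\<lambda>t. (fst t, snd (snd t))) T" using one by (auto simp: inj_on_def prod_eq_iff)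
    show "(\<lambda>t. (fst t, snd (snd t))) ` T \<subseteq> (B \<inter> leg1 t0) \<times> (D \<inter> leg2 t0)"
    proof (rule image_subsetI)
      fix t assume t: "t \<in> T"
      have "fst t \<in> leg1 t" "snd (snd t) \<in> leg2 t" by (simp_all add: leg1_def leg2_def line_points)
      then show "(fst t, snd (snd t)) \<in> (B \<inter> leg1 t0) \<times> (D \<inter> leg2 t0)" using memT[OF fin cards T t] legs[OF t] by simp
    qed
  qed (use fin in simp)
  also have "\<dots> = card (B \<inter> leg1 t0) * card (D \<inter> leg2 t0)" by (rule card_cartesian_product)
  also have "\<dots> \<le> p * q" using k[OF t0] by (intro mult_mono) auto
  finally show ?thesis .
qed simp

lemma fiber_fourth:
  assumes one: "\<And>t. t \<in> T \<Longrightarrow> (fst (snd t), leg1 t) = (y, l)"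
  shows "inj_on fourth T"
proof (rule inj_onI)
  fix t t' assume t: "t \<in> T" "t' \<in> T" and eq: "fourth t = fourth t'"
  obtain x u z where xyz: "t = (x, u, z)" by (rule prod_cases3)
  obtain x' u' z' where xyz': "t' = (x', u', z')" by (rule prod_cases3)
  have u: "u = y" "u' = y" "line y x = line y x'"
    using one[OF t(1)] one[OF t(2)] by (auto simp: xyz xyz' leg1_def)
  have "right_angle x y z" "right_angle x' y z'" using memT(5)[OF fin cards T t(1)] memT(5)[OF fin cards T t(2)] u by (simp_all add: xyz xyz')
  from fourth_vertex_inj[OF this u(3)] eq show "t = t'" by (simp add: xyz xyz' u fourth_def)
qed

text \<open>Once the corner, the line of the first leg and the corner in \<open>D\<close> are fixed,
  the opposite side lies on a fixed parallel line, and lightness of that line bounds the choices of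
  the fourth corner.\<close>

lemma fiber_opp:
  assumes one: "\<And>t. t \<in> T \<Longrightarrow> (fst (snd t), leg1 t) = (y, l)"
    and q: "\<And>t. t \<in> T \<Longrightarrow> card (D \<inter> leg2 t) \<le> q"
    and light: "\<And>t. t \<in> T \<Longrightarrow> (real (card (A \<inter> opp1 t)))\<^sup>2 < 4 * 2 powr a"
  shows "card T \<le> q * (2 * 2 powr (a / 2))"
proof (cases "T = {}")
  case False
  then obtain t1 where t1: "t1 \<in> T" by blast
  have "real (card T) \<le> card ((\<lambda>t. snd (snd t)) ` T) * (2 * 2 powr (a / 2))"
  proof (rule card_le_fibers[OF finT[OF fin cards T]])
    fix z assume "z \<in> (\<lambda>t. snd (snd t)) ` T"
    then obtain t0 where t0: "t0 \<in> T" "z = snd (snd t0)" by blast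
    have "card {t \<in> T. snd (snd t) = z} \<le> card (A \<inter> opp1 t0)"
    proof (rule card_inj_on_le[of fourth])
      show "inj_on fourth {t \<in> T. snd (snd t) = z}" using fiber_fourth[OF one] by (rule inj_on_subset) auto
      show "fourth ` {t \<in> T. snd (snd t) = z} \<subseteq> A \<inter> opp1 t0"
      proof (rule image_subsetI)
        fix t assume "t \<in> {t \<in> T. snd (snd t) = z}"
        then have t: "t \<in> T" "snd (snd t) = z" by auto
        have o: "fst (snd t) = y" "leg1 t = l" "fst (snd t0) = y" "leg1 t0 = l"
          using one[OF t(1)] one[OF t0(1)] by simp_all
        have "right_angle (fst t) y z" using memT(5)[OF fin cards T t(1)] o t(2) by simp
        moreover have "right_angle (fst t0) y z" using memT(5)[OF fin cards T t0(1)] o t0(2) by simp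
        moreover have "line y (fst t) = line y (fst t0)" using o unfolding leg1_def by simp
        ultimately have "line z (fst t + z - y) = line z (fst t0 + z - y)" by (rule parallel_line)
        then have "opp1 t = opp1 t0" using o t(2) t0(2) by (simp add: opp1_def fourth_def)
        moreover have "fourth t \<in> opp1 t" by (simp add: opp1_def line_points)
        ultimately show "fourth t \<in> A \<inter> opp1 t0" using memT[OF fin cards T t(1)] by simp
      qed
    qed (use fin in simp)
    moreover have "real (card (A \<inter> opp1 t0)) \<le> 2 * 2 powr (a / 2)"
    proof (rule power2_le_imp_le)
      show "(real (card (A \<inter> opp1 t0)))\<^sup>2 \<le> (2 * 2 powr (a / 2))\<^sup>2"
        using light[OF t0(1)] by (simp add: power_mult_distrib power2_eq_square powr_add[symmetric])
    qed simp
    ultimately show "real (card {t \<in> T. snd (snd t) = z}) \<le> 2 * 2 powr (a / 2)" by linarith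
  qed
  also have "card ((\<lambda>t. snd (snd t)) ` T) \<le> card (D \<inter> leg2 t1)"
  proof (rule card_mono)
    show "(\<lambda>t. snd (snd t)) ` T \<subseteq> D \<inter> leg2 t1"
    proof (rule image_subsetI)
      fix t assume t: "t \<in> T"
      have "leg2 t = leg2 t1" using leg2_perp[OF T] one[OF t] one[OF t1] t t1 by simp
      moreover have "snd (snd t) \<in> leg2 t" by (simp add: leg2_def line_points)
      ultimately show "snd (snd t) \<in> D \<inter> leg2 t1" using memT[OF fin cards T t] by simp
    qed
  qed (use fin in simp)
  also have "card (D \<inter> leg2 t1) \<le> q" by (rule q[OF t1])
  finally show ?thesis by (simp add: mult_right_mono)
qed simp

text \<open>The corner and any further point of \<open>D\<close> on the leg determine the leg line,
  so such pairs inject into \<open>C \<times> D\<close>. Excluding the corner itself loses at most a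
  factor 2, because the corner in \<open>D\<close> always remains.\<close>

lemma pairs_trivial:
  assumes k: "\<And>t. t \<in> T \<Longrightarrow> 2 ^ k \<le> card (D \<inter> leg2 t)"
  shows "card (pairs2 T) \<le> 2 * 2 powr (c + d - k)"
proof -
  let ?S = "Sigma (pairs2 T) (\<lambda>p. D \<inter> snd p - {fst p})"
  have half: "real (2 ^ k) / 2 \<le> real (card (D \<inter> snd p - {fst p}))" if p: "p \<in> pairs2 T" for p
  proof -
    obtain t where t: "t \<in> T" "p = (fst (snd t), leg2 t)" using p by blast
    have "snd (snd t) \<in> D \<inter> snd p - {fst p}"
      using memT[OF fin cards T t(1)] by (simp add: t leg2_def line_points right_angle_def)
    then have "D \<inter> snd p - {fst p} \<noteq> {}" by blast
    then have "card (D \<inter> snd p - {fst p}) \<ge> 1" using fin by (simp add: Suc_le_eq card_gt_0_iff)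
    moreover have "card (D \<inter> snd p) - 1 \<le> card (D \<inter> snd p - {fst p})"
      by (simp add: card_Diff_singleton_if)
    moreover have "2 ^ k \<le> card (D \<inter> snd p)" using k[OF t(1)] by (simp add: t)
    ultimately have "2 ^ k \<le> 2 * card (D \<inter> snd p - {fst p})" by linarith
    from of_nat_mono[OF this, where 'a = real] show ?thesis by simp
  qed
  have "inj_on (\<lambda>a. (fst (fst a), snd a)) ?S"
  proof (rule inj_onI)
    fix p q assume p: "p \<in> ?S" and q: "q \<in> ?S" and eq: "(fst (fst p), snd p) = (fst (fst q), snd q)"
    have ln: "snd (fst r) = line (fst (fst r)) (snd r)" if r: "r \<in> ?S" for r
    proof -
      have *: "fst r \<in> pairs2 T \<and> snd r \<in> D \<inter> snd (fst r) - {fst (fst r)}"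
        using r by (cases r) (simp only: mem_Sigma_iff fst_conv snd_conv)
      then obtain t where t: "t \<in> T" "fst r = (fst (snd t), leg2 t)" by blast
      have r: "snd r \<in> leg2 t" "snd r \<noteq> fst (snd t)" using t * by simp_all
      have "fst (snd t) \<in> leg2 t" by (simp add: leg2_def line_points)
      then have "leg2 t = line (fst (snd t)) (snd r)"
        using lines_unique[OF leg_lines(2)[OF T t(1)]] r by simp
      then show ?thesis by (simp add: t)
    qed
    have f: "fst (fst p) = fst (fst q)" "snd p = snd q" using eq by (simp_all only: prod.inject)
    then have "snd (fst p) = snd (fst q)" using ln[OF p] ln[OF q] by (simp only:)
    then show "p = q" using f by (intro prod_eqI) simp_all
  qed
  moreover have "(\<lambda>a. (fst (fst a), snd a)) ` ?S \<subseteq> C \<times> D"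
    using memT[OF fin cards T] by (intro image_subsetI) fastforce
  ultimately have "card ?S \<le> card (C \<times> D)" by (rule card_inj_on_le) (use fin in simp)
  have "real (card (pairs2 T)) * (2 ^ k / 2) = (\<Sum>p\<in>pairs2 T. real (2 ^ k) / 2)" by simp
  also have "\<dots> \<le> (\<Sum>p\<in>pairs2 T. real (card (D \<inter> snd p - {fst p})))" by (rule sum_mono[OF half])
  also have "\<dots> = real (card ?S)" using fin finT[OF fin cards T] by simp
  also have "\<dots> \<le> real (card (C \<times> D))" using \<open>card ?S \<le> card (C \<times> D)\<close> by simp
  also have "\<dots> \<le> 2 powr c * 2 powr d"
    unfolding card_cartesian_product of_nat_mult using cards by (intro mult_mono) auto
  finally have "real (card (pairs2 T)) \<le> 2 * 2 powr (c + d) / 2 ^ k"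
    by (simp add: pos_le_divide_eq powr_add)
  also have "\<dots> = 2 * 2 powr (c + d - k)" by (simp add: powr_diff[of 2 "c + d"] powr_realpow)
  finally show ?thesis .
qed

text \<open>The lines with \<open>2 ^ k\<close> points of \<open>D\<close> are few by
  \<open>card_rich_lines_le\<close>, and the incidence theorem is applied to them with
  \<open>C\<close>. The first summand is its main term, with \<open>576 = 13824 powr (2/3)\<close>;
  the lower-order terms go into \<open>light_bound\<close>.\<close>

lemma light_pairs:
  assumes k: "\<And>t. t \<in> T \<Longrightarrow> 2 ^ k \<le> card (D \<inter> leg2 t)"
    and light: "\<And>t. t \<in> T \<Longrightarrow> (real (card (D \<inter> leg2 t)))\<^sup>2 < 4 * 2 powr d"
  shows "card (pairs2 T) \<le> 27648 * (2 powr (2/3 * c + 4/3 * d - 2 * k) + light_bound c d k)"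
proof (cases "T = {} \<or> k = 0")
  case True
  then show ?thesis
  proof
    assume "T = {}"
    then show ?thesis by (simp add: light_bound_def)
  next
    assume [simp]: "k = 0"
    have "real (card (pairs2 T)) \<le> 2 * 2 powr (c + d)" using pairs_trivial[OF k] by simp
    also have "\<dots> \<le> 27648 * 2 powr (c + d)" by simp
    also have "\<dots> \<le> 27648 * (2 powr (2/3 * c + 4/3 * d - 2 * k) + light_bound c d k)"
      by (intro mult_left_mono) (auto simp: light_bound_def)
    finally show ?thesis by simp
  qed
next
  case False
  then have k1: "k \<ge> 1" by simp
  from False obtain t0 where t0: "t0 \<in> T" by blast
  note lt = power_light[OF k[OF t0] light[OF t0]]
  let ?L = "leg2 ` T"
  have L: "finite ?L" "?L \<subseteq> lines" using finT[OF fin cards T] leg_lines(2)[OF T] by blast+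
  have e: "x / 8 ^ k = x * 2 powr (- 3 * real k)" for x :: real
  proof -
    have "(8::real) ^ k = (2 ^ 3) ^ k" by simp
    also have "\<dots> = 2 powr (3 * real k)" by (simp only: power_mult[symmetric]) (simp add: powr_realpow[symmetric])
    finally show ?thesis by (simp add: powr_minus divide_inverse)
  qed
  have "real (card ?L) \<le> 13824 * (2 powr d)\<^sup>2 / 8 ^ k"
    by (rule card_rich_lines_le[OF fin(4) cards(4) L _ k1 lt(1)]) (use k in blast)
  also have "\<dots> = 13824 * 2 powr (2 * d - 3 * k)"
    unfolding e by (simp add: power2_eq_square powr_add[symmetric])
  finally have n: "real (card ?L) \<le> 13824 * 2 powr (2 * d - 3 * k)" .
  have "real (card (pairs2 T)) \<le> real (\<Sum>l\<in>?L. card (C \<inter> l))"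
    by (rule of_nat_mono[OF card_pairs2_le[OF finT[OF fin cards T] fin(3) T]])
  also have "\<dots> \<le> 2 * card ?L + 8 * card C + 6 * (real (card C) * card ?L) powr (2/3)"
    using lattice_szemeredi_trotter[OF fin(3) L] by simp
  also have "\<dots> \<le> 2 * (13824 * 2 powr (2 * d - 3 * k)) + 8 * 2 powr c
      + 6 * (2 powr c * (13824 * 2 powr (2 * d - 3 * k))) powr (2/3)"
    using n cards by (intro add_mono mult_left_mono powr_mono2 mult_mono) auto
  also have "(2 powr c * (13824 * 2 powr (2 * d - 3 * k))) powr (2/3) = 576 * 2 powr (2/3 * c + 4/3 * d - 2 * k)"
  proof -
    have "(13824::real) powr (2/3) = (24 powr 3) powr (2/3)" by simp
    also have "\<dots> = 576" unfolding powr_powr by simp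
    finally have "(13824::real) powr (2/3) = 576" .
    then show ?thesis by (simp add: powr_mult powr_powr powr_add[symmetric] algebra_simps)
  qed
  also have "2 * (13824 * 2 powr (2 * d - 3 * k)) + 8 * 2 powr c + 6 * (576 * 2 powr (2/3 * c + 4/3 * d - 2 * k))
      \<le> 27648 * (2 powr (2 * d - 3 * k) + 2 powr c + 2 powr (2/3 * c + 4/3 * d - 2 * k))"
  proof -
    have "2 * (13824 * x) + 8 * y + 6 * (576 * z) \<le> 27648 * (x + y + z)" if "y \<ge> 0" "z \<ge> 0" for x y z :: real
      using that by simp
    then show ?thesis by simp
  qed
  finally have 1: "real (card (pairs2 T))
      \<le> 27648 * (2 powr (2 * d - 3 * k) + 2 powr c + 2 powr (2/3 * c + 4/3 * d - 2 * k))" .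
  have 2: "real (card (pairs2 T)) \<le> 2 * 2 powr (c + d - k)" by (rule pairs_trivial[OF k])
  \<comment> \<open>Lightness gives \<open>2 * k < 2 + d\<close>, so the second entry of the
    \<open>min\<close> is the larger one.\<close>
  have m: "min (2 powr c) (2 powr (c + 4 + 2 * d - 4 * k)) = 2 powr c" using lt(2) by (simp add: min_def)
  show ?thesis
  proof (cases "2 powr (c + d - k) \<le> 2 powr (2 * d - 3 * k)")
    case True
    then have "light_bound c d k = 2 powr c + 2 powr (c + d - k)" using k1 m by (simp add: light_bound_def min_def)
    moreover have "2 * x \<le> 27648 * (z + (y + x))" if "x \<ge> 0" "y \<ge> 0" "z \<ge> 0" for x y z :: real
      using that by simp
    ultimately show ?thesis using order_trans[OF 2] by simp
  next
    case False
    then have "light_bound c d k = 2 powr c + 2 powr (2 * d - 3 * k)" using k1 m by (simp add: light_bound_def min_def)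
    then show ?thesis using 1 by (simp add: algebra_simps)
  qed
qed

end

section \<open>Sums over dyadic scales\<close>

lemma geometric_le:
  fixes r :: real
  assumes "0 \<le> r" "r < 1"
  shows "(\<Sum>i<n. r ^ i) \<le> 1 / (1 - r)"
proof -
  have "(\<Sum>i<n. r ^ i) \<le> (\<Sum>i. r ^ i)"
    using assms by (intro sum_le_suminf summable_geometric) auto
  then show ?thesis using assms by (simp add: suminf_geometric)
qed

definition dyadic_const :: "real \<Rightarrow> real \<Rightarrow> real" where
  "dyadic_const u v = 1 / (1 - 2 powr (- u)) + 1 / (1 - 2 powr (- v))"

lemma powr_less_one': "u > 0 \<Longrightarrow> (2::real) powr (- u) < 1"
  using powr_less_mono[of "- u" 0 2] by simp

lemma dyadic_const_pos: "u > 0 \<Longrightarrow> v > 0 \<Longrightarrow> dyadic_const u v > 0"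
  unfolding dyadic_const_def by (intro add_pos_pos divide_pos_pos) (auto simp: powr_less_one')

text \<open>The rising and the falling sequence cross at \<open>k0\<close> with common value
  \<open>2 powr e\<close>; away from \<open>k0\<close> the minimum decays geometrically on both
  sides.\<close>

lemma dyadic_sum:
  fixes p q u v :: real
  assumes u: "u > 0" and v: "v > 0"
  shows "(\<Sum>k<n. min (2 powr (p + u * real k)) (2 powr (q - v * real k)))
           \<le> dyadic_const u v * 2 powr ((v * p + u * q) / (u + v))"
proof -
  define k0 where "k0 = (q - p) / (u + v)"
  define e where "e = (v * p + u * q) / (u + v)"
  have uv: "u + v > 0" using u v by simp
  have e1: "p + u * k0 = e" "q - v * k0 = e"
    using uv by (simp_all add: k0_def e_def field_simps)
  define j where "j = nat \<lfloor>k0\<rfloor>"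
  define i where "i = nat \<lceil>k0\<rceil>"
  have 1: "(\<Sum>k\<in>{k\<in>{..<n}. real k \<le> k0}. 2 powr (u * (real k - k0))) \<le> 1 / (1 - 2 powr (- u))"
  proof -
    have "(\<Sum>k\<in>{k\<in>{..<n}. real k \<le> k0}. 2 powr (u * (real k - k0))) \<le> (\<Sum>k\<in>{k\<in>{..<n}. real k \<le> k0}. (2 powr (- u)) ^ (j - k))"
    proof (rule sum_mono)
      fix k assume "k \<in> {k\<in>{..<n}. real k \<le> k0}"
      then have k: "real k \<le> k0" by simp
      then have kj: "k \<le> j" by (simp add: j_def le_nat_floor)
      have "real j \<le> k0" using k by (simp add: j_def)
      then have "u * (real k - k0) \<le> - u * real (j - k)" using kj u by (simp add: of_nat_diff algebra_simps)
      then have "2 powr (u * (real k - k0)) \<le> 2 powr (- u * real (j - k))" by simp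
      also have "\<dots> = (2 powr (- u)) ^ (j - k)" by (simp only: powr_powr[symmetric]) (simp add: powr_realpow)
      finally show "2 powr (u * (real k - k0)) \<le> (2 powr (- u)) ^ (j - k)" .
    qed
    also have "\<dots> = (\<Sum>l\<in>(\<lambda>k. j - k) ` {k\<in>{..<n}. real k \<le> k0}. (2 powr (- u)) ^ l)"
    proof (subst sum.reindex)
      show "inj_on (\<lambda>k. j - k) {k\<in>{..<n}. real k \<le> k0}"
      proof (rule inj_onI)
        fix k l assume "k \<in> {k\<in>{..<n}. real k \<le> k0}" "l \<in> {k\<in>{..<n}. real k \<le> k0}" "j - k = j - l"
        moreover from this have "k \<le> j" "l \<le> j" by (simp_all add: j_def le_nat_floor)
        ultimately show "k = l" by linarith
      qed
    qed simp
    also have "\<dots> \<le> (\<Sum>l<Suc j. (2 powr (- u)) ^ l)" by (rule sum_mono2) auto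
    also have "\<dots> \<le> 1 / (1 - 2 powr (- u))" using u by (intro geometric_le) (auto simp: powr_less_one')
    finally show ?thesis .
  qed
  have 2: "(\<Sum>k\<in>{k\<in>{..<n}. \<not> real k \<le> k0}. 2 powr (- v * (real k - k0))) \<le> 1 / (1 - 2 powr (- v))"
  proof -
    have ik: "i \<le> k" if "\<not> real k \<le> k0" for k using that by (simp add: i_def nat_le_iff ceiling_le_iff)
    have "(\<Sum>k\<in>{k\<in>{..<n}. \<not> real k \<le> k0}. 2 powr (- v * (real k - k0))) \<le> (\<Sum>k\<in>{k\<in>{..<n}. \<not> real k \<le> k0}. (2 powr (- v)) ^ (k - i))"
    proof (rule sum_mono)
      fix k assume "k \<in> {k\<in>{..<n}. \<not> real k \<le> k0}"
      then have k: "i \<le> k" using ik by simp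
      have "k0 \<le> real i" by (simp add: i_def real_nat_ceiling_ge)
      then have "- v * (real k - k0) \<le> - v * real (k - i)" using k v by (simp add: of_nat_diff algebra_simps)
      then have "2 powr (- v * (real k - k0)) \<le> 2 powr (- v * real (k - i))" by simp
      also have "\<dots> = (2 powr (- v)) ^ (k - i)" by (simp only: powr_powr[symmetric]) (simp add: powr_realpow)
      finally show "2 powr (- v * (real k - k0)) \<le> (2 powr (- v)) ^ (k - i)" .
    qed
    also have "\<dots> = (\<Sum>l\<in>(\<lambda>k. k - i) ` {k\<in>{..<n}. \<not> real k \<le> k0}. (2 powr (- v)) ^ l)"
    proof (subst sum.reindex)
      show "inj_on (\<lambda>k. k - i) {k\<in>{..<n}. \<not> real k \<le> k0}"
      proof (rule inj_onI)
        fix k l assume "k \<in> {k\<in>{..<n}. \<not> real k \<le> k0}" "l \<in> {k\<in>{..<n}. \<not> real k \<le> k0}" "k - i = l - i"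
        moreover from this have "i \<le> k" "i \<le> l" using ik by simp_all
        ultimately show "k = l" by linarith
      qed
    qed simp
    also have "\<dots> \<le> (\<Sum>l<n. (2 powr (- v)) ^ l)" by (rule sum_mono2) auto
    also have "\<dots> \<le> 1 / (1 - 2 powr (- v))" using v by (intro geometric_le) (auto simp: powr_less_one')
    finally show ?thesis .
  qed
  have "(\<Sum>k<n. min (2 powr (p + u * real k)) (2 powr (q - v * real k)))
      \<le> (\<Sum>k<n. 2 powr e * (if real k \<le> k0 then 2 powr (u * (real k - k0)) else 2 powr (- v * (real k - k0))))"
  proof (rule sum_mono)
    fix k
    have "p + u * real k = e + u * (real k - k0)" "q - v * real k = e - v * (real k - k0)"
      using e1 by (simp_all add: algebra_simps)
    then show "min (2 powr (p + u * real k)) (2 powr (q - v * real k))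
      \<le> 2 powr e * (if real k \<le> k0 then 2 powr (u * (real k - k0)) else 2 powr (- v * (real k - k0)))"
      by (auto simp: powr_add[symmetric])
  qed
  also have "\<dots> = 2 powr e * ((\<Sum>k\<in>{k\<in>{..<n}. real k \<le> k0}. 2 powr (u * (real k - k0)))
     + (\<Sum>k\<in>{k\<in>{..<n}. \<not> real k \<le> k0}. 2 powr (- v * (real k - k0))))"
    by (simp add: sum_distrib_left[symmetric] sum.If_cases Int_def)
  also have "\<dots> \<le> 2 powr e * dyadic_const u v"
    using 1 2 by (intro mult_left_mono) (auto simp: dyadic_const_def)
  finally show ?thesis by (simp add: e_def mult.commute)
qed

lemma dyadic_sum':
  fixes u v x y :: real
  assumes "u > 0" "v > 0" "x > 0" "y > 0"
  shows "(\<Sum>k<n. min (x * 2 powr (u * real k)) (y * 2 powr (- v * real k)))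
           \<le> dyadic_const u v * (x powr (v / (u + v)) * y powr (u / (u + v)))"
proof -
  have e: "x = 2 powr (log 2 x)" "y = 2 powr (log 2 y)" using assms by simp_all
  have "(\<Sum>k<n. min (x * 2 powr (u * real k)) (y * 2 powr (- v * real k)))
     = (\<Sum>k<n. min (2 powr (log 2 x + u * real k)) (2 powr (log 2 y - v * real k)))"
    using assms by (intro sum.cong refl) (simp add: powr_add powr_diff powr_minus divide_inverse)
  also have "\<dots> \<le> dyadic_const u v * 2 powr ((v * log 2 x + u * log 2 y) / (u + v))"
    by (rule dyadic_sum[OF assms(1,2)])
  also have "2 powr ((v * log 2 x + u * log 2 y) / (u + v)) = x powr (v / (u + v)) * y powr (u / (u + v))"
    by (subst (2) e(1), subst (2) e(2))
      (simp only: powr_powr powr_add[symmetric], simp add: add_divide_distrib mult.commute add.commute)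
  finally show ?thesis .
qed

lemma dyadic_sum_sqrt:
  fixes x y :: real
  assumes "x > 0" "y > 0"
  shows "(\<Sum>k<n. min (x * 2 ^ k) (y / 2 ^ k)) \<le> 4 * sqrt (x * y)"
proof -
  have "(\<Sum>k<n. min (x * 2 ^ k) (y / 2 ^ k)) = (\<Sum>k<n. min (x * 2 powr (1 * real k)) (y * 2 powr (- 1 * real k)))"
    by (intro sum.cong refl) (simp add: powr_realpow powr_minus divide_inverse)
  also have "\<dots> \<le> dyadic_const 1 1 * (x powr (1 / (1 + 1)) * y powr (1 / (1 + 1)))"
    by (rule dyadic_sum') (use assms in auto)
  also have "\<dots> = 4 * sqrt (x * y)"
    using assms by (simp add: dyadic_const_def powr_minus powr_half_sqrt real_sqrt_mult)
  finally show ?thesis .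
qed

lemma min_le_sqrt: "0 \<le> x \<Longrightarrow> 0 \<le> y \<Longrightarrow> min x y \<le> sqrt x * sqrt (y::real)"
proof -
  assume *: "0 \<le> x" "0 \<le> y"
  have "min x y = sqrt (min x y) * sqrt (min x y)" using * by simp
  also have "\<dots> \<le> sqrt x * sqrt y" using * by (intro mult_mono) auto
  finally show ?thesis .
qed

lemma light_bound_pos: "light_bound x z k > 0"
  by (auto simp: light_bound_def add_pos_pos)

text \<open>The square root comes from \<open>min_le_sqrt\<close>. After weighting by
  \<open>2 ^ k\<close>, each \<open>min\<close> in \<open>light_bound\<close> is still a rising
  against a falling geometric sequence, with rates 1 and 1/2, so no factor \<open>n\<close>
  appears.\<close>

lemma sum_light_bound:
  "(\<Sum>k<n. 2 ^ k * sqrt (light_bound x z k)) \<le> 20 * (2 powr ((x + z) / 2) + 2 powr (x / 4 + 3/4 * z))"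
proof -
  let ?f = "\<lambda>k. min (2 powr (x / 2 + 1 * real k)) (2 powr (x / 2 + 2 + z - 1 * real k))"
  let ?g = "\<lambda>k. min (2 powr ((x + z) / 2 + 1/2 * real k)) (2 powr (z - 1/2 * real k))"
  have h: "sqrt (2 powr y) = 2 powr (y / 2)" for y :: real
    by (simp add: powr_half_sqrt[symmetric] powr_powr)
  have "2 ^ k * sqrt (light_bound x z k) \<le> (if k = 0 then 2 powr ((x + z) / 2) else 0) + (?f k + ?g k)" for k
  proof (cases "k = 0")
    case True
    then show ?thesis by (simp add: light_bound_def h add_nonneg_nonneg)
  next
    case False
    let ?a = "min (2 powr x) (2 powr (x + 4 + 2 * z - 4 * k))" and ?b = "min (2 powr (x + z - k)) (2 powr (2 * z - 3 * k))"
    have "sqrt (light_bound x z k) \<le> sqrt ?a + sqrt ?b"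
      using False by (simp add: light_bound_def sqrt_add_le_add_sqrt)
    then have "2 ^ k * sqrt (light_bound x z k) \<le> 2 powr k * (sqrt ?a + sqrt ?b)"
      by (simp add: powr_realpow)
    also have "\<dots> = 2 powr k * sqrt ?a + 2 powr k * sqrt ?b" by (simp add: distrib_left)
    also have "sqrt ?a = min (2 powr (x / 2)) (2 powr ((x + 4 + 2 * z - 4 * k) / 2))"
      by (simp add: min_def h)
    also have "2 powr k * \<dots> = ?f k"
      by (subst min_mult_distrib_left) (simp_all add: powr_add[symmetric] diff_divide_distrib add_divide_distrib algebra_simps)
    also have "sqrt ?b = min (2 powr ((x + z - k) / 2)) (2 powr ((2 * z - 3 * k) / 2))"
      by (simp add: min_def h)
    also have "2 powr k * \<dots> = ?g k"
      by (subst min_mult_distrib_left) (simp_all add: powr_add[symmetric] diff_divide_distrib add_divide_distrib algebra_simps)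
    finally show ?thesis using False by simp
  qed
  then have "(\<Sum>k<n. 2 ^ k * sqrt (light_bound x z k)) \<le> (\<Sum>k<n. (if k = 0 then 2 powr ((x + z) / 2) else 0) + (?f k + ?g k))"
    by (intro sum_mono) auto
  also have "\<dots> = (\<Sum>k<n. if k = 0 then 2 powr ((x + z) / 2) else 0) + ((\<Sum>k<n. ?f k) + (\<Sum>k<n. ?g k))"
    by (simp add: sum.distrib)
  also have "(\<Sum>k<n. if k = 0 then 2 powr ((x + z) / 2) else 0) \<le> 2 powr ((x + z) / 2)"
    by (simp add: sum.delta)
  also have "(\<Sum>k<n. ?f k) \<le> dyadic_const 1 1 * 2 powr ((1 * (x / 2) + 1 * (x / 2 + 2 + z)) / (1 + 1))"
    by (rule dyadic_sum) auto
  also have "dyadic_const 1 1 * 2 powr ((1 * (x / 2) + 1 * (x / 2 + 2 + z)) / (1 + 1)) = 8 * 2 powr ((x + z) / 2)"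
  proof -
    have "(1 * (x / 2) + 1 * (x / 2 + 2 + z)) / (1 + 1) = (x + z) / 2 + 1" by (simp add: field_simps)
    then show ?thesis by (simp only: powr_add) (simp add: dyadic_const_def powr_minus)
  qed
  also have "(\<Sum>k<n. ?g k) \<le> 8 * 2 powr (x / 4 + 3/4 * z)"
  proof -
    have "sqrt 2 \<ge> 4 / 3" by (rule real_le_rsqrt) (simp add: power2_eq_square)
    then have "inverse (sqrt 2) \<le> 3 / 4" using le_imp_inverse_le[of "4/3" "sqrt 2"] by simp
    moreover have "(2::real) powr (- (1/2)) = inverse (sqrt 2)"
      by (simp only: powr_minus) (simp add: powr_half_sqrt)
    moreover have "1 / (1 - t) \<le> 4" if "t \<le> 3 / 4" for t :: real using that by (simp add: field_simps)
    ultimately have c: "dyadic_const (1/2) (1/2) \<le> 8" unfolding dyadic_const_def by fastforce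
    have "(\<Sum>k<n. ?g k) \<le> dyadic_const (1/2) (1/2) * 2 powr ((1/2 * ((x + z) / 2) + 1/2 * z) / (1/2 + 1/2))"
      by (rule dyadic_sum) auto
    also have "(1/2 * ((x + z) / 2) + 1/2 * z) / (1/2 + 1/2) = x / 4 + 3/4 * z" by (simp add: field_simps)
    finally show ?thesis using mult_right_mono[OF c powr_ge_zero, of 2 "x / 4 + 3/4 * z"] by linarith
  qed
  finally have *: "(\<Sum>k<n. 2 ^ k * sqrt (light_bound x z k))
     \<le> 2 powr ((x + z) / 2) + (8 * 2 powr ((x + z) / 2) + 8 * 2 powr (x / 4 + 3/4 * z))" by simp
  have "u + (8 * u + 8 * v) \<le> 20 * (u + v)" if "u \<ge> 0" "v \<ge> 0" for u v :: real using that by simp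
  from order_trans[OF * this] show ?thesis by simp
qed

section \<open>Rectangles with corners in sets of given size\<close>

lemma dyadic_index:
  fixes r n :: nat
  assumes "1 \<le> r" "r < 2 ^ n"
  shows "\<exists>k<n. 2 ^ k \<le> r \<and> r < 2 ^ Suc k"
proof -
  obtain k where k: "2 ^ k \<le> r" "r < 2 ^ (k + 1)" using ex_power_ivl1[of 2 r] assms by auto
  have "(2::nat) ^ k < 2 ^ n" using k assms by linarith
  then have "k < n" by simp
  then show ?thesis using k by auto
qed

lemma dyadic_split:
  fixes f g :: "'a \<Rightarrow> nat"
  assumes T: "finite T"
    and f: "\<And>t. t \<in> T \<Longrightarrow> 1 \<le> f t \<and> f t < 2 ^ n" and g: "\<And>t. t \<in> T \<Longrightarrow> 1 \<le> g t \<and> g t < 2 ^ n"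
    and M: "\<And>k l. k < n \<Longrightarrow> l < n \<Longrightarrow>
       real (card {t \<in> T. 2 ^ k \<le> f t \<and> f t < 2 ^ Suc k \<and> 2 ^ l \<le> g t \<and> g t < 2 ^ Suc l}) \<le> M k l"
  shows "real (card T) \<le> (\<Sum>k<n. \<Sum>l<n. M k l)"
proof -
  let ?S = "\<lambda>k l. {t \<in> T. 2 ^ k \<le> f t \<and> f t < 2 ^ Suc k \<and> 2 ^ l \<le> g t \<and> g t < 2 ^ Suc l}"
  have "T \<subseteq> (\<Union>k\<in>{..<n}. \<Union>l\<in>{..<n}. ?S k l)"
  proof
    fix t assume t: "t \<in> T"
    obtain k where "k < n" "2 ^ k \<le> f t \<and> f t < 2 ^ Suc k" using dyadic_index f[OF t] by blast
    moreover obtain l where "l < n" "2 ^ l \<le> g t \<and> g t < 2 ^ Suc l" using dyadic_index g[OF t] by blast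
    ultimately show "t \<in> (\<Union>k\<in>{..<n}. \<Union>l\<in>{..<n}. ?S k l)" using t by blast
  qed
  then have "card T \<le> card (\<Union>k\<in>{..<n}. \<Union>l\<in>{..<n}. ?S k l)"
    using T by (intro card_mono) auto
  also have "\<dots> \<le> (\<Sum>k<n. card (\<Union>l\<in>{..<n}. ?S k l))" by (rule card_UN_le) simp
  also have "\<dots> \<le> (\<Sum>k<n. \<Sum>l<n. card (?S k l))" by (intro sum_mono card_UN_le) simp
  finally have "real (card T) \<le> real (\<Sum>k<n. \<Sum>l<n. card (?S k l))" by (rule of_nat_mono)
  also have "\<dots> = (\<Sum>k<n. \<Sum>l<n. real (card (?S k l)))" by simp
  also have "\<dots> \<le> (\<Sum>k<n. \<Sum>l<n. M k l)" using M by (intro sum_mono) auto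
  finally show ?thesis .
qed

text \<open>The minimum of two sums is at most the sum of the four cross minima. Only
  \<open>x / 4 ^ k\<close> against \<open>x' / 4 ^ l\<close> loses a factor \<open>n\<close>: after
  summation over \<open>l\<close> its contribution no longer depends on \<open>k\<close>.\<close>

lemma sum_min_light:
  fixes w w' :: "nat \<Rightarrow> real"
  assumes pos: "x > 0" "x' > 0" "\<And>k. w k > 0" "\<And>k. w' k > 0"
  shows "(\<Sum>k<n. \<Sum>l<n. 2 ^ k * 2 ^ l * min (x / 4 ^ k + w k) (x' / 4 ^ l + w' l))
    \<le> (\<Sum>k<n. 2 ^ k * sqrt (w k)) * (\<Sum>l<n. 2 ^ l * sqrt (w' l))
      + 4 * sqrt x * (\<Sum>l<n. 2 ^ l * sqrt (w' l)) + 4 * sqrt x' * (\<Sum>k<n. 2 ^ k * sqrt (w k))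
      + 4 * n * (sqrt x * sqrt x')"
proof -
  have four: "(4::real) ^ k = 2 ^ k * 2 ^ k" for k by (simp flip: power_mult_distrib)
  have split: "min (p + q) (r + s) \<le> min q s + min p s + min r q + min p r"
    if "p \<ge> 0" "q \<ge> 0" "r \<ge> 0" "s \<ge> 0" for p q r s :: real using that by linarith
  have "(\<Sum>k<n. \<Sum>l<n. 2 ^ k * 2 ^ l * min (x / 4 ^ k + w k) (x' / 4 ^ l + w' l))
    \<le> (\<Sum>k<n. \<Sum>l<n. 2 ^ k * 2 ^ l * (min (w k) (w' l) + min (x / 4 ^ k) (w' l) + min (x' / 4 ^ l) (w k)
         + min (x / 4 ^ k) (x' / 4 ^ l)))"
    using pos by (intro sum_mono mult_left_mono split) (auto simp: less_imp_le)
  also have "\<dots> = (\<Sum>k<n. \<Sum>l<n. 2 ^ k * 2 ^ l * min (w k) (w' l))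
      + (\<Sum>k<n. \<Sum>l<n. 2 ^ k * 2 ^ l * min (x / 4 ^ k) (w' l))
      + (\<Sum>k<n. \<Sum>l<n. 2 ^ k * 2 ^ l * min (x' / 4 ^ l) (w k))
      + (\<Sum>k<n. \<Sum>l<n. 2 ^ k * 2 ^ l * min (x / 4 ^ k) (x' / 4 ^ l))"
    by (simp add: sum.distrib distrib_left)
  also have "(\<Sum>k<n. \<Sum>l<n. 2 ^ k * 2 ^ l * min (w k) (w' l))
     \<le> (\<Sum>k<n. \<Sum>l<n. 2 ^ k * 2 ^ l * (sqrt (w k) * sqrt (w' l)))"
    using pos by (intro sum_mono mult_left_mono min_le_sqrt) (auto simp: less_imp_le)
  also have "\<dots> = (\<Sum>k<n. 2 ^ k * sqrt (w k)) * (\<Sum>l<n. 2 ^ l * sqrt (w' l))"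
    by (simp add: sum_product mult_ac)
  also have "(\<Sum>k<n. \<Sum>l<n. 2 ^ k * 2 ^ l * min (x / 4 ^ k) (w' l))
      = (\<Sum>l<n. \<Sum>k<n. min ((2 ^ l * w' l) * 2 ^ k) ((2 ^ l * x) / 2 ^ k))"
    by (subst sum.swap) (simp add: four min_mult_distrib_left min.commute mult_ac)
  also have "\<dots> \<le> (\<Sum>l<n. 4 * sqrt ((2 ^ l * w' l) * (2 ^ l * x)))"
    using pos by (intro sum_mono dyadic_sum_sqrt) auto
  also have "\<dots> = 4 * sqrt x * (\<Sum>l<n. 2 ^ l * sqrt (w' l))"
    by (simp add: sum_distrib_left real_sqrt_mult mult_ac)
  also have "(\<Sum>k<n. \<Sum>l<n. 2 ^ k * 2 ^ l * min (x' / 4 ^ l) (w k))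
      = (\<Sum>k<n. \<Sum>l<n. min ((2 ^ k * w k) * 2 ^ l) ((2 ^ k * x') / 2 ^ l))"
    by (simp add: four min_mult_distrib_left min.commute mult_ac)
  also have "\<dots> \<le> (\<Sum>k<n. 4 * sqrt ((2 ^ k * w k) * (2 ^ k * x')))"
    using pos by (intro sum_mono dyadic_sum_sqrt) auto
  also have "\<dots> = 4 * sqrt x' * (\<Sum>k<n. 2 ^ k * sqrt (w k))"
    by (simp add: sum_distrib_left real_sqrt_mult mult_ac)
  also have "(\<Sum>k<n. \<Sum>l<n. 2 ^ k * 2 ^ l * min (x / 4 ^ k) (x' / 4 ^ l))
      = (\<Sum>k<n. \<Sum>l<n. min ((x / 2 ^ k) * 2 ^ l) ((2 ^ k * x') / 2 ^ l))"
    by (simp add: four min_mult_distrib_left mult_ac)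
  also have "\<dots> \<le> (\<Sum>k<n. 4 * sqrt ((x / 2 ^ k) * (2 ^ k * x')))"
    using pos by (intro sum_mono dyadic_sum_sqrt) auto
  also have "\<dots> = 4 * n * (sqrt x * sqrt x')"
    by (simp add: real_sqrt_mult real_sqrt_divide)
  finally show ?thesis by simp
qed

section \<open>Dyadic blocks by the richness of the two legs\<close>

context
  fixes A B C D :: "pt set" and a b c d :: real and T :: "triple set" and n :: nat
  assumes fin: "finite A" "finite B" "finite C" "finite D"
    and cards: "card A \<le> 2 powr a" "card B \<le> 2 powr b" "card C \<le> 2 powr c" "card D \<le> 2 powr d"
    and T: "T \<subseteq> corners A B C D" and n: "b < n" "d < n"
begin

lemma leg_counts:
  assumes "t \<in> T"
  shows "1 \<le> card (B \<inter> leg1 t) \<and> card (B \<inter> leg1 t) < 2 ^ n"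
    "1 \<le> card (D \<inter> leg2 t) \<and> card (D \<inter> leg2 t) < 2 ^ n"
proof -
  have t: "fst t \<in> B" "snd (snd t) \<in> D" using T assms by (auto simp: corners_def)
  have "fst t \<in> B \<inter> leg1 t" "snd (snd t) \<in> D \<inter> leg2 t"
    using t by (simp_all add: leg1_def leg2_def line_points)
  then have "B \<inter> leg1 t \<noteq> {}" "D \<inter> leg2 t \<noteq> {}" by blast+
  then have 1: "1 \<le> card (B \<inter> leg1 t)" "1 \<le> card (D \<inter> leg2 t)"
    using fin by (simp_all add: Suc_le_eq card_gt_0_iff)
  have "real (card (X \<inter> l)) < 2 ^ n" if "finite X" "card X \<le> 2 powr x" "x < n" for X l and x :: real
  proof -
    have "real (card (X \<inter> l)) \<le> card X" using that by (simp add: card_mono)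
    also have "\<dots> \<le> 2 powr x" by fact
    also have "\<dots> < 2 powr n" using that by simp
    finally show ?thesis by (simp add: powr_realpow)
  qed
  from this[OF fin(2) cards(2) n(1)] this[OF fin(4) cards(4) n(2)]
  have "real (card (B \<inter> leg1 t)) < real (2 ^ n)" "real (card (D \<inter> leg2 t)) < real (2 ^ n)" by simp_all
  then show "1 \<le> card (B \<inter> leg1 t) \<and> card (B \<inter> leg1 t) < 2 ^ n"
    "1 \<le> card (D \<inter> leg2 t) \<and> card (D \<inter> leg2 t) < 2 ^ n" using 1 unfolding of_nat_less_iff by simp_all
qed

abbreviation (input) block where
  "block k l \<equiv> {t \<in> T. 2 ^ k \<le> card (B \<inter> leg1 t) \<and> card (B \<inter> leg1 t) < 2 ^ Suc k
      \<and> 2 ^ l \<le> card (D \<inter> leg2 t) \<and> card (D \<inter> leg2 t) < 2 ^ Suc l}"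

text \<open>The pairs of a corner and a leg line can be bounded through either leg, whence the
  \<open>min\<close>, and each pair is completed to a rectangle in at most
  \<open>4 * (2 ^ k * 2 ^ l)\<close> ways; \<open>110592 = 4 * 27648\<close>.\<close>

lemma light_light_blocks:
  assumes lightB: "\<And>t. t \<in> T \<Longrightarrow> (real (card (B \<inter> leg1 t)))\<^sup>2 < 4 * 2 powr b"
    and lightD: "\<And>t. t \<in> T \<Longrightarrow> (real (card (D \<inter> leg2 t)))\<^sup>2 < 4 * 2 powr d"
  shows "real (card T) \<le> (\<Sum>k<n. \<Sum>l<n. 110592 * (2 ^ k * 2 ^ l *
     min (2 powr (2/3 * c + 4/3 * b) / 4 ^ k + light_bound c b k) (2 powr (2/3 * c + 4/3 * d) / 4 ^ l + light_bound c d l)))"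
proof (rule dyadic_split[OF finT[OF fin cards T] leg_counts])
  fix k l
  let ?S = "block k l"
  have S: "?S \<subseteq> corners A B C D" "finite ?S" using T finT[OF fin cards T] by auto
  have fS: "flip ` ?S \<subseteq> corners A D C B" by (rule flip_corners[OF S(1)])
  have e: "2 powr (y - 2 * real j) = 2 powr y / 4 ^ j" for y j
    by (simp add: powr_diff powr_realpow[symmetric] powr_powr[symmetric])
  have "real (card (pairs2 ?S)) \<le> 27648 * (2 powr (2/3 * c + 4/3 * d - 2 * real l) + light_bound c d l)"
    by (rule light_pairs[OF fin cards S(1)]) (use lightD in auto)
  then have 1: "real (card (pairs1 ?S)) \<le> 27648 * (2 powr (2/3 * c + 4/3 * d) / 4 ^ l + light_bound c d l)"
    using card_pairs_eq[OF S(2,1)] e by simp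
  have "real (card (pairs2 (flip ` ?S))) \<le> 27648 * (2 powr (2/3 * c + 4/3 * b - 2 * real k) + light_bound c b k)"
    by (rule light_pairs[OF fin(1,4,3,2) cards(1,4,3,2) fS]) (use lightB in auto)
  then have 2: "real (card (pairs1 ?S)) \<le> 27648 * (2 powr (2/3 * c + 4/3 * b) / 4 ^ k + light_bound c b k)"
    using pairs_flip(2)[of ?S] e by simp
  have "real (card ?S) \<le> card (pairs1 ?S) * real (2 ^ Suc k * 2 ^ Suc l)"
  proof (rule card_le_fibers[OF S(2)])
    fix q assume "q \<in> pairs1 ?S"
    have sub: "{t \<in> ?S. (fst (snd t), leg1 t) = q} \<subseteq> corners A B C D" using S by auto
    have "card {t \<in> ?S. (fst (snd t), leg1 t) = q} \<le> 2 ^ Suc k * 2 ^ Suc l"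
      by (rule fiber_legs[OF fin cards sub, where y = "fst q" and l = "snd q"]) auto
    then show "real (card {t \<in> ?S. (fst (snd t), leg1 t) = q}) \<le> real (2 ^ Suc k * 2 ^ Suc l)"
      by (rule of_nat_mono)
  qed
  also have "real (2 ^ Suc k * 2 ^ Suc l) = 4 * (2 ^ k * 2 ^ l)" by simp
  also have "real (card (pairs1 ?S)) * (4 * (2 ^ k * 2 ^ l)) \<le> (27648 * min (2 powr (2/3 * c + 4/3 * b) / 4 ^ k + light_bound c b k)
      (2 powr (2/3 * c + 4/3 * d) / 4 ^ l + light_bound c d l)) * (4 * (2 ^ k * 2 ^ l))"
    using 1 2 by (intro mult_right_mono) (auto simp: min_def)
  finally show "real (card ?S) \<le> 110592 * (2 ^ k * 2 ^ l * min (2 powr (2/3 * c + 4/3 * b) / 4 ^ k + light_bound c b k)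
      (2 powr (2/3 * c + 4/3 * d) / 4 ^ l + light_bound c d l))"
    by (simp add: mult_ac)
qed auto

text \<open>Over a pair of corner and leg line the richness of the legs gives
  \<open>2 ^ Suc k * 2 ^ Suc l\<close> rectangles. Lightness of the sides through the fourth corner
  allows either factor to be replaced by \<open>2 * 2 powr (a / 2)\<close>, and
  \<open>card A\<close> bounds the fibre when both are replaced.\<close>

lemma mid_mid_block:
  assumes heavyB: "\<And>t. t \<in> T \<Longrightarrow> 4 * 2 powr b \<le> (real (card (B \<inter> leg1 t)))\<^sup>2"
    and midB: "\<And>t. t \<in> T \<Longrightarrow> 2 powr c * (real (card (B \<inter> leg1 t)))\<^sup>2 < 16 * 2 powr (2 * b)"
    and heavyD: "\<And>t. t \<in> T \<Longrightarrow> 4 * 2 powr d \<le> (real (card (D \<inter> leg2 t)))\<^sup>2"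
    and midD: "\<And>t. t \<in> T \<Longrightarrow> 2 powr c * (real (card (D \<inter> leg2 t)))\<^sup>2 < 16 * 2 powr (2 * d)"
    and light: "\<And>t. t \<in> T \<Longrightarrow> (real (card (A \<inter> opp1 t)))\<^sup>2 < 4 * 2 powr a"
      "\<And>t. t \<in> T \<Longrightarrow> (real (card (A \<inter> opp1 (flip t))))\<^sup>2 < 4 * 2 powr a"
  shows "real (card (block k l)) \<le> 48 * 2 powr (c / 2 + (b - k) / 4 + 3 * (d - l) / 4)
     * (min (2 powr k) (2 powr (a / 2)) * min (2 powr l) (2 powr (a / 2)))"
proof -
  let ?S = "block k l" and ?s = "2 powr (a / 2)"
  have S: "?S \<subseteq> corners A B C D" "finite ?S" using T finT[OF fin cards T] by auto
  have fS: "flip ` ?S \<subseteq> corners A D C B" by (rule flip_corners[OF S(1)])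
  have "real (card (pairs2 ?S)) \<le> 12 * 2 powr (c / 2 + d - l)"
    by (rule mid_pairs[OF fin cards S(1)]) (use heavyD midD in auto)
  then have 1: "real (card (pairs1 ?S)) \<le> 12 * 2 powr (c / 2 + d - l)"
    using card_pairs_eq[OF S(2,1)] by simp
  have "real (card (pairs2 (flip ` ?S))) \<le> 12 * 2 powr (c / 2 + b - k)"
    by (rule mid_pairs[OF fin(1,4,3,2) cards(1,4,3,2) fS]) (use heavyB midB in auto)
  then have 2: "real (card (pairs1 ?S)) \<le> 12 * 2 powr (c / 2 + b - k)"
    using pairs_flip(2)[of ?S] by simp
  \<comment> \<open>The smaller of the two bounds is at most their geometric mean with weights 1/4
    and 3/4. The unequal weights leave a gain in \<open>b - d\<close>, while the sums over
    \<open>k\<close> and over \<open>l\<close> stay geometric on both sides of their peaks.\<close>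
  have 3: "real (card (pairs1 ?S)) \<le> 12 * 2 powr (c / 2 + (b - k) / 4 + 3 * (d - l) / 4)"
  proof (cases "b - k \<le> d - l")
    case True
    have "c / 2 + b - k \<le> c / 2 + (b - k) / 4 + 3 * (d - l) / 4" using True by (simp add: field_simps)
    then have "2 powr (c / 2 + b - k) \<le> 2 powr (c / 2 + (b - k) / 4 + 3 * (d - l) / 4)" by (rule powr_mono) simp
    then show ?thesis using 2 by linarith
  next
    case False
    have "c / 2 + d - l \<le> c / 2 + (b - k) / 4 + 3 * (d - l) / 4" using False by (simp add: field_simps)
    then have "2 powr (c / 2 + d - l) \<le> 2 powr (c / 2 + (b - k) / 4 + 3 * (d - l) / 4)" by (rule powr_mono) simp
    then show ?thesis using 1 by linarith
  qed
  have "real (card ?S) \<le> card (pairs1 ?S) * (4 * (min (2 powr k) ?s * min (2 powr l) ?s))"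
  proof (rule card_le_fibers[OF S(2)])
    fix q assume "q \<in> pairs1 ?S"
    define F where "F = {t \<in> ?S. (fst (snd t), leg1 t) = q}"
    have sub: "F \<subseteq> corners A B C D" "F \<subseteq> T" using S by (auto simp: F_def)
    have finF: "finite F" using sub finT[OF fin cards T] finite_subset by blast
    have fsub: "flip ` F \<subseteq> corners A D C B" by (rule flip_corners[OF sub(1)])
    have F: "(fst (snd t), leg1 t) = (fst q, snd q)" if "t \<in> F" for t using that by (simp add: F_def)
    have cD: "card (D \<inter> leg2 t) \<le> 2 ^ Suc l" and cB: "card (B \<inter> leg1 t) \<le> 2 ^ Suc k" if "t \<in> F" for t
      using that by (simp_all add: F_def)
    have "card F \<le> 2 ^ Suc k * 2 ^ Suc l"
      by (rule fiber_legs[OF fin cards sub(1) F]) (use cB cD in auto)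
    from of_nat_mono[OF this, where 'a = real] have f1: "real (card F) \<le> 4 * (2 powr k * 2 powr l)"
      by (simp add: powr_realpow)
    have "real (card F) \<le> real (2 ^ Suc l) * (2 * ?s)"
      by (rule fiber_opp[OF fin cards sub(1) F]) (use cD light(1) sub(2) in auto)
    then have f2: "real (card F) \<le> 4 * (2 powr l * ?s)" by (simp add: powr_realpow)
    have "real (card (flip ` F)) \<le> real (2 ^ Suc k) * (2 * ?s)"
    proof (rule fiber_opp[OF fin(1,4,3,2) cards(1,4,3,2) fsub, where y = "fst q" and l = "perp (fst q) (snd q)"])
      fix t assume "t \<in> flip ` F"
      then obtain t' where t': "t' \<in> F" "t = flip t'" by blast
      show "(fst (snd t), leg1 t) = (fst q, perp (fst q) (snd q))"
        using prod.inject[THEN iffD1, OF F[OF t'(1)]] leg2_perp[OF sub(1) t'(1)] by (simp add: t')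
      show "card (B \<inter> leg2 t) \<le> 2 ^ Suc k" using cB[OF t'(1)] by (simp add: t')
      show "(real (card (A \<inter> opp1 t)))\<^sup>2 < 4 * 2 powr a" using light(2) sub(2) t' by blast
    qed
    then have f3: "real (card F) \<le> 4 * (2 powr k * ?s)" by (simp add: card_flip powr_realpow)
    have "card F \<le> card A"
      by (rule card_inj_on_le[OF fiber_fourth[OF fin cards sub(1) F]]) (use sub fin in \<open>auto simp: corners_def\<close>)
    then have "real (card F) \<le> 2 powr a" using cards(1) by linarith
    also have "2 powr a = ?s * ?s" by (simp flip: powr_add)
    also have "?s * ?s \<le> 4 * (?s * ?s)" by simp
    finally have f4: "real (card F) \<le> 4 * (?s * ?s)" .
    show "real (card {t \<in> ?S. (fst (snd t), leg1 t) = q}) \<le> 4 * (min (2 powr k) ?s * min (2 powr l) ?s)"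
      unfolding F_def[symmetric] using f1 f2 f3 f4
      by (cases "2 powr k \<le> ?s"; cases "2 powr l \<le> ?s") (simp_all only: min_def if_True if_False mult.commute)
  qed
  also have "\<dots> \<le> 12 * 2 powr (c / 2 + (b - k) / 4 + 3 * (d - l) / 4) * (4 * (min (2 powr k) ?s * min (2 powr l) ?s))"
    using 3 by (intro mult_right_mono) auto
  finally show ?thesis by (simp add: mult_ac)
qed

end

text \<open>The gain over \<open>2 powr ((a + b + c + d) / 2)\<close> for corner sets with these
  logarithmic sizes, \<open>a\<close> being the largest. The first term is the smaller of the
  diagonal bounds |A| |C| and |B| |D|, the second comes from two legs of middle richness, the next
  three from light legs, and the last, with the factor \<open>n\<close>, from the main terms of two
  light legs.\<close>

definition level_kernel :: "real \<Rightarrow> real \<Rightarrow> real \<Rightarrow> real \<Rightarrow> real \<Rightarrow> real" where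
  "level_kernel n a b c d = 2 powr (- \<bar>a + c - b - d\<bar> / 2) + 2 powr (- \<bar>b - d\<bar> / 4)
     + 2 powr ((b - a) / 6) + 2 powr ((c - a) / 6) + 2 powr ((d - a) / 6)
     + n * 2 powr ((b - a) / 6 + (c - a) / 6 + (d - a) / 6)"

context
  fixes A B C D :: "pt set" and a b c d :: real and T :: "triple set" and n :: nat
  assumes fin: "finite A" "finite B" "finite C" "finite D"
    and cards: "card A \<le> 2 powr a" "card B \<le> 2 powr b" "card C \<le> 2 powr c" "card D \<le> 2 powr d"
    and T: "T \<subseteq> corners A B C D" and n: "b < n" "d < n" and le: "b \<le> a" "c \<le> a" "d \<le> a"
begin

lemma mid_mid:
  assumes heavyB: "\<And>t. t \<in> T \<Longrightarrow> 4 * 2 powr b \<le> (real (card (B \<inter> leg1 t)))\<^sup>2"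
    and midB: "\<And>t. t \<in> T \<Longrightarrow> 2 powr c * (real (card (B \<inter> leg1 t)))\<^sup>2 < 16 * 2 powr (2 * b)"
    and heavyD: "\<And>t. t \<in> T \<Longrightarrow> 4 * 2 powr d \<le> (real (card (D \<inter> leg2 t)))\<^sup>2"
    and midD: "\<And>t. t \<in> T \<Longrightarrow> 2 powr c * (real (card (D \<inter> leg2 t)))\<^sup>2 < 16 * 2 powr (2 * d)"
    and light: "\<And>t. t \<in> T \<Longrightarrow> (real (card (A \<inter> opp1 t)))\<^sup>2 < 4 * 2 powr a"
      "\<And>t. t \<in> T \<Longrightarrow> (real (card (A \<inter> opp1 (flip t))))\<^sup>2 < 4 * 2 powr a"
  shows "real (card T) \<le> 48 * dyadic_const (3/4) (1/4) * dyadic_const (1/4) (3/4)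
     * 2 powr ((a + b + c + d) / 2 - (b - d) / 4)"
proof -
  let ?s = "2 powr (a / 2)"
  define e where "e = c / 2 + b / 4 + 3 * d / 4"
  have "real (card T) \<le> (\<Sum>k<n. \<Sum>l<n. 48 * 2 powr (c / 2 + (b - k) / 4 + 3 * (d - l) / 4)
     * (min (2 powr k) ?s * min (2 powr l) ?s))"
    by (rule dyadic_split[OF finT[OF fin cards T] leg_counts[OF fin cards T n]]; (rule mid_mid_block[OF fin cards T n assms])?)
  also have "\<dots> = (\<Sum>k<n. \<Sum>l<n. 48 * 2 powr e * (min (2 powr (0 + 3/4 * real k)) (2 powr (a / 2 - 1/4 * real k))
     * min (2 powr (0 + 1/4 * real l)) (2 powr (a / 2 - 3/4 * real l))))"
  proof (intro sum.cong refl)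
    fix k l
    have 1: "2 powr (- (1/4) * real k) * min (2 powr k) ?s = min (2 powr (0 + 3/4 * real k)) (2 powr (a / 2 - 1/4 * real k))"
      by (subst min_mult_distrib_left) (simp_all add: powr_add[symmetric])
    have 2: "2 powr (- (3/4) * real l) * min (2 powr l) ?s = min (2 powr (0 + 1/4 * real l)) (2 powr (a / 2 - 3/4 * real l))"
      by (subst min_mult_distrib_left) (simp_all add: powr_add[symmetric])
    have "c / 2 + (b - k) / 4 + 3 * (d - l) / 4 = e + (- (1/4) * real k) + (- (3/4) * real l)"
      by (simp add: e_def field_simps)
    then have 3: "2 powr (c / 2 + (b - k) / 4 + 3 * (d - l) / 4) = 2 powr e * 2 powr (- (1/4) * real k) * 2 powr (- (3/4) * real l)"
      by (simp only: powr_add)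
    show "48 * 2 powr (c / 2 + (b - k) / 4 + 3 * (d - l) / 4) * (min (2 powr k) ?s * min (2 powr l) ?s)
      = 48 * 2 powr e * (min (2 powr (0 + 3/4 * real k)) (2 powr (a / 2 - 1/4 * real k))
         * min (2 powr (0 + 1/4 * real l)) (2 powr (a / 2 - 3/4 * real l)))"
      unfolding 1[symmetric] 2[symmetric] 3 by (simp only: mult_ac)
  qed
  also have "\<dots> = 48 * 2 powr e * ((\<Sum>k<n. min (2 powr (0 + 3/4 * real k)) (2 powr (a / 2 - 1/4 * real k)))
      * (\<Sum>l<n. min (2 powr (0 + 1/4 * real l)) (2 powr (a / 2 - 3/4 * real l))))"
    by (simp only: sum_product, simp only: sum_distrib_left)
  also have "\<dots> \<le> 48 * 2 powr e * ((dyadic_const (3/4) (1/4) * 2 powr ((1/4 * 0 + 3/4 * (a / 2)) / (3/4 + 1/4)))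
      * (dyadic_const (1/4) (3/4) * 2 powr ((3/4 * 0 + 1/4 * (a / 2)) / (1/4 + 3/4))))"
    using dyadic_const_pos[of "3/4" "1/4"]
    by (intro mult_left_mono mult_mono dyadic_sum sum_nonneg) auto
  also have "\<dots> = 48 * dyadic_const (3/4) (1/4) * dyadic_const (1/4) (3/4) * (2 powr e * 2 powr (3/8 * a) * 2 powr (1/8 * a))"
    by simp
  also have "2 powr e * 2 powr (3/8 * a) * 2 powr (1/8 * a) = 2 powr ((a + b + c + d) / 2 - (b - d) / 4)"
    by (simp add: powr_add[symmetric] e_def field_simps)
  finally show ?thesis .
qed

lemma powr_two_le:
  assumes "e \<le> (a + b + c + d) / 2 + max (b - a) (max (c - a) (d - a)) / 6"
  shows "2 powr e \<le> 2 powr ((a + b + c + d) / 2) * (2 powr ((b - a) / 6) + 2 powr ((c - a) / 6) + 2 powr ((d - a) / 6))"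
proof -
  have "2 powr e \<le> 2 powr ((a + b + c + d) / 2) * 2 powr (max (b - a) (max (c - a) (d - a)) / 6)"
    using assms by (simp flip: powr_add)
  also have "2 powr (max (b - a) (max (c - a) (d - a)) / 6) \<le> 2 powr ((b - a) / 6) + 2 powr ((c - a) / 6) + 2 powr ((d - a) / 6)"
    by (auto simp: max_def add_increasing add_increasing2)
  finally show ?thesis by (simp add: mult_left_mono)
qed

lemma light_light:
  assumes lightB: "\<And>t. t \<in> T \<Longrightarrow> (real (card (B \<inter> leg1 t)))\<^sup>2 < 4 * 2 powr b"
    and lightD: "\<And>t. t \<in> T \<Longrightarrow> (real (card (D \<inter> leg2 t)))\<^sup>2 < 4 * 2 powr d"
  shows "real (card T) \<le> 110592 * 1920 * 2 powr ((a + b + c + d) / 2) * level_kernel n a b c d"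
proof -
  define S where "S = 2 powr ((a + b + c + d) / 2)"
  define p where "p = 2 powr ((b - a) / 6) + 2 powr ((c - a) / 6) + 2 powr ((d - a) / 6)"
  define r where "r = 2 powr ((b - a) / 6 + (c - a) / 6 + (d - a) / 6)"
  \<comment> \<open>\<open>u1\<close> and \<open>u2\<close> are the exponents in
    \<open>sum_light_bound\<close>, and \<open>u3\<close> is that of the square root of the main
    term; \<open>v1\<close>, \<open>v2\<close>, \<open>v3\<close> are the same for
    \<open>d\<close>.\<close>
  define u1 u2 u3 where "u1 = (c + b) / 2" "u2 = c / 4 + 3/4 * b" "u3 = c / 3 + 2/3 * b"
  define v1 v2 v3 where "v1 = (c + d) / 2" "v2 = c / 4 + 3/4 * d" "v3 = c / 3 + 2/3 * d"
  note uv = u1_u2_u3_def v1_v2_v3_def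
  let ?xb = "2 powr (2/3 * c + 4/3 * b)" and ?xd = "2 powr (2/3 * c + 4/3 * d)"
  define sb where "sb = (\<Sum>k<n. 2 ^ k * sqrt (light_bound c b k))"
  define sd where "sd = (\<Sum>k<n. 2 ^ k * sqrt (light_bound c d k))"
  have sq: "sqrt ?xb = 2 powr u3" "sqrt ?xd = 2 powr v3"
  proof -
    have e: "(2/3 * c + 4/3 * b) * (1/2) = u3" "(2/3 * c + 4/3 * d) * (1/2) = v3" by (simp_all add: uv)
    show "sqrt ?xb = 2 powr u3" "sqrt ?xd = 2 powr v3"
      unfolding e[symmetric] by (simp_all only: powr_half_sqrt[symmetric] powr_ge_zero powr_powr)
  qed
  have sb: "sb \<le> 20 * (2 powr u1 + 2 powr u2)" "sb \<ge> 0" and sd: "sd \<le> 20 * (2 powr v1 + 2 powr v2)" "sd \<ge> 0"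
    using sum_light_bound[where x = c and z = b and n = n] sum_light_bound[where x = c and z = d and n = n]
    by (auto simp: sb_def sd_def uv intro!: sum_nonneg mult_nonneg_nonneg less_imp_le[OF light_bound_pos])
  have pair: "2 powr x * 2 powr y \<le> S * p" if "x \<in> {u1, u2, u3}" "y \<in> {v1, v2, v3}" for x y
  proof -
    have "x + y \<le> (a + b + c + d) / 2 + max (b - a) (max (c - a) (d - a)) / 6"
      using that le by (auto simp: uv max_def field_simps)
    from powr_two_le[OF this] show ?thesis by (simp add: S_def p_def powr_add)
  qed
  have "real (card T) \<le> (\<Sum>k<n. \<Sum>l<n. 110592 * (2 ^ k * 2 ^ l *
     min (?xb / 4 ^ k + light_bound c b k) (?xd / 4 ^ l + light_bound c d l)))"
    by (rule light_light_blocks[OF fin cards T n assms])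
  also have "\<dots> = 110592 * (\<Sum>k<n. \<Sum>l<n. 2 ^ k * 2 ^ l *
     min (?xb / 4 ^ k + light_bound c b k) (?xd / 4 ^ l + light_bound c d l))"
    by (simp add: sum_distrib_left)
  also have "\<dots> \<le> 110592 * (sb * sd + 4 * 2 powr u3 * sd + 4 * 2 powr v3 * sb + 4 * real n * (2 powr u3 * 2 powr v3))"
    unfolding sq[symmetric] sb_def sd_def
    by (rule mult_left_mono[OF sum_min_light]) (simp_all add: light_bound_pos)
  also have "\<dots> \<le> 110592 * ((20 * (2 powr u1 + 2 powr u2)) * (20 * (2 powr v1 + 2 powr v2))
      + 4 * 2 powr u3 * (20 * (2 powr v1 + 2 powr v2)) + 4 * 2 powr v3 * (20 * (2 powr u1 + 2 powr u2))
      + 4 * real n * (2 powr u3 * 2 powr v3))"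
    using sb sd by (intro mult_left_mono add_mono mult_mono) auto
  \<comment> \<open>Main term against main term is the only product that carries the factor
    \<open>n\<close>; its exponent gains in all three size differences at once.\<close>
  also have "2 powr u3 * 2 powr v3 = S * r"
  proof -
    have "u3 + v3 = (a + b + c + d) / 2 + ((b - a) / 6 + (c - a) / 6 + (d - a) / 6)" by (simp add: uv field_simps)
    then show ?thesis by (simp only: S_def r_def powr_add[symmetric])
  qed
  also have "(20 * (2 powr u1 + 2 powr u2)) * (20 * (2 powr v1 + 2 powr v2))
      + 4 * 2 powr u3 * (20 * (2 powr v1 + 2 powr v2)) + 4 * 2 powr v3 * (20 * (2 powr u1 + 2 powr u2))
      + 4 * real n * (S * r)
    = 400 * (2 powr u1 * 2 powr v1 + 2 powr u1 * 2 powr v2 + 2 powr u2 * 2 powr v1 + 2 powr u2 * 2 powr v2)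
      + 80 * (2 powr u3 * 2 powr v1 + 2 powr u3 * 2 powr v2) + 80 * (2 powr u1 * 2 powr v3 + 2 powr u2 * 2 powr v3)
      + 4 * (S * (n * r))"
  proof -
    have "(20 * (x1 + x2)) * (20 * (y1 + y2)) + 4 * x3 * (20 * (y1 + y2)) + 4 * y3 * (20 * (x1 + x2)) + 4 * real n * (z * w)
      = 400 * (x1 * y1 + x1 * y2 + x2 * y1 + x2 * y2) + 80 * (x3 * y1 + x3 * y2) + 80 * (x1 * y3 + x2 * y3) + 4 * (z * (n * w))"
      for x1 x2 x3 y1 y2 y3 z w :: real by (simp add: algebra_simps)
    then show ?thesis .
  qed
  also have "\<dots> \<le> 400 * (S * p + S * p + S * p + S * p) + 80 * (S * p + S * p) + 80 * (S * p + S * p) + 4 * (S * (n * r))"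
    by (intro add_mono mult_left_mono pair order_refl) auto
  also have "\<dots> = 1920 * (S * p) + 4 * (S * (n * r))" by simp
  also have "\<dots> \<le> 1920 * (S * p) + 1920 * (S * (n * r))" by (simp add: S_def r_def)
  also have "\<dots> = 1920 * (S * (p + n * r))" by (simp add: algebra_simps)
  also have "\<dots> \<le> 1920 * (S * level_kernel n a b c d)"
    by (intro mult_left_mono) (auto simp: S_def p_def r_def level_kernel_def)
  finally show ?thesis by (simp add: S_def mult_ac)
qed

end

definition rect_const :: real where
  "rect_const = 4 + 4 + 48 + 48 * dyadic_const (3/4) (1/4) * dyadic_const (1/4) (3/4) + 110592 * 1920 + 4"

text \<open>With \<open>A\<close> the largest of the four sets, only the lines through the opposite corner \<open>c\<close> are
  needed. A leg is heavy if it carries at least \<open>2 * 2 powr (d / 2)\<close> points of its set; heavy lines have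
  linearly many incidences, so they contribute at most \<open>min (|A| |C|) (|B| |D|)\<close> or leave a middle
  range. On light legs the Szemeredi-Trotter bound applies.\<close>

theorem card_corners_le:
  assumes fin: "finite A" "finite B" "finite C" "finite D"
    and cards: "card A \<le> 2 powr a" "card B \<le> 2 powr b" "card C \<le> 2 powr c" "card D \<le> 2 powr d"
    and n: "b < real n" "d < real n" and le: "b \<le> a" "c \<le> a" "d \<le> a"
  shows "real (card (corners A B C D)) \<le> rect_const * (2 powr ((a + b + c + d) / 2) * level_kernel n a b c d)"
proof -
  define T where "T = corners A B C D"
  have T: "T \<subseteq> corners A B C D" by (simp add: T_def)
  have finT: "finite T" using finite_corners fin T by blast
  define S where "S = 2 powr ((a + b + c + d) / 2)"
  define k where "k = level_kernel n a b c d"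
  let ?rB = "\<lambda>t. (real (card (B \<inter> leg1 t)))\<^sup>2" and ?rD = "\<lambda>t. (real (card (D \<inter> leg2 t)))\<^sup>2"
  let ?rA = "\<lambda>t. (real (card (A \<inter> opp1 t)))\<^sup>2"
  define hB where "hB t \<longleftrightarrow> 4 * 2 powr b \<le> ?rB t" for t
  define hD where "hD t \<longleftrightarrow> 4 * 2 powr d \<le> ?rD t" for t
  define hA where "hA t \<longleftrightarrow> 4 * 2 powr a \<le> ?rA t" for t
  define tB where "tB t \<longleftrightarrow> hB t \<and> 16 * 2 powr (2 * b) \<le> 2 powr c * ?rB t" for t
  define tD where "tD t \<longleftrightarrow> hD t \<and> 16 * 2 powr (2 * d) \<le> 2 powr c * ?rD t" for t
  have h: "hB t \<Longrightarrow> \<not> tB t \<Longrightarrow> 2 powr c * ?rB t < 16 * 2 powr (2 * b)"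
    "hD t \<Longrightarrow> \<not> tD t \<Longrightarrow> 2 powr c * ?rD t < 16 * 2 powr (2 * d)" for t
    by (auto simp: tB_def tD_def)
  define T1 T1' T2 T2' T3 T3' T4 T5 where
    "T1 = {t \<in> T. tD t}" and "T1' = {t \<in> T. tB t}"
    and "T2 = {t \<in> T. hD t \<and> \<not> tD t \<and> \<not> hB t}" and "T2' = {t \<in> T. hB t \<and> \<not> tB t \<and> \<not> hD t}"
    and "T3 = {t \<in> T. hD t \<and> hA t}" and "T3' = {t \<in> T. hB t \<and> hA (flip t)}"
    and "T4 = {t \<in> T. hD t \<and> \<not> tD t \<and> hB t \<and> \<not> tB t \<and> \<not> hA t \<and> \<not> hA (flip t)}"
    and "T5 = {t \<in> T. \<not> hB t \<and> \<not> hD t}"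
  note defs = T1_def T1'_def T2_def T2'_def T3_def T3'_def T4_def T5_def
  have sub: "T1 \<subseteq> corners A B C D" "T1' \<subseteq> corners A B C D" "T2 \<subseteq> corners A B C D" "T2' \<subseteq> corners A B C D"
    "T3 \<subseteq> corners A B C D" "T3' \<subseteq> corners A B C D" "T4 \<subseteq> corners A B C D" "T5 \<subseteq> corners A B C D"
    using T by (auto simp: defs)
  \<comment> \<open>The exponents \<open>a + c\<close> and \<open>b + d\<close> have the mean
    \<open>(a + b + c + d) / 2\<close>, and the smaller one lies half their distance below
    it.\<close>
  have min: "real x \<le> 2 * (S * k)" if "real x \<le> 2 * 2 powr (a + c)" "real x \<le> 2 * 2 powr (b + d)" for x :: nat
  proof -
    have "real x \<le> 2 * 2 powr ((a + b + c + d) / 2 - \<bar>a + c - b - d\<bar> / 2)"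
    proof (cases "a + c \<le> b + d")
      case True
      then have "(a + b + c + d) / 2 - \<bar>a + c - b - d\<bar> / 2 = a + c" by (simp add: field_simps)
      then show ?thesis using that by simp
    next
      case False
      then have "(a + b + c + d) / 2 - \<bar>a + c - b - d\<bar> / 2 = b + d" by (simp add: field_simps)
      then show ?thesis using that by simp
    qed
    also have "2 powr ((a + b + c + d) / 2 - \<bar>a + c - b - d\<bar> / 2) = S * 2 powr (- \<bar>a + c - b - d\<bar> / 2)"
      by (simp add: S_def powr_add[symmetric])
    also have "2 * \<dots> \<le> 2 * (S * k)" by (intro mult_left_mono) (auto simp: S_def k_def level_kernel_def)
    finally show ?thesis .
  qed
  have c1: "real (card T1) \<le> 2 * (S * k)"
    by (rule min[OF top_D[OF fin cards sub(1)] heavy_D[OF fin cards sub(1)]])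
      (simp_all add: T1_def tD_def hD_def)
  have c1f: "real (card T1') \<le> 2 * (S * k)"
  proof -
    note f = flip_corners[OF sub(2)]
    have "real (card (flip ` T1')) \<le> 2 * 2 powr (a + c)"
      by (rule top_D[OF fin(1,4,3,2) cards(1,4,3,2) f]) (auto simp: T1'_def tB_def hB_def)
    moreover have "real (card (flip ` T1')) \<le> 2 * 2 powr (d + b)"
      by (rule heavy_D[OF fin(1,4,3,2) cards(1,4,3,2) f]) (auto simp: T1'_def tB_def hB_def)
    ultimately show ?thesis using min by (simp add: card_flip add.commute)
  qed
  have c2: "real (card T2) \<le> 24 * (S * k)"
  proof -
    have "real (card T2) \<le> 24 * 2 powr ((b + c) / 2 + d)"
      by (rule mid_light[OF fin cards sub(3)]) (use h in \<open>auto simp: T2_def hB_def hD_def\<close>)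
    also have "2 powr ((b + c) / 2 + d) \<le> S * 2 powr ((d - a) / 6)"
      using le unfolding S_def powr_add[symmetric] by (intro powr_mono) (auto simp: field_simps)
    also have "24 * \<dots> \<le> 24 * (S * k)" by (intro mult_left_mono) (auto simp: S_def k_def level_kernel_def)
    finally show ?thesis by simp
  qed
  have c2f: "real (card T2') \<le> 24 * (S * k)"
  proof -
    have "real (card (flip ` T2')) \<le> 24 * 2 powr ((d + c) / 2 + b)"
      by (rule mid_light[OF fin(1,4,3,2) cards(1,4,3,2) flip_corners[OF sub(4)]])
        (use h in \<open>auto simp: T2'_def hB_def hD_def\<close>)
    also have "2 powr ((d + c) / 2 + b) \<le> S * 2 powr ((b - a) / 6)"
      using le unfolding S_def powr_add[symmetric] by (intro powr_mono) (auto simp: field_simps)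
    also have "24 * \<dots> \<le> 24 * (S * k)" by (intro mult_left_mono) (auto simp: S_def k_def level_kernel_def)
    finally show ?thesis by (simp add: card_flip)
  qed
  have c3: "real (card T3) \<le> 2 * (S * k)"
    by (rule min[OF heavy_A[OF fin cards sub(5)] heavy_D[OF fin cards sub(5)]])
      (simp_all add: T3_def hA_def hD_def)
  have c3f: "real (card T3') \<le> 2 * (S * k)"
  proof -
    note f = flip_corners[OF sub(6)]
    have "real (card (flip ` T3')) \<le> 2 * 2 powr (a + c)"
      by (rule heavy_A[OF fin(1,4,3,2) cards(1,4,3,2) f]) (auto simp: T3'_def hA_def hB_def)
    moreover have "real (card (flip ` T3')) \<le> 2 * 2 powr (d + b)"
      by (rule heavy_D[OF fin(1,4,3,2) cards(1,4,3,2) f]) (auto simp: T3'_def hB_def)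
    ultimately show ?thesis using min by (simp add: card_flip add.commute)
  qed
  define K where "K = 48 * dyadic_const (3/4) (1/4) * dyadic_const (1/4) (3/4)"
  have K: "K \<ge> 0" using dyadic_const_pos[of "3/4" "1/4"] dyadic_const_pos[of "1/4" "3/4"] by (simp add: K_def)
  have c4: "real (card T4) \<le> K * (S * k)"
  proof -
    have u: "real (card T4) \<le> K * 2 powr ((a + b + c + d) / 2 - (b - d) / 4)"
      unfolding K_def
      by (rule mid_mid[OF fin cards sub(7) n le]) (use h in \<open>auto simp: T4_def hB_def hD_def hA_def\<close>)
    \<comment> \<open>Exchanging the legs reverses the sign of \<open>b - d\<close>, so the better
      of the two bounds decays in the absolute value.\<close>
    have "real (card (flip ` T4)) \<le> K * 2 powr ((a + d + c + b) / 2 - (d - b) / 4)"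
      unfolding K_def
      by (rule mid_mid[OF fin(1,4,3,2) cards(1,4,3,2) flip_corners[OF sub(7)] n(2,1) le(3,2,1)])
        (use h in \<open>auto simp: T4_def hB_def hD_def hA_def\<close>)
    then have v: "real (card T4) \<le> K * 2 powr ((a + d + c + b) / 2 - (d - b) / 4)" by (simp add: card_flip)
    have "real (card T4) \<le> K * 2 powr ((a + b + c + d) / 2 + - \<bar>b - d\<bar> / 4)"
    proof (cases "b \<ge> d")
      case True
      then have "\<bar>b - d\<bar> = b - d" by simp
      then show ?thesis using u by (simp only: minus_divide_left[symmetric] diff_conv_add_uminus)
    next
      case False
      then have "(a + d + c + b) / 2 - (d - b) / 4 = (a + b + c + d) / 2 + - \<bar>b - d\<bar> / 4" by (simp add: field_simps)
      then show ?thesis using v by simp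
    qed
    also have "\<dots> \<le> K * (S * k)"
      unfolding powr_add S_def using K by (intro mult_left_mono) (auto simp: k_def level_kernel_def)
    finally show ?thesis .
  qed
  have c5: "real (card T5) \<le> 110592 * 1920 * (S * k)"
  proof -
    have "real (card T5) \<le> 110592 * 1920 * 2 powr ((a + b + c + d) / 2) * level_kernel n a b c d"
      by (rule light_light[OF fin cards sub(8) n le]) (auto simp: T5_def hB_def hD_def)
    then show ?thesis by (simp only: S_def k_def mult.assoc)
  qed
  have "T \<subseteq> T1 \<union> T1' \<union> T2 \<union> T2' \<union> T3 \<union> T3' \<union> T4 \<union> T5" 
  proof
    fix t assume t: "t \<in> T"
    have "tD t \<or> tB t \<or> hD t \<and> \<not> tD t \<and> \<not> hB t \<or> hB t \<and> \<not> tB t \<and> \<not> hD t \<or> hD t \<and> hA t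
      \<or> hB t \<and> hA (flip t) \<or> hD t \<and> \<not> tD t \<and> hB t \<and> \<not> tB t \<and> \<not> hA t \<and> \<not> hA (flip t) \<or> \<not> hB t \<and> \<not> hD t"
      by argo
    then show "t \<in> T1 \<union> T1' \<union> T2 \<union> T2' \<union> T3 \<union> T3' \<union> T4 \<union> T5"
      unfolding defs using t by (elim disjE) simp_all
  qed
  then have "card T \<le> card (T1 \<union> T1' \<union> T2 \<union> T2' \<union> T3 \<union> T3' \<union> T4 \<union> T5)"
    using finT by (intro card_mono) (auto simp: defs)
  also have "\<dots> \<le> card T1 + card T1' + card T2 + card T2' + card T3 + card T3' + card T4 + card T5"
    using card_Un_le[of T1 T1'] card_Un_le[of "T1 \<union> T1'" T2] card_Un_le[of "T1 \<union> T1' \<union> T2" T2']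
      card_Un_le[of "T1 \<union> T1' \<union> T2 \<union> T2'" T3] card_Un_le[of "T1 \<union> T1' \<union> T2 \<union> T2' \<union> T3" T3']
      card_Un_le[of "T1 \<union> T1' \<union> T2 \<union> T2' \<union> T3 \<union> T3'" T4]
      card_Un_le[of "T1 \<union> T1' \<union> T2 \<union> T2' \<union> T3 \<union> T3' \<union> T4" T5] by linarith
  finally have "real (card T) \<le> real (card T1 + card T1' + card T2 + card T2' + card T3 + card T3' + card T4 + card T5)"
    by (rule of_nat_mono)
  also have "\<dots> \<le> 2 * (S * k) + 2 * (S * k) + 24 * (S * k) + 24 * (S * k) + 2 * (S * k) + 2 * (S * k) + K * (S * k)
      + 110592 * 1920 * (S * k)"
    unfolding of_nat_add using c1 c1f c2 c2f c3 c3f c4 c5 by (intro add_mono)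
  also have "\<dots> \<le> rect_const * (S * k)"
  proof -
    have "S * k \<ge> 0" by (simp add: S_def k_def level_kernel_def)
    then show ?thesis unfolding rect_const_def K_def[symmetric] by (simp add: distrib_right)
  qed
  finally show ?thesis by (simp add: T_def S_def k_def)
qed

section \<open>The energy of a function on the lattice\<close>

lemma sum_powr_distance:
  fixes e z :: real
  assumes "e > 0"
  shows "(\<Sum>k<m. 2 powr (- e * \<bar>real k - z\<bar>)) \<le> dyadic_const e e"
proof -
  have "(\<Sum>k<m. 2 powr (- e * \<bar>real k - z\<bar>)) = (\<Sum>k<m. min (2 powr (- e * z + e * real k)) (2 powr (e * z - e * real k)))"
  proof (rule sum.cong[OF refl])
    fix k
    have "2 powr (- e * \<bar>real k - z\<bar>) = min (2 powr (- e * (z - real k))) (2 powr (- e * (real k - z)))"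
      using assms by (cases "real k \<le> z") (auto simp: min_def mult_le_cancel_left)
    then show "2 powr (- e * \<bar>real k - z\<bar>) = min (2 powr (- e * z + e * real k)) (2 powr (e * z - e * real k))"
      by (simp add: algebra_simps)
  qed
  also have "\<dots> \<le> dyadic_const e e * 2 powr ((e * (- e * z) + e * (e * z)) / (e + e))"
    by (rule dyadic_sum[OF assms assms])
  finally show ?thesis by simp
qed

text \<open>The Schur test with the pairs (i, j) and (k, l) as row and column indices; the
  inequality between the arithmetic and geometric means separates the two pairs.\<close>

lemma schur_quadrilinear:
  fixes f :: "nat \<Rightarrow> real" and K :: "nat \<Rightarrow> nat \<Rightarrow> nat \<Rightarrow> nat \<Rightarrow> real"
  assumes f: "\<And>j. f j \<ge> 0" and K: "\<And>i j k l. K i j k l \<ge> 0"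
    and 1: "\<And>i j. (\<Sum>k<m. \<Sum>l<m. K i j k l) \<le> M"
    and 2: "\<And>k l. (\<Sum>i<m. \<Sum>j<m. K i j k l) \<le> M"
  shows "(\<Sum>i<m. \<Sum>j<m. \<Sum>k<m. \<Sum>l<m. f i * f j * f k * f l * K i j k l) \<le> M * (\<Sum>j<m. (f j)\<^sup>2)\<^sup>2"
proof -
  let ?N = "\<Sum>j<m. (f j)\<^sup>2"
  have "(\<Sum>i<m. \<Sum>j<m. \<Sum>k<m. \<Sum>l<m. f i * f j * f k * f l * K i j k l)
    \<le> (\<Sum>i<m. \<Sum>j<m. \<Sum>k<m. \<Sum>l<m. (f i)\<^sup>2 * (f j)\<^sup>2 * K i j k l / 2 + (f k)\<^sup>2 * (f l)\<^sup>2 * K i j k l / 2)"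
  proof (intro sum_mono)
    fix i j k l
    have "2 * ((f i * f j) * (f k * f l)) \<le> (f i * f j)\<^sup>2 + (f k * f l)\<^sup>2"
      using sum_squares_bound[of "f i * f j" "f k * f l"] by (simp add: mult.assoc)
    then have "f i * f j * f k * f l \<le> ((f i)\<^sup>2 * (f j)\<^sup>2 + (f k)\<^sup>2 * (f l)\<^sup>2) / 2"
      by (simp add: power_mult_distrib mult_ac)
    from mult_right_mono[OF this K[of i j k l]]
    show "f i * f j * f k * f l * K i j k l \<le> (f i)\<^sup>2 * (f j)\<^sup>2 * K i j k l / 2 + (f k)\<^sup>2 * (f l)\<^sup>2 * K i j k l / 2"
      by (simp add: algebra_simps add_divide_distrib)
  qed
  also have "\<dots> = (\<Sum>i<m. \<Sum>j<m. \<Sum>k<m. \<Sum>l<m. (f i)\<^sup>2 * (f j)\<^sup>2 * K i j k l / 2)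
      + (\<Sum>i<m. \<Sum>j<m. \<Sum>k<m. \<Sum>l<m. (f k)\<^sup>2 * (f l)\<^sup>2 * K i j k l / 2)"
    by (simp add: sum.distrib)
  also have "(\<Sum>i<m. \<Sum>j<m. \<Sum>k<m. \<Sum>l<m. (f i)\<^sup>2 * (f j)\<^sup>2 * K i j k l / 2)
      = (\<Sum>i<m. \<Sum>j<m. (f i)\<^sup>2 * (f j)\<^sup>2 / 2 * (\<Sum>k<m. \<Sum>l<m. K i j k l))"
    by (simp add: sum_distrib_left)
  also have "\<dots> \<le> (\<Sum>i<m. \<Sum>j<m. (f i)\<^sup>2 * (f j)\<^sup>2 / 2 * M)"
    by (intro sum_mono mult_left_mono 1) auto
  also have "(\<Sum>i<m. \<Sum>j<m. \<Sum>k<m. \<Sum>l<m. (f k)\<^sup>2 * (f l)\<^sup>2 * K i j k l / 2)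
      = (\<Sum>i<m. \<Sum>k<m. \<Sum>j<m. \<Sum>l<m. (f k)\<^sup>2 * (f l)\<^sup>2 * K i j k l / 2)"
    by (intro sum.cong refl sum.swap)
  also have "\<dots> = (\<Sum>k<m. \<Sum>i<m. \<Sum>j<m. \<Sum>l<m. (f k)\<^sup>2 * (f l)\<^sup>2 * K i j k l / 2)" by (rule sum.swap)
  also have "\<dots> = (\<Sum>k<m. \<Sum>i<m. \<Sum>l<m. \<Sum>j<m. (f k)\<^sup>2 * (f l)\<^sup>2 * K i j k l / 2)"
    by (intro sum.cong refl sum.swap)
  also have "\<dots> = (\<Sum>k<m. \<Sum>l<m. \<Sum>i<m. \<Sum>j<m. (f k)\<^sup>2 * (f l)\<^sup>2 * K i j k l / 2)"
    by (intro sum.cong refl sum.swap)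
  also have "\<dots> = (\<Sum>k<m. \<Sum>l<m. (f k)\<^sup>2 * (f l)\<^sup>2 / 2 * (\<Sum>i<m. \<Sum>j<m. K i j k l))"
    by (simp add: sum_distrib_left)
  also have "\<dots> \<le> (\<Sum>k<m. \<Sum>l<m. (f k)\<^sup>2 * (f l)\<^sup>2 / 2 * M)"
    by (intro sum_mono mult_left_mono 2) auto
  also have "(\<Sum>i<m. \<Sum>j<m. (f i)\<^sup>2 * (f j)\<^sup>2 / 2 * M) = M / 2 * ?N\<^sup>2"
    unfolding power2_eq_square[of ?N] sum_product by (simp add: sum_distrib_left mult_ac)
  finally show ?thesis by simp
qed

definition kappa :: real where "kappa = dyadic_const (1/6) (1/6)"

lemma kappa_pos: "kappa > 0"
  by (simp add: kappa_def dyadic_const_pos)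

lemma sum_kappa: "(\<Sum>k<m. 2 powr (- \<bar>real k - z\<bar> / 6)) \<le> kappa"
  using sum_powr_distance[of "1/6" z m] by (simp add: kappa_def)

definition top_kernel :: "nat \<Rightarrow> nat \<Rightarrow> nat \<Rightarrow> nat \<Rightarrow> nat \<Rightarrow> real" where
  "top_kernel m i j k l = (if j \<le> i \<and> k \<le> i \<and> l \<le> i then level_kernel m i j k l else 0)"

text \<open>Since \<open>i\<close> is the top level, every gain is a decay in a distance between
  levels. The product of the three gains retains decay in two independent distances, chosen so that
  summing over either pair of indices converges despite the factor \<open>m\<close>.\<close>

lemma top_kernel_le:
  "top_kernel m i j k l \<le> 2 powr (- \<bar>real l - (real i + real k - real j)\<bar> / 6)
     + 2 powr (- \<bar>real j - real l\<bar> / 6) + 2 powr (- \<bar>real i - real k\<bar> / 6)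
     + 2 powr (- \<bar>real i - real l\<bar> / 6)
     + m * (2 powr (- \<bar>real i - real k\<bar> / 6) * 2 powr (- \<bar>real j - real l\<bar> / 6))
     + 2 powr (- \<bar>real i - real j\<bar> / 6)"
proof (cases "j \<le> i \<and> k \<le> i \<and> l \<le> i")
  case True
  then have le: "real j \<le> i" "real k \<le> i" "real l \<le> i" by auto
  have "2 powr (- \<bar>real i + k - j - l\<bar> / 2) \<le> 2 powr (- \<bar>real l - (real i + real k - real j)\<bar> / 6)"
  proof (rule powr_mono)
    have "\<bar>real l - (real i + real k - real j)\<bar> = \<bar>real i + real k - real j - real l\<bar>" by linarith
    then show "- \<bar>real i + real k - real j - real l\<bar> / 2 \<le> - \<bar>real l - (real i + real k - real j)\<bar> / 6" by simp
  qed simp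
  moreover have "2 powr (- \<bar>real j - real l\<bar> / 4) \<le> 2 powr (- \<bar>real j - real l\<bar> / 6)" by (rule powr_mono) auto
  moreover have "2 powr ((real j - i) / 6) = 2 powr (- \<bar>real i - real j\<bar> / 6)"
    "2 powr ((real k - i) / 6) = 2 powr (- \<bar>real i - real k\<bar> / 6)"
    "2 powr ((real l - i) / 6) = 2 powr (- \<bar>real i - real l\<bar> / 6)" using le by simp_all
  moreover have "2 powr ((real j - i) / 6 + (real k - i) / 6 + (real l - i) / 6)
      \<le> 2 powr (- \<bar>real i - real k\<bar> / 6) * 2 powr (- \<bar>real j - real l\<bar> / 6)"
    unfolding powr_add[symmetric] using le by (intro powr_mono) (auto simp: abs_if field_simps)
  from mult_left_mono[OF this, of "real m"]
  have "m * 2 powr ((real j - i) / 6 + (real k - i) / 6 + (real l - i) / 6)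
      \<le> m * (2 powr (- \<bar>real i - real k\<bar> / 6) * 2 powr (- \<bar>real j - real l\<bar> / 6))" by simp
  ultimately show ?thesis using True unfolding top_kernel_def level_kernel_def if_P[OF True] by linarith
next
  case False
  then have "top_kernel m i j k l = 0" by (simp only: top_kernel_def if_False)
  then show ?thesis by (simp add: add_nonneg_nonneg)
qed

lemma sum_top_kernel:
  fixes f :: "nat \<Rightarrow> real"
  assumes f: "\<And>j. f j \<ge> 0"
  shows "(\<Sum>i<m. \<Sum>j<m. \<Sum>k<m. \<Sum>l<m. f i * f j * f k * f l * top_kernel m i j k l)
    \<le> (5 * kappa + kappa\<^sup>2) * m * (\<Sum>j<m. (f j)\<^sup>2)\<^sup>2"
proof -
  let ?q = "\<lambda>x y. 2 powr (- \<bar>real x - real y\<bar> / 6)"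
  let ?z = "\<lambda>i j k l. 2 powr (- \<bar>real l - (real i + real k - real j)\<bar> / 6)"
  \<comment> \<open>The summand \<open>?q i j\<close> stays outside \<open>K\<close>: it does not
    depend on \<open>k\<close> and \<open>l\<close>, so its sums over them would be quadratic in
    \<open>m\<close>.\<close>
  define K where "K i j k l = ?z i j k l + ?q j l + ?q i k + ?q i l + m * (?q i k * ?q j l)" for i j k l
  let ?N = "\<Sum>j<m. (f j)\<^sup>2" and ?f = "\<lambda>i j k l. f i * f j * f k * f l"
  have qs: "(\<Sum>x<m. ?q x y) \<le> kappa" "(\<Sum>x<m. ?q y x) \<le> kappa" for y
    using sum_kappa[of "real y" m] by (simp_all add: abs_minus_commute)
  have const: "(\<Sum>x<m. c) \<le> m * (c::real)" for c by simp
  have q2: "(\<Sum>x<m. \<Sum>y<m. ?q w x * ?q v y) \<le> kappa\<^sup>2" for w v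
  proof -
    have "(\<Sum>x<m. \<Sum>y<m. ?q w x * ?q v y) = (\<Sum>x<m. ?q w x) * (\<Sum>y<m. ?q v y)" by (simp add: sum_product)
    also have "\<dots> \<le> kappa * kappa" using qs kappa_pos by (intro mult_mono) (auto intro: sum_nonneg)
    finally show ?thesis by (simp add: power2_eq_square)
  qed
  have m1: "(\<Sum>x<m. \<Sum>y<m. F x y) \<le> m * kappa" if "\<And>x. (\<Sum>y<m. F x y) \<le> kappa" for F :: "nat \<Rightarrow> nat \<Rightarrow> real"
    using sum_mono[of "{..<m}" "\<lambda>x. \<Sum>y<m. F x y" "\<lambda>_. kappa"] that by simp
  have m2: "(\<Sum>x<m. \<Sum>y<m. F x y) \<le> m * kappa" if "\<And>y. (\<Sum>x<m. F x y) \<le> kappa" for F :: "nat \<Rightarrow> nat \<Rightarrow> real"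
    by (subst sum.swap) (rule m1[OF that])
  have 1: "(\<Sum>k<m. \<Sum>l<m. K i j k l) \<le> (4 * kappa + kappa\<^sup>2) * m" for i j
  proof -
    have "(\<Sum>k<m. \<Sum>l<m. K i j k l) = (\<Sum>k<m. \<Sum>l<m. ?z i j k l) + (\<Sum>k<m. \<Sum>l<m. ?q j l)
       + (\<Sum>k<m. \<Sum>l<m. ?q i k) + (\<Sum>k<m. \<Sum>l<m. ?q i l) + m * (\<Sum>k<m. \<Sum>l<m. ?q i k * ?q j l)"
      by (simp add: K_def sum.distrib sum_distrib_left)
    also have "\<dots> \<le> m * kappa + m * kappa + m * kappa + m * kappa + m * kappa\<^sup>2"
      by (intro add_mono mult_left_mono q2 m1 sum_kappa qs m2[of "\<lambda>k l. ?q i k"]) auto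
    finally show ?thesis by (simp add: algebra_simps)
  qed
  have 2: "(\<Sum>i<m. \<Sum>j<m. K i j k l) \<le> (4 * kappa + kappa\<^sup>2) * m" for k l
  proof -
    have z: "?z i j k l = 2 powr (- \<bar>real i - (real l + real j - real k)\<bar> / 6)" for i j
      by (simp add: abs_minus_commute algebra_simps)
    have "(\<Sum>i<m. \<Sum>j<m. K i j k l) = (\<Sum>i<m. \<Sum>j<m. ?z i j k l) + (\<Sum>i<m. \<Sum>j<m. ?q j l)
       + (\<Sum>i<m. \<Sum>j<m. ?q i k) + (\<Sum>i<m. \<Sum>j<m. ?q i l) + m * (\<Sum>i<m. \<Sum>j<m. ?q k i * ?q l j)"
      by (simp add: K_def sum.distrib sum_distrib_left abs_minus_commute)
    also have "\<dots> \<le> m * kappa + m * kappa + m * kappa + m * kappa + m * kappa\<^sup>2"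
      by (intro add_mono mult_left_mono q2 m2[of "\<lambda>i j. ?z i j k l"] m1[of "\<lambda>i j. ?q j l"] m2[of "\<lambda>i j. ?q i k"] m2[of "\<lambda>i j. ?q i l"])
        (auto simp only: z intro!: sum_kappa qs)
    finally show ?thesis by (simp add: algebra_simps)
  qed
  have K0: "K i j k l \<ge> 0" for i j k l by (simp add: K_def)
  have "(\<Sum>i<m. \<Sum>j<m. \<Sum>k<m. \<Sum>l<m. ?f i j k l * top_kernel m i j k l)
     \<le> (\<Sum>i<m. \<Sum>j<m. \<Sum>k<m. \<Sum>l<m. ?f i j k l * (K i j k l + ?q i j))"
    using f top_kernel_le unfolding K_def by (intro sum_mono mult_left_mono) auto
  also have "\<dots> = (\<Sum>i<m. \<Sum>j<m. \<Sum>k<m. \<Sum>l<m. ?f i j k l * K i j k l)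
      + (\<Sum>i<m. \<Sum>j<m. \<Sum>k<m. \<Sum>l<m. ?f i j k l * ?q i j)"
    by (simp add: distrib_left sum.distrib)
  \<comment> \<open>For this summand the indices are paired as (i, k) and (j, l), which makes its
    row and column sums linear in \<open>m\<close>.\<close>
  also have "(\<Sum>i<m. \<Sum>j<m. \<Sum>k<m. \<Sum>l<m. ?f i j k l * ?q i j)
      = (\<Sum>i<m. \<Sum>k<m. \<Sum>j<m. \<Sum>l<m. ?f i k j l * ?q i j)"
    by (subst sum.swap) (simp add: mult_ac)
  also have "\<dots> \<le> (kappa * m) * ?N\<^sup>2"
    by (rule schur_quadrilinear[OF f]) (use m2[of "\<lambda>x y. ?q _ x"] m2[of "\<lambda>x y. ?q x _"] qs in \<open>auto simp: mult.commute\<close>)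
  also have "(\<Sum>i<m. \<Sum>j<m. \<Sum>k<m. \<Sum>l<m. ?f i j k l * K i j k l) \<le> ((4 * kappa + kappa\<^sup>2) * m) * ?N\<^sup>2"
    by (rule schur_quadrilinear[OF f K0 1 2])
  finally show ?thesis by (simp add: algebra_simps)
qed


section \<open>From corner sets to weighted rectangle sums\<close>

lemma rect_const_pos: "rect_const > 0"
  using dyadic_const_pos[of "3/4" "1/4"] dyadic_const_pos[of "1/4" "3/4"]
  by (simp add: rect_const_def add_pos_pos)

text \<open>Renaming the corners cyclically lets the largest set take the first place, as
  \<open>card_corners_le\<close> requires.\<close>

lemma card_corners_rotate:
  assumes "finite A" "finite C" "finite D"
  shows "card (corners A B C D) \<le> card (corners B C D A)"
proof (rule card_inj_on_le)
  let ?r = "\<lambda>t. (fst (snd t), snd (snd t), fourth t)"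
  show "inj_on ?r (corners A B C D)"
    by (rule inj_onI) (auto simp: fourth_def prod_eq_iff)
  show "?r ` corners A B C D \<subseteq> corners B C D A"
  proof (rule image_subsetI)
    fix t assume t: "t \<in> corners A B C D"
    obtain x y z where [simp]: "t = (x, y, z)" by (rule prod_cases3)
    show "?r t \<in> corners B C D A"
      using t right_angle_opposite[of x y z] by (simp add: corners_def fourth_def)
  qed
  show "finite (corners B C D A)" using finite_corners[OF assms(2,3,1) order.refl] .
qed

lemma card_corners_le_top_kernel:
  assumes fin: "\<And>j. finite (S j)" and card: "\<And>j. real (card (S j)) \<le> 2 ^ j"
    and m: "i < m" "j < m" "k < m" "l < m"
  shows "real (card (corners (S i) (S j) (S k) (S l))) \<le> rect_const * (2 powr ((real i + j + k + l) / 2)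
    * (top_kernel m i j k l + top_kernel m j k l i + top_kernel m k l i j + top_kernel m l i j k))"
proof -
  have card': "real (card (S j)) \<le> 2 powr (real j)" for j using card by (simp add: powr_realpow)
  have nonneg: "top_kernel n a b c d \<ge> 0" for n a b c d
    by (simp add: top_kernel_def level_kernel_def add_nonneg_nonneg)
  have top: "real (card (corners (S a) (S b) (S c) (S d))) \<le> rect_const * (2 powr ((real a + b + c + d) / 2)
    * (top_kernel m a b c d + z))"
    if "b < m" "d < m" "b \<le> a" "c \<le> a" "d \<le> a" "z \<ge> 0" for a b c d z
  proof -
    have "real (card (corners (S a) (S b) (S c) (S d))) \<le> rect_const * (2 powr ((real a + b + c + d) / 2)
      * level_kernel m a b c d)"
      by (rule card_corners_le) (use fin card' that in auto)
    also have "\<dots> \<le> rect_const * (2 powr ((real a + b + c + d) / 2) * (top_kernel m a b c d + z))"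
      using that rect_const_pos by (intro mult_left_mono) (auto simp: top_kernel_def)
    finally show ?thesis .
  qed
  have rot: "real (card (corners (S a) (S b) (S c) (S d))) \<le> card (corners (S b) (S c) (S d) (S a))" for a b c d
    using card_corners_rotate fin by simp
  consider "j \<le> i \<and> k \<le> i \<and> l \<le> i" | "i \<le> j \<and> k \<le> j \<and> l \<le> j" | "i \<le> k \<and> j \<le> k \<and> l \<le> k" | "i \<le> l \<and> j \<le> l \<and> k \<le> l"
    by linarith
  then show ?thesis
  proof cases
    case 1
    then show ?thesis
      using top[of j l i k "top_kernel m j k l i + top_kernel m k l i j + top_kernel m l i j k"] m nonneg
      by (simp add: add_ac)
  next
    case 2
    then show ?thesis
      using rot[of i j k l] top[of k i j l "top_kernel m i j k l + top_kernel m k l i j + top_kernel m l i j k"] m nonneg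
      by (simp add: add_ac)
  next
    case 3
    then show ?thesis
      using rot[of i j k l] rot[of j k l i]
        top[of l j k i "top_kernel m i j k l + top_kernel m j k l i + top_kernel m l i j k"] m nonneg
      by (simp add: add_ac)
  next
    case 4
    then show ?thesis
      using rot[of i j k l] rot[of j k l i] rot[of k l i j]
        top[of i k l j "top_kernel m i j k l + top_kernel m j k l i + top_kernel m k l i j"] m nonneg
      by (simp add: add_ac)
  qed
qed

lemma sum4_rotate:
  fixes F :: "nat \<Rightarrow> nat \<Rightarrow> nat \<Rightarrow> nat \<Rightarrow> real"
  shows "(\<Sum>i<m. \<Sum>j<m. \<Sum>k<m. \<Sum>l<m. F j k l i) = (\<Sum>i<m. \<Sum>j<m. \<Sum>k<m. \<Sum>l<m. F i j k l)"
proof -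
  have "(\<Sum>i<m. \<Sum>j<m. \<Sum>k<m. \<Sum>l<m. F j k l i) = (\<Sum>j<m. \<Sum>i<m. \<Sum>k<m. \<Sum>l<m. F j k l i)" by (rule sum.swap)
  also have "\<dots> = (\<Sum>j<m. \<Sum>k<m. \<Sum>i<m. \<Sum>l<m. F j k l i)" by (intro sum.cong refl sum.swap)
  also have "\<dots> = (\<Sum>j<m. \<Sum>k<m. \<Sum>l<m. \<Sum>i<m. F j k l i)" by (intro sum.cong refl sum.swap)
  finally show ?thesis .
qed

definition corner_energy :: "pt set \<Rightarrow> (pt \<Rightarrow> real) \<Rightarrow> real" where
  "corner_energy P g = (\<Sum>t\<in>corners P P P P. g (fst t) * g (fst (snd t)) * g (snd (snd t)) * g (fourth t))"

text \<open>The four weights \<open>2 powr (- real (lev p) / 2)\<close> cancel the factor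
  \<open>2 powr ((real i + j + k + l) / 2)\<close> of the rectangle count, so that only the kernel
  remains to be summed against \<open>f\<close>.\<close>

lemma corner_energy_levels:
  assumes P: "finite P" and lev: "\<And>p. p \<in> P \<Longrightarrow> lev p < m"
    and card: "\<And>j. real (card {p \<in> P. lev p = j}) \<le> 2 ^ j"
    and g: "\<And>p. g p \<ge> 0" "\<And>p. p \<in> P \<Longrightarrow> g p \<le> f (lev p) * 2 powr (- real (lev p) / 2)"
    and f: "\<And>j. f j \<ge> 0"
  shows "corner_energy P g \<le> 4 * rect_const * (5 * kappa + kappa\<^sup>2) * m * (\<Sum>j<m. (f j)\<^sup>2)\<^sup>2"
proof -
  define S where "S j = {p \<in> P. lev p = j}" for j
  have S: "finite (S j)" "real (card (S j)) \<le> 2 ^ j" for j using P card by (auto simp: S_def)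
  let ?f = "\<lambda>i j k l. f i * f j * f k * f l" and ?e = "\<lambda>i j k l. 2 powr ((real i + j + k + l) / 2)"
  let ?T = "corners P P P P" and ?q = "\<lambda>t. (lev (fourth t), lev (fst t), lev (fst (snd t)), lev (snd (snd t)))"
  let ?G = "\<lambda>t. g (fst t) * g (fst (snd t)) * g (snd (snd t)) * g (fourth t)"
  let ?I = "{..<m} \<times> {..<m} \<times> {..<m} \<times> {..<m}"
  let ?t = "\<lambda>i j k l. ?f i j k l * top_kernel m i j k l"
  have finT: "finite ?T" by (rule finite_corners[OF P P P order.refl])
  have fibre: "(\<Sum>t\<in>{t \<in> ?T. ?q t = (i, j, k, l)}. ?G t)
      \<le> rect_const * (?t i j k l + ?t j k l i + ?t k l i j + ?t l i j k)"
    if m: "i < m" "j < m" "k < m" "l < m" for i j k l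
  proof -
    have sub: "{t \<in> ?T. ?q t = (i, j, k, l)} \<subseteq> corners (S i) (S j) (S k) (S l)"
      by (rule subsetI) (simp add: corners_def S_def)
    have b: "?G t \<le> ?f i j k l * inverse (?e i j k l)" if t: "t \<in> {t \<in> ?T. ?q t = (i, j, k, l)}" for t
    proof -
      have mem: "fourth t \<in> P" "lev (fourth t) = i" "fst t \<in> P" "lev (fst t) = j" "fst (snd t) \<in> P" "lev (fst (snd t)) = k"
        "snd (snd t) \<in> P" "lev (snd (snd t)) = l" using t by (simp_all add: corners_def)
      have "?G t \<le> (f j * 2 powr (- real j / 2)) * (f k * 2 powr (- real k / 2)) * (f l * 2 powr (- real l / 2))
          * (f i * 2 powr (- real i / 2))"
        using g(2)[OF mem(1)] g(2)[OF mem(3)] g(2)[OF mem(5)] g(2)[OF mem(7)] mem g(1) f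
        by (intro mult_mono mult_nonneg_nonneg) auto
      also have "\<dots> = ?f i j k l * 2 powr (- real i / 2 + - real j / 2 + - real k / 2 + - real l / 2)"
        by (simp only: powr_add mult_ac)
      also have "- real i / 2 + - real j / 2 + - real k / 2 + - real l / 2 = - ((real i + j + k + l) / 2)" by (simp add: field_simps)
      also have "2 powr (- ((real i + j + k + l) / 2)) = inverse (?e i j k l)" by (rule powr_minus)
      finally show ?thesis .
    qed
    have ff: "?f i j k l * inverse (?e i j k l) \<ge> 0" using f by simp
    have "(\<Sum>t\<in>{t \<in> ?T. ?q t = (i, j, k, l)}. ?G t) \<le> real (card {t \<in> ?T. ?q t = (i, j, k, l)}) * (?f i j k l * inverse (?e i j k l))"
      by (rule sum_bounded_above, rule b)
    also have "\<dots> \<le> real (card (corners (S i) (S j) (S k) (S l))) * (?f i j k l * inverse (?e i j k l))"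
      using card_mono[OF finite_corners[OF S(1) S(1) S(1) order.refl] sub] ff by (intro mult_right_mono) auto
    also have "\<dots> \<le> rect_const * (?e i j k l * (top_kernel m i j k l + top_kernel m j k l i + top_kernel m k l i j + top_kernel m l i j k))
        * (?f i j k l * inverse (?e i j k l))"
      by (rule mult_right_mono[OF card_corners_le_top_kernel[OF S m] ff])
    also have "\<dots> = rect_const * (?e i j k l * inverse (?e i j k l))
        * (?f i j k l * (top_kernel m i j k l + top_kernel m j k l i + top_kernel m k l i j + top_kernel m l i j k))"
      by (simp only: mult_ac)
    also have "?e i j k l * inverse (?e i j k l) = 1" by simp
    finally show ?thesis by (simp add: distrib_left mult_ac)
  qed
  have "corner_energy P g = (\<Sum>y\<in>?I. \<Sum>t\<in>{t \<in> ?T. ?q t = y}. ?G t)"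
    unfolding corner_energy_def
  proof (rule sum.group[symmetric, OF finT])
    show "?q ` ?T \<subseteq> ?I" by (rule image_subsetI) (simp add: corners_def lev)
  qed simp
  also have "\<dots> = (\<Sum>i<m. \<Sum>j<m. \<Sum>k<m. \<Sum>l<m. \<Sum>t\<in>{t \<in> ?T. ?q t = (i, j, k, l)}. ?G t)"
    by (simp only: sum.cartesian_product')
  also have "\<dots> \<le> (\<Sum>i<m. \<Sum>j<m. \<Sum>k<m. \<Sum>l<m. rect_const * (?t i j k l + ?t j k l i + ?t k l i j + ?t l i j k))"
    by (intro sum_mono fibre) auto
  also have "\<dots> = rect_const * ((\<Sum>i<m. \<Sum>j<m. \<Sum>k<m. \<Sum>l<m. ?t i j k l) + (\<Sum>i<m. \<Sum>j<m. \<Sum>k<m. \<Sum>l<m. ?t j k l i)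
      + (\<Sum>i<m. \<Sum>j<m. \<Sum>k<m. \<Sum>l<m. ?t k l i j) + (\<Sum>i<m. \<Sum>j<m. \<Sum>k<m. \<Sum>l<m. ?t l i j k))"
    by (simp only: sum_distrib_left[symmetric] sum.distrib)
  also have "\<dots> = rect_const * (4 * (\<Sum>i<m. \<Sum>j<m. \<Sum>k<m. \<Sum>l<m. ?t i j k l))"
  proof -
    have "(\<Sum>i<m. \<Sum>j<m. \<Sum>k<m. \<Sum>l<m. ?t k l i j) = (\<Sum>i<m. \<Sum>j<m. \<Sum>k<m. \<Sum>l<m. ?t j k l i)"
      by (rule sum4_rotate[of "\<lambda>i j k l. ?t j k l i"])
    moreover have "(\<Sum>i<m. \<Sum>j<m. \<Sum>k<m. \<Sum>l<m. ?t l i j k) = (\<Sum>i<m. \<Sum>j<m. \<Sum>k<m. \<Sum>l<m. ?t k l i j)"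
      by (rule sum4_rotate[of "\<lambda>i j k l. ?t k l i j"])
    ultimately show ?thesis using sum4_rotate[of ?t m] by simp
  qed
  also have "\<dots> \<le> rect_const * (4 * ((5 * kappa + kappa\<^sup>2) * m * (\<Sum>j<m. (f j)\<^sup>2)\<^sup>2))"
    using rect_const_pos by (intro mult_left_mono sum_top_kernel f) auto
  finally show ?thesis by (simp only: mult_ac)
qed

text \<open>Cauchy condensation: for \<open>j \<ge> 1\<close> the value at \<open>2 ^ j - 1\<close>
  is at most each value on the dyadic block of indices ending there, and that block has
  \<open>2 ^ (j - 1)\<close> elements.\<close>

lemma sum_dyadic_le:
  fixes u :: "nat \<Rightarrow> real"
  assumes "antimono u" "\<And>i. u i \<ge> 0"
  shows "(\<Sum>j<m. 2 ^ j * u (2 ^ j - 1)) \<le> 2 * (\<Sum>i<2 ^ m. u i)"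
proof -
  have "(\<Sum>j<Suc m. 2 ^ j * u (2 ^ j - 1)) \<le> 2 * (\<Sum>i<2 ^ m. u i)" for m
  proof (induction m)
    case 0
    show ?case using assms(2)[of 0] by simp
  next
    case (Suc m)
    have "(\<Sum>i<2 ^ Suc m. u i) = (\<Sum>i<2 ^ m. u i) + (\<Sum>i=2 ^ m..<2 ^ Suc m. u i)"
      using sum.atLeastLessThan_concat[of 0 "2 ^ m" "2 ^ Suc m" u] by (simp add: atLeast0LessThan)
    moreover have "(\<Sum>i=2 ^ m..<2 ^ Suc m. u i) \<ge> real (card {2 ^ m..<(2::nat) ^ Suc m}) * u (2 ^ Suc m - 1)"
      by (rule sum_bounded_below) (rule antimonoD[OF assms(1)], auto)
    then have "(\<Sum>i=2 ^ m..<2 ^ Suc m. u i) \<ge> 2 ^ m * u (2 ^ Suc m - 1)" by simp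
    ultimately show ?case using Suc.IH by (simp add: sum.lessThan_Suc[of _ "Suc m"])
  qed
  from this[of "m - 1"] show ?thesis
  proof (cases m)
    case (Suc n)
    have "(\<Sum>i<2 ^ n. u i) \<le> (\<Sum>i<2 ^ m. u i)" using assms(2) by (intro sum_mono2) (auto simp: Suc)
    then show ?thesis using \<open>_ \<le> 2 * (\<Sum>i<2 ^ (m - 1). u i)\<close> Suc by simp
  qed (simp add: assms)
qed

text \<open>Level \<open>j\<close> contains the points whose rank \<open>i\<close>, counted from \<open>0\<close> in order of decreasing \<open>g\<close>, satisfies
  \<open>2 ^ j \<le> i + 1 < 2 ^ Suc j\<close>.\<close>

lemma level_decomposition:
  fixes g :: "'a \<Rightarrow> real"
  assumes P: "finite P" "card P < 2 ^ m" and g: "\<And>p. g p \<ge> 0"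
  obtains lev :: "'a \<Rightarrow> nat" and f where
    "\<And>p. p \<in> P \<Longrightarrow> lev p < m" "\<And>j. real (card {p \<in> P. lev p = j}) \<le> 2 ^ j"
    "\<And>p. p \<in> P \<Longrightarrow> g p \<le> f (lev p) * 2 powr (- real (lev p) / 2)" "\<And>j. f j \<ge> 0"
    "(\<Sum>j<m. (f j)\<^sup>2) \<le> 2 * (\<Sum>p\<in>P. (g p)\<^sup>2)"
proof -
  obtain ys where ys: "set ys = P" "distinct ys" using finite_distinct_list[OF P(1)] by blast
  define xs where "xs = sort_key (\<lambda>p. - g p) ys"
  have xs: "set xs = P" "distinct xs" "length xs = card P"
    using ys by (auto simp: xs_def distinct_card)
  have srt: "g (xs ! j) \<le> g (xs ! i)" if "i \<le> j" "j < length xs" for i j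
  proof -
    have "sorted (map (\<lambda>p. - g p) xs)" by (simp add: xs_def)
    from sorted_nth_mono[OF this that(1)] that show ?thesis by simp
  qed
  define u where "u i = (if i < length xs then g (xs ! i) else 0)" for i
  have anti: "antimono u" by (rule antimonoI) (auto simp: u_def g srt)
  have u0: "u i \<ge> 0" for i by (simp add: u_def g)
  define idx where "idx = the_inv_into {..<length xs} (\<lambda>i. xs ! i)"
  have bij: "bij_betw (\<lambda>i. xs ! i) {..<length xs} P" using bij_betw_nth[OF xs(2) refl xs(1)[symmetric]] by simp
  have idx: "idx p < length xs" "xs ! idx p = p" if "p \<in> P" for p
    using bij_betwE[OF bij_betw_the_inv_into[OF bij]] f_the_inv_into_f_bij_betw[OF bij] that by (auto simp: idx_def)
  define lev where "lev p = (LEAST j. idx p + 1 < 2 ^ Suc j)" for p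
  have ex: "idx p + 1 < 2 ^ Suc (idx p)" for p using less_exp[of "Suc (idx p)"] by simp
  have up: "idx p + 1 < 2 ^ Suc (lev p)" for p unfolding lev_def by (rule LeastI[of _ "idx p"]) (rule ex)
  have low: "2 ^ lev p \<le> idx p + 1" for p
  proof (cases "lev p")
    case (Suc n)
    then have "n < (LEAST j. idx p + 1 < 2 ^ Suc j)" by (simp add: lev_def)
    from not_less_Least[OF this] show ?thesis by (simp add: Suc)
  qed simp
  \<comment> \<open>\<open>u (2 ^ j - 1)\<close> dominates \<open>g\<close> on level
    \<open>j\<close>; the other factor is the square root of the largest possible size of the
    level.\<close>
  define f where "f j = 2 powr (real j / 2) * u (2 ^ j - 1)" for j
  show thesis
  proof (rule that[of lev f])
    fix p assume p: "p \<in> P"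
    show "lev p < m"
    proof (rule ccontr)
      assume "\<not> lev p < m"
      then have "(2::nat) ^ m \<le> 2 ^ lev p" by simp
      with low[of p] idx(1)[OF p] P(2) xs(3) show False by simp
    qed
    have "g p = u (idx p)" using idx[OF p] by (simp add: u_def)
    also have "\<dots> \<le> u (2 ^ lev p - 1)" using low[of p] by (intro antimonoD[OF anti]) simp
    also have "\<dots> = f (lev p) * 2 powr (- real (lev p) / 2)" by (simp add: f_def powr_minus divide_simps)
    finally show "g p \<le> f (lev p) * 2 powr (- real (lev p) / 2)" .
  next
    fix j
    have "card {p \<in> P. lev p = j} \<le> card {2 ^ j - 1..<2 ^ Suc j - (1::nat)}"
    proof (rule card_inj_on_le[of idx])
      show "inj_on idx {p \<in> P. lev p = j}" by (rule inj_onI) (metis (mono_tags, lifting) idx(2) mem_Collect_eq)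
      show "idx ` {p \<in> P. lev p = j} \<subseteq> {2 ^ j - 1..<2 ^ Suc j - 1}"
      proof (rule image_subsetI)
        fix p assume "p \<in> {p \<in> P. lev p = j}"
        then have "lev p = j" by simp
        with up[of p] low[of p] show "idx p \<in> {2 ^ j - 1..<2 ^ Suc j - 1}"
          by (simp only: atLeastLessThan_iff) linarith
      qed
    qed simp
    then have "card {p \<in> P. lev p = j} \<le> 2 ^ j" by simp
    then show "real (card {p \<in> P. lev p = j}) \<le> 2 ^ j"
      by (metis of_nat_le_iff of_nat_numeral of_nat_power)
    show "f j \<ge> 0" by (simp add: f_def u0)
  next
    have sq: "(f j)\<^sup>2 = 2 ^ j * (u (2 ^ j - 1))\<^sup>2" for j
    proof -
      have "(2 powr (real j / 2))\<^sup>2 = 2 powr (real j)" by (simp add: power2_eq_square powr_add[symmetric])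
      then show ?thesis by (simp add: f_def power_mult_distrib powr_realpow)
    qed
    have "(\<Sum>j<m. (f j)\<^sup>2) \<le> 2 * (\<Sum>i<2 ^ m. (u i)\<^sup>2)"
      unfolding sq by (rule sum_dyadic_le) (auto intro!: antimonoI power_mono antimonoD[OF anti] u0)
    also have "(\<Sum>i<2 ^ m. (u i)\<^sup>2) = (\<Sum>i<length xs. (u i)\<^sup>2)"
      using P(2) xs(3) by (intro sum.mono_neutral_right) (auto simp: u_def)
    also have "\<dots> = (\<Sum>i<length xs. (g (xs ! i))\<^sup>2)" by (simp add: u_def)
    also have "\<dots> = (\<Sum>p\<in>P. (g p)\<^sup>2)" by (rule sum.reindex_bij_betw[OF bij])
    finally show "(\<Sum>j<m. (f j)\<^sup>2) \<le> 2 * (\<Sum>p\<in>P. (g p)\<^sup>2)" by simp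
  qed
qed

text \<open>The factor 16 is the product of 4, for the corner that has the top level, and
  \<open>2\<^sup>2\<close>, from the bound on \<open>f\<close> in
  \<open>level_decomposition\<close>.\<close>

definition energy_const :: real where "energy_const = 16 * rect_const * (5 * kappa + kappa\<^sup>2)"

lemma energy_const_pos: "energy_const > 0"
  using rect_const_pos kappa_pos by (simp add: energy_const_def add_pos_pos)

theorem corner_energy_le:
  assumes P: "finite P" "card P < 2 ^ m" and g: "\<And>p. g p \<ge> 0"
  shows "corner_energy P g \<le> energy_const * m * (\<Sum>p\<in>P. (g p)\<^sup>2)\<^sup>2"
proof -
  obtain lev f where l: "\<And>p. p \<in> P \<Longrightarrow> lev p < m" "\<And>j. real (card {p \<in> P. lev p = j}) \<le> 2 ^ j"
    "\<And>p. p \<in> P \<Longrightarrow> g p \<le> f (lev p) * 2 powr (- real (lev p) / 2)" "\<And>j. f j \<ge> 0"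
    "(\<Sum>j<m. (f j)\<^sup>2) \<le> 2 * (\<Sum>p\<in>P. (g p)\<^sup>2)"
    by (rule level_decomposition[OF P, of g, OF g]) (rule that)
  have "corner_energy P g \<le> 4 * rect_const * (5 * kappa + kappa\<^sup>2) * m * (\<Sum>j<m. (f j)\<^sup>2)\<^sup>2"
    by (rule corner_energy_levels[OF P(1) l(1,2) g l(3,4)])
  also have "\<dots> \<le> 4 * rect_const * (5 * kappa + kappa\<^sup>2) * m * (2 * (\<Sum>p\<in>P. (g p)\<^sup>2))\<^sup>2"
    using rect_const_pos kappa_pos by (intro mult_left_mono power_mono l(5)) (auto intro: sum_nonneg)
  finally show ?thesis by (simp add: energy_const_def power_mult_distrib)
qed

section \<open>Fourier series on the torus\<close>

abbreviation torus_box :: "(real \<times> real) set" where "torus_box \<equiv> {0..<2 * pi} \<times> {0..<2 * pi}"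

lemma emeasure_rectangle:
  assumes "a \<ge> 0" "b \<ge> 0"
  shows "emeasure lborel ({x..<x + a} \<times> {y..<y + b} :: (real \<times> real) set) = ennreal (a * b)"
proof -
  have "emeasure (lborel \<Otimes>\<^sub>M lborel) ({x..<x + a} \<times> {y..<y + b}) = emeasure lborel {x..<x + a} * emeasure lborel {y..<y + b}"
    by (rule lborel.emeasure_pair_measure_Times) auto
  also have "emeasure lborel {x..<x + a} * emeasure lborel {y..<y + b} = ennreal (a * b)"
    using assms by (simp add: ennreal_mult)
  finally show ?thesis by (simp only: lborel_prod)
qed

lemma box_sets [measurable, simp]: "torus_box \<in> sets borel" "torus_box \<in> sets (lborel :: (real \<times> real) measure)"
proof -
  have "torus_box \<in> sets (borel \<Otimes>\<^sub>M borel)" by simp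
  then show "torus_box \<in> sets borel" unfolding borel_prod .
  then show "torus_box \<in> sets (lborel :: (real \<times> real) measure)" by simp
qed

lemma emeasure_box: "emeasure lborel torus_box = ennreal (4 * pi\<^sup>2)"
  using emeasure_rectangle[of "2 * pi" "2 * pi" 0 0] by (simp add: power2_eq_square)

lemma finite_measure_torus: "finite_measure torus"
  unfolding torus_def by (rule finite_measureI) (simp add: emeasure_uniform_measure emeasure_box ennreal_divide_eq_top_iff)

lemma sets_torus [measurable_cong, simp]: "sets torus = sets borel"
  by (simp add: torus_def)

lemma emeasure_torus:
  assumes "A \<in> sets borel" "A \<subseteq> torus_box"
  shows "emeasure torus A = emeasure lborel A / ennreal (4 * pi\<^sup>2)"
  using assms by (simp add: torus_def emeasure_uniform_measure emeasure_box Int_absorb1)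

lemma torus_density: "torus = density lborel (\<lambda>x. ennreal (indicator torus_box x / (4 * pi\<^sup>2)))"
proof -
  have "indicator torus_box x / ennreal (4 * pi\<^sup>2) = ennreal (indicator torus_box x / (4 * pi\<^sup>2))" for x :: "real \<times> real"
    using divide_ennreal[of 1 "4 * pi\<^sup>2"] by (cases "x \<in> torus_box") simp_all
  then show ?thesis unfolding torus_def uniform_measure_def emeasure_box by simp
qed

definition character :: "int \<times> int \<Rightarrow> real \<times> real \<Rightarrow> complex" where "character n x = cis (freq n \<bullet> x)"

lemma character_measurable [measurable]: "character n \<in> borel_measurable borel"
  unfolding character_def by (intro borel_measurable_continuous_onI continuous_intros)

lemma norm_character [simp]: "cmod (character n x) = 1"
  by (simp add: character_def)

lemma character_mult: "character n x * character m x = character (n + m) x"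
  by (simp add: character_def freq_def cis_mult inner_prod_def algebra_simps)

lemma cnj_character: "cnj (character n x) = character (- n) x"
  by (simp add: character_def freq_def cis_cnj inner_prod_def algebra_simps)

lemma character_diff: "character (n - m) x = character n x * cnj (character m x)"
  by (simp add: cnj_character character_mult)

lemma integrable_character: "integrable torus (character n)"
proof -
  interpret finite_measure torus by (rule finite_measure_torus)
  show ?thesis by (rule integrable_const_bound[where B = 1]) auto
qed

lemma integral_cis:
  "(\<integral>x. indicator {0..<2 * pi} x *\<^sub>R cis (of_int k * x) \<partial>lborel) = (if k = 0 then of_real (2 * pi) else 0)"
proof -
  have "(\<integral>x. indicator {0..<2 * pi} x *\<^sub>R cis (of_int k * x) \<partial>lborel) = (\<integral>x. indicator {0..2 * pi} x *\<^sub>R cis (of_int k * x) \<partial>lborel)"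
  proof (rule integral_cong_AE)
    show "AE x in lborel. indicator {0..<2 * pi} x *\<^sub>R cis (of_int k * x) = indicator {0..2 * pi} x *\<^sub>R cis (of_int k * x)"
      using AE_lborel_singleton[of "2 * pi"] by eventually_elim (auto simp: indicator_def)
    have [measurable]: "(\<lambda>x. cis (of_int k * x)) \<in> borel_measurable borel"
      by (intro borel_measurable_continuous_onI continuous_intros)
    show "(\<lambda>x. indicator {0..<2 * pi} x *\<^sub>R cis (of_int k * x)) \<in> borel_measurable lborel" by measurable
    show "(\<lambda>x. indicator {0..2 * pi} x *\<^sub>R cis (of_int k * x)) \<in> borel_measurable lborel" by measurable
  qed
  also have "\<dots> = (if k = 0 then of_real (2 * pi) else 0)"
  proof (cases "k = 0")
    case True
    then show ?thesis by (simp add: scaleR_conv_of_real)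
  next
    case False
    let ?F = "\<lambda>x. cis (of_int k * x) / (\<i> * of_int k)"
    have "(\<integral>x. indicator {0..2 * pi} x *\<^sub>R cis (of_int k * x) \<partial>lborel) = ?F (2 * pi) - ?F 0"
    proof (rule integral_FTC_Icc)
      fix x :: real
      let ?G = "\<lambda>z. exp (\<i> * of_int k * z) / (\<i> * of_int k)"
      have "(?G has_field_derivative exp (\<i> * of_int k * of_real x)) (at (of_real x))"
        by (rule derivative_eq_intros refl | simp add: False)+
      from has_vector_derivative_real_field[OF this, of "{0..2 * pi}"]
      show "(?F has_vector_derivative cis (of_int k * x)) (at x within {0..2 * pi})"
        by (simp add: cis_conv_exp mult_ac)
    qed (auto intro!: continuous_intros)
    moreover have "cis (of_int k * (2 * pi)) = 1"
    proof -
      have "of_int k * (2 * pi) = 2 * pi * of_int k" by (rule mult.commute)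
      then show ?thesis using cis_multiple_2pi[OF Ints_of_int, of k] by (simp only:)
    qed
    ultimately show ?thesis using False by simp
  qed
  finally show ?thesis .
qed

lemma integral_character: "(\<integral>x. character n x \<partial>torus) = (if n = 0 then 1 else 0)"
proof -
  let ?h = "\<lambda>k x. indicator {0..<2 * pi} x *\<^sub>R cis (of_int k * x)"
  let ?g = "\<lambda>x. (indicator torus_box x / (4 * pi\<^sup>2)) *\<^sub>R character n x"
  have [measurable]: "(\<lambda>x. indicator torus_box x / (4 * pi\<^sup>2)) \<in> borel_measurable borel" by simp
  have eq: "?g (x, y) = (1 / (4 * pi\<^sup>2)) *\<^sub>R (?h (fst n) x * ?h (snd n) y)" for x y
    by (auto simp: indicator_def character_def freq_def inner_prod_def cis_mult)
  have int: "integrable lborel ?g"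
    using integrable_character[of n] unfolding torus_density by (subst (asm) integrable_density) auto
  have "(\<integral>x. character n x \<partial>torus) = (\<integral>x. ?g x \<partial>lborel)"
    unfolding torus_density by (rule integral_density) auto
  also have "\<dots> = (\<integral>x. (\<integral>y. ?g (x, y) \<partial>lborel) \<partial>lborel)"
    using lborel_pair.integral_fst'[of ?g] int by (simp add: lborel_prod)
  also have "\<dots> = (1 / (4 * pi\<^sup>2)) *\<^sub>R ((\<integral>x. ?h (fst n) x \<partial>lborel) * (\<integral>y. ?h (snd n) y \<partial>lborel))"
    by (simp only: eq integral_scaleR_right integral_mult_right_zero integral_mult_left_zero)
  also have "\<dots> = (if n = 0 then 1 else 0)"
    unfolding integral_cis by (simp add: prod_eq_iff scaleR_conv_of_real power2_eq_square)
  finally show ?thesis .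
qed

lemma parseval:
  assumes "finite S"
  shows "(\<integral>\<^sup>+x. ennreal ((cmod (\<Sum>n\<in>S. c n * character n x))\<^sup>2) \<partial>torus) = ennreal (\<Sum>n\<in>S. (cmod (c n))\<^sup>2)"
proof -
  interpret finite_measure torus by (rule finite_measure_torus)
  let ?u = "\<lambda>x. \<Sum>n\<in>S. c n * character n x"
  let ?v = "\<lambda>x. \<Sum>n\<in>S. \<Sum>m\<in>S. (c n * cnj (c m)) * character (n - m) x"
  have cpl: "complex_of_real ((cmod (?u x))\<^sup>2) = ?v x" for x
  proof -
    have "complex_of_real ((cmod (?u x))\<^sup>2) = (\<Sum>n\<in>S. c n * character n x) * (\<Sum>m\<in>S. cnj (c m) * cnj (character m x))"
      unfolding complex_norm_square by (simp only: cnj_sum complex_cnj_mult)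
    also have "\<dots> = ?v x"
      unfolding sum_product by (intro sum.cong refl) (simp only: character_diff mult_ac)
    finally show ?thesis .
  qed
  have int: "integrable torus ?v" by (intro Bochner_Integration.integrable_sum integrable_mult_right integrable_character)
  have re: "(cmod (?u x))\<^sup>2 = Re (?v x)" for x unfolding cpl[symmetric] by simp
  have "(\<integral>x. ?v x \<partial>torus) = (\<Sum>n\<in>S. \<Sum>m\<in>S. (c n * cnj (c m)) * (if n - m = 0 then 1 else 0))"
    by (simp add: Bochner_Integration.integral_sum integrable_character integral_character)
  also have "\<dots> = (\<Sum>n\<in>S. c n * cnj (c n))"
  proof (rule sum.cong[OF refl])
    fix n assume "n \<in> S"
    have "(\<Sum>m\<in>S. (c n * cnj (c m)) * (if n - m = 0 then 1 else 0)) = (\<Sum>m\<in>S. if n = m then c n * cnj (c m) else 0)"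
      by (intro sum.cong) auto
    then show "(\<Sum>m\<in>S. (c n * cnj (c m)) * (if n - m = 0 then 1 else 0)) = c n * cnj (c n)"
      using \<open>n \<in> S\<close> assms by simp
  qed
  also have "\<dots> = of_real (\<Sum>n\<in>S. (cmod (c n))\<^sup>2)" by (simp only: of_real_sum complex_norm_square)
  finally have v: "(\<integral>x. ?v x \<partial>torus) = of_real (\<Sum>n\<in>S. (cmod (c n))\<^sup>2)" .
  have "(\<integral>\<^sup>+x. ennreal ((cmod (?u x))\<^sup>2) \<partial>torus) = ennreal (\<integral>x. Re (?v x) \<partial>torus)"
    unfolding re
  proof (rule nn_integral_eq_integral[OF integrable_Re[OF int]])
    show "AE x in torus. 0 \<le> Re (?v x)" unfolding re[symmetric] by simp
  qed
  also have "(\<integral>x. Re (?v x) \<partial>torus) = Re (\<integral>x. ?v x \<partial>torus)"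
    by (rule integral_Re[OF int])
  finally show ?thesis unfolding v by simp
qed

lemma fourier_coeff_sum:
  assumes "finite S"
  shows "fourier_coeff (\<lambda>x. \<Sum>n\<in>S. c n * character n x) k = (if k \<in> S then c k else 0)"
proof -
  have "fourier_coeff (\<lambda>x. \<Sum>n\<in>S. c n * character n x) k = (\<integral>x. (\<Sum>n\<in>S. c n * character (n - k) x) \<partial>torus)"
  proof -
    have "cis (- (freq k \<bullet> x)) = character (- k) x" for x by (simp add: character_def freq_def inner_prod_def)
    then show ?thesis
      by (simp add: fourier_coeff_def sum_distrib_right mult.assoc character_mult)
  qed
  also have "\<dots> = (\<Sum>n\<in>S. c n * (if n - k = 0 then 1 else 0))"
    by (simp add: Bochner_Integration.integral_sum integrable_character integral_character)
  also have "\<dots> = (if k \<in> S then c k else 0)"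
  proof -
    have "(\<Sum>n\<in>S. c n * (if n - k = 0 then 1 else 0)) = (\<Sum>n\<in>S. if n = k then c n else 0)"
      by (intro sum.cong) auto
    then show ?thesis using assms by simp
  qed
  finally show ?thesis .
qed

lemma trig_polynomial_expansion:
  assumes "trig_polynomial f"
  shows "finite (fourier_support f)" "f = (\<lambda>x. \<Sum>n\<in>fourier_support f. fourier_coeff f n * character n x)"
proof -
  obtain S c where S: "finite S" "f = (\<lambda>x. \<Sum>n\<in>S. c n * character n x)"
    using assms unfolding trig_polynomial_def character_def by blast
  have co: "fourier_coeff f k = (if k \<in> S then c k else 0)" for k
    unfolding S(2) by (rule fourier_coeff_sum[OF S(1)])
  have sub: "fourier_support f \<subseteq> S" by (auto simp: fourier_support_def co split: if_splits)
  then show "finite (fourier_support f)" using S(1) finite_subset by blast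
  have "(\<Sum>n\<in>S. c n * character n x) = (\<Sum>n\<in>fourier_support f. fourier_coeff f n * character n x)" for x
    using sub by (intro sum.mono_neutral_cong_right S(1)) (auto simp: co fourier_support_def)
  moreover have "f x = (\<Sum>n\<in>S. c n * character n x)" for x by (subst S(2)) (rule refl)
  ultimately show "f = (\<lambda>x. \<Sum>n\<in>fourier_support f. fourier_coeff f n * character n x)" by (intro ext) (rule trans)
qed

section \<open>The evolution of a trigonometric polynomial\<close>

definition nsq :: "int \<times> int \<Rightarrow> int" where "nsq n = (fst n)\<^sup>2 + (snd n)\<^sup>2"

lemma norm_freq: "(norm (freq n))\<^sup>2 = of_int (nsq n)"
  by (simp add: freq_def nsq_def norm_Pair)

lemma schroedinger_eq:
  assumes "finite S" "\<And>n. n \<notin> S \<Longrightarrow> fourier_coeff f n = 0"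
  shows "schroedinger t f x = (\<Sum>n\<in>S. fourier_coeff f n * character n x * cis (- (t * of_int (nsq n))))"
proof -
  have "schroedinger t f x = (\<Sum>\<^sub>\<infinity>n\<in>S. fourier_coeff f n * cis (freq n \<bullet> x - t * (norm (freq n))\<^sup>2))"
    unfolding schroedinger_def using assms(2) by (intro infsum_cong_neutral) auto
  also have "\<dots> = (\<Sum>n\<in>S. fourier_coeff f n * cis (freq n \<bullet> x - t * (norm (freq n))\<^sup>2))"
    by (rule infsum_finite[OF assms(1)])
  finally show ?thesis by (simp add: character_def norm_freq cis_mult mult.assoc)
qed

section \<open>The maximal estimate\<close>

lemma ennreal_sqrt_ennreal: "r \<ge> 0 \<Longrightarrow> ennreal_sqrt (ennreal r) = ennreal (sqrt r)"
  by (simp add: ennreal_sqrt_def)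

lemma ennreal_sqrt_le:
  assumes "a \<le> ennreal r" "r \<ge> 0"
  shows "ennreal_sqrt a \<le> ennreal (sqrt r)"
proof -
  have "a \<noteq> \<infinity>" using assms(1) by (auto simp: top_unique)
  moreover have "enn2real a \<le> r" using enn2real_mono[OF assms(1)] assms(2) by simp
  ultimately show ?thesis by (auto simp: ennreal_sqrt_def intro!: ennreal_leI)
qed

lemma L2_norm_modulus:
  assumes "finite S" "f = (\<lambda>x. \<Sum>n\<in>S. c n * character n x)"
  shows "L2_norm (modulus f) = ennreal (sqrt (\<Sum>n\<in>S. (cmod (c n))\<^sup>2))"
proof -
  have "(modulus f x)\<^sup>2 = ennreal ((cmod (\<Sum>n\<in>S. c n * character n x))\<^sup>2)" for x
    by (simp add: modulus_def assms(2) ennreal_power)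
  then show ?thesis
    by (simp add: L2_norm_def parseval[OF assms(1)] ennreal_sqrt_ennreal sum_nonneg)
qed

lemma sum_fibre_squares:
  fixes G :: "'a \<Rightarrow> real"
  assumes "finite A" "finite W" "h ` A \<subseteq> W"
  shows "(\<Sum>w\<in>W. (\<Sum>p\<in>{p \<in> A. h p = w}. G p)\<^sup>2) = (\<Sum>(p, q)\<in>Sigma A (\<lambda>p. {q \<in> A. h q = h p}). G p * G q)"
proof -
  let ?T = "\<lambda>w. \<Sum>p\<in>{p \<in> A. h p = w}. G p"
  have "(\<Sum>w\<in>W. (?T w)\<^sup>2) = (\<Sum>w\<in>W. \<Sum>p\<in>{p \<in> A. h p = w}. G p * ?T (h p))"
    by (intro sum.cong refl) (simp add: power2_eq_square sum_distrib_right)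
  also have "\<dots> = (\<Sum>p\<in>A. G p * ?T (h p))" by (rule sum.group[OF assms])
  also have "\<dots> = (\<Sum>p\<in>A. \<Sum>q\<in>{q \<in> A. h q = h p}. G p * G q)" by (simp add: sum_distrib_left)
  also have "\<dots> = (\<Sum>(p, q)\<in>Sigma A (\<lambda>p. {q \<in> A. h q = h p}). G p * G q)"
    using assms(1) by (intro sum.Sigma) auto
  finally show ?thesis .
qed

text \<open>The time frequency, up to sign, and the spatial frequency of the product of two modes of
  the solution.\<close>

definition pair_key :: "(int \<times> int) \<times> (int \<times> int) \<Rightarrow> int \<times> (int \<times> int)" where
  "pair_key p = (nsq (fst p) + nsq (snd p), fst p + snd p)"

text \<open>Equal momenta make \<open>a\<close>, \<open>b\<close>, \<open>c\<close>,
  \<open>d\<close> a parallelogram; eliminating \<open>d\<close> from the equation of energies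
  leaves \<open>dot (a - b) (c - b) = 0\<close>, so it is a rectangle, degenerate if
  \<open>b\<close> is \<open>a\<close> or \<open>c\<close>.\<close>

lemma pair_key_eq_cases:
  assumes "pair_key (a, c) = pair_key (b, d)"
  shows "b = a \<and> d = c \<or> b = c \<and> d = a \<or> right_angle a b c \<and> d = a + c - b"
proof -
  obtain a1 a2 b1 b2 c1 c2 d1 d2 where [simp]: "a = (a1, a2)" "b = (b1, b2)" "c = (c1, c2)" "d = (d1, d2)"
    by (metis surj_pair)
  have d: "d1 = a1 + c1 - b1" "d2 = a2 + c2 - b2" using assms by (auto simp: pair_key_def)
  have "a1\<^sup>2 + a2\<^sup>2 + (c1\<^sup>2 + c2\<^sup>2) = b1\<^sup>2 + b2\<^sup>2 + ((a1 + c1 - b1)\<^sup>2 + (a2 + c2 - b2)\<^sup>2)"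
    using assms unfolding pair_key_def nsq_def by (simp add: d)
  then have "2 * ((a1 - b1) * (c1 - b1) + (a2 - b2) * (c2 - b2)) = 0"
    by (simp add: power2_eq_square algebra_simps)
  then have "dot (a - b) (c - b) = 0" by (simp add: dot_def)
  then show ?thesis unfolding right_angle_def by (auto simp: d)
qed

text \<open>Each of the two kinds of degenerate rectangle contributes the square of the sum of the
  squares, whence the factor 2.\<close>

lemma pair_energy_le:
  assumes S: "finite S" and g: "\<And>n. g n \<ge> (0::real)"
  defines "Q \<equiv> Sigma (S \<times> S) (\<lambda>p. {q \<in> S \<times> S. pair_key q = pair_key p})"
  shows "(\<Sum>(p, q)\<in>Q. (g (fst p) * g (snd p)) * (g (fst q) * g (snd q))) \<le> 2 * (\<Sum>n\<in>S. (g n)\<^sup>2)\<^sup>2 + corner_energy S g"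
proof -
  let ?G = "\<lambda>(p, q). (g (fst p) * g (snd p)) * (g (fst q) * g (snd q))"
  define Q1 where "Q1 = (\<lambda>p. (p, p)) ` (S \<times> S)"
  define Q2 where "Q2 = (\<lambda>p. (p, (snd p, fst p))) ` (S \<times> S)"
  define Q3 where "Q3 = (\<lambda>t. ((fst t, snd (snd t)), (fst (snd t), fourth t))) ` corners S S S S"
  have fin: "finite Q1" "finite Q2" "finite Q3"
    unfolding Q1_def Q2_def Q3_def using S finite_corners[OF S S S order.refl] by auto
  have "Q \<subseteq> Q1 \<union> Q2 \<union> Q3"
  proof (rule subsetI)
    fix r assume r: "r \<in> Q"
    obtain a c b d where [simp]: "r = ((a, c), (b, d))" by (metis surj_pair)
    have mem: "a \<in> S" "b \<in> S" "c \<in> S" "d \<in> S" and key: "pair_key (a, c) = pair_key (b, d)"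
      using r by (auto simp: Q_def)
    from pair_key_eq_cases[OF key] show "r \<in> Q1 \<union> Q2 \<union> Q3"
    proof (elim disjE)
      assume "right_angle a b c \<and> d = a + c - b"
      then have "(a, b, c) \<in> corners S S S S" "r = (\<lambda>t. ((fst t, snd (snd t)), (fst (snd t), fourth t))) (a, b, c)"
        using mem by (simp_all add: corners_def fourth_def)
      then show ?thesis unfolding Q3_def by blast
    qed (use mem in \<open>auto simp: Q1_def Q2_def image_iff\<close>)
  qed
  moreover have nonneg: "?G r \<ge> 0" for r using g by (simp add: case_prod_unfold)
  ultimately have "sum ?G Q \<le> sum ?G (Q1 \<union> Q2 \<union> Q3)" using fin by (intro sum_mono2) auto
  also have "\<dots> \<le> sum ?G Q1 + sum ?G Q2 + sum ?G Q3"
    using sum_Un[OF fin(1,2), of ?G] sum_Un[of "Q1 \<union> Q2" Q3 ?G] fin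
      sum_nonneg[of "Q1 \<inter> Q2" ?G, OF nonneg] sum_nonneg[of "(Q1 \<union> Q2) \<inter> Q3" ?G, OF nonneg] by simp
  also have "sum ?G Q1 = (\<Sum>n\<in>S. (g n)\<^sup>2)\<^sup>2"
    unfolding Q1_def power2_eq_square[of "sum _ _"] sum_product sum.cartesian_product
    by (subst sum.reindex) (auto simp: inj_on_def case_prod_unfold power2_eq_square mult_ac)
  also have "sum ?G Q2 = (\<Sum>n\<in>S. (g n)\<^sup>2)\<^sup>2"
    unfolding Q2_def power2_eq_square[of "sum _ _"] sum_product sum.cartesian_product
    by (subst sum.reindex) (auto simp: inj_on_def case_prod_unfold power2_eq_square mult_ac)
  also have "sum ?G Q3 = corner_energy S g"
    unfolding Q3_def corner_energy_def
    by (subst sum.reindex) (auto simp: inj_on_def mult_ac)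
  finally show ?thesis by simp
qed

lemma emeasure_space_torus: "emeasure torus (space torus) = 1"
  unfolding torus_def by (simp add: emeasure_uniform_measure emeasure_box)

lemma norm_sum_le_card:
  fixes z :: "'a \<Rightarrow> complex"
  assumes "finite K"
  shows "(cmod (\<Sum>k\<in>K. z k))\<^sup>2 \<le> card K * (\<Sum>k\<in>K. (cmod (z k))\<^sup>2)"
proof -
  have "(cmod (\<Sum>k\<in>K. z k))\<^sup>2 \<le> (\<Sum>k\<in>K. cmod (z k))\<^sup>2"
    by (rule power_mono[OF norm_sum]) simp
  also have "\<dots> \<le> card K * (\<Sum>k\<in>K. (cmod (z k))\<^sup>2)"
    using sum_squared_le_sum_of_squares[of "\<lambda>k. cmod (z k)" K] by (simp add: mult.commute)
  finally show ?thesis .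
qed

section \<open>The square of the solution, grouped by time frequency\<close>

context
  fixes S :: "(int \<times> int) set" and c :: "int \<times> int \<Rightarrow> complex"
  assumes S: "finite S"
begin

definition key_energies :: "int set" where "key_energies = (\<lambda>p. fst (pair_key p)) ` (S \<times> S)"
definition key_momenta :: "(int \<times> int) set" where "key_momenta = (\<lambda>p. snd (pair_key p)) ` (S \<times> S)"
definition pair_coeff :: "int \<Rightarrow> int \<times> int \<Rightarrow> complex" where
  "pair_coeff k v = (\<Sum>p\<in>{p \<in> S \<times> S. pair_key p = (k, v)}. c (fst p) * c (snd p))"
definition square_function :: "real \<times> real \<Rightarrow> real" where
  "square_function x = (\<Sum>k\<in>key_energies. (cmod (\<Sum>v\<in>key_momenta. pair_coeff k v * character v x))\<^sup>2)"

lemma finite_keys: "finite key_energies" "finite key_momenta" "finite (key_energies \<times> key_momenta)" "pair_key ` (S \<times> S) \<subseteq> key_energies \<times> key_momenta"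
  using S by (auto simp: key_energies_def key_momenta_def image_iff) (metis fst_conv snd_conv surj_pair)+

lemma key_energiesE:
  assumes "k \<in> key_energies"
  obtains n m where "n \<in> S" "m \<in> S" "k = nsq n + nsq m"
  using assms by (auto simp: key_energies_def pair_key_def)

lemma solution_le_square_function:
  "(cmod (\<Sum>n\<in>S. c n * character n x * cis (- (t * of_int (nsq n))))) ^ 4 \<le> card key_energies * square_function x"
proof -
  let ?u = "\<Sum>n\<in>S. c n * character n x * cis (- (t * of_int (nsq n)))"
  let ?z = "\<lambda>k. cis (- (t * of_int k)) * (\<Sum>v\<in>key_momenta. pair_coeff k v * character v x)"
  let ?h = "\<lambda>p. c (fst p) * c (snd p) * (cis (- (t * of_int (fst (pair_key p)))) * character (snd (pair_key p)) x)"
  have "?u\<^sup>2 = (\<Sum>p\<in>S \<times> S. ?h p)"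
    unfolding power2_eq_square sum_product sum.cartesian_product
  proof (intro sum.cong refl)
    fix p :: "(int \<times> int) \<times> (int \<times> int)"
    obtain n m where p: "p = (n, m)" by (rule prod.exhaust)
    show "(case p of (n, m) \<Rightarrow> c n * character n x * cis (- (t * of_int (nsq n))) * (c m * character m x * cis (- (t * of_int (nsq m))))) = ?h p"
    proof -
      have e: "cis (- (t * of_int (nsq n + nsq m))) = cis (- (t * of_int (nsq n))) * cis (- (t * of_int (nsq m)))"
        by (simp add: cis_mult distrib_left)
      show ?thesis by (simp only: p e pair_key_def prod.case fst_conv snd_conv character_mult[symmetric] mult_ac)
    qed
  qed
  also have "\<dots> = (\<Sum>w\<in>key_energies \<times> key_momenta. \<Sum>p\<in>{p \<in> S \<times> S. pair_key p = w}. ?h p)"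
    by (rule sum.group[symmetric]) (use S finite_keys in auto)
  also have "\<dots> = (\<Sum>k\<in>key_energies. \<Sum>v\<in>key_momenta. cis (- (t * of_int k)) * (pair_coeff k v * character v x))"
    unfolding sum.cartesian_product' pair_coeff_def
    by (intro sum.cong refl) (simp add: sum_distrib_left sum_distrib_right mult_ac)
  also have "\<dots> = (\<Sum>k\<in>key_energies. ?z k)" by (simp only: sum_distrib_left)
  finally have sq: "?u\<^sup>2 = (\<Sum>k\<in>key_energies. ?z k)" .
  have "(cmod ?u) ^ 4 = (cmod (?u\<^sup>2))\<^sup>2" by (simp add: norm_power power_mult[symmetric])
  also have "\<dots> \<le> card key_energies * (\<Sum>k\<in>key_energies. (cmod (?z k))\<^sup>2)"
    unfolding sq by (rule norm_sum_le_card[OF finite_keys(1)])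
  finally show ?thesis by (simp add: square_function_def norm_mult)
qed

text \<open>Parseval in space for each time frequency; replacing the coefficients by their moduli
  leaves a sum over coincidences of \<open>pair_key\<close>.\<close>

lemma nn_integral_square_function:
  "(\<integral>\<^sup>+x. ennreal (square_function x) \<partial>torus) \<le> ennreal (2 * (\<Sum>n\<in>S. (cmod (c n))\<^sup>2)\<^sup>2 + corner_energy S (\<lambda>n. cmod (c n)))"
proof -
  let ?g = "\<lambda>n. cmod (c n)" and ?A = "\<lambda>w. {p \<in> S \<times> S. pair_key p = w}"
  let ?s = "\<lambda>k x. \<Sum>v\<in>key_momenta. pair_coeff k v * character v x"
  have "(\<integral>\<^sup>+x. ennreal (square_function x) \<partial>torus) = (\<integral>\<^sup>+x. (\<Sum>k\<in>key_energies. ennreal ((cmod (?s k x))\<^sup>2)) \<partial>torus)"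
    unfolding square_function_def by (simp add: sum_ennreal)
  also have "\<dots> = (\<Sum>k\<in>key_energies. \<integral>\<^sup>+x. ennreal ((cmod (?s k x))\<^sup>2) \<partial>torus)"
    by (intro nn_integral_sum) measurable
  also have "\<dots> = ennreal (\<Sum>k\<in>key_energies. \<Sum>v\<in>key_momenta. (cmod (pair_coeff k v))\<^sup>2)"
    by (simp only: parseval[OF finite_keys(2)]) (simp add: sum_ennreal sum_nonneg)
  also have "\<dots> \<le> ennreal (2 * (\<Sum>n\<in>S. (?g n)\<^sup>2)\<^sup>2 + corner_energy S ?g)"
  proof (rule ennreal_leI)
    have "(\<Sum>k\<in>key_energies. \<Sum>v\<in>key_momenta. (cmod (pair_coeff k v))\<^sup>2)
        \<le> (\<Sum>k\<in>key_energies. \<Sum>v\<in>key_momenta. (\<Sum>p\<in>?A (k, v). ?g (fst p) * ?g (snd p))\<^sup>2)"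
      unfolding pair_coeff_def
      by (intro sum_mono power_mono order.trans[OF norm_sum]) (auto simp: norm_mult)
    also have "\<dots> = (\<Sum>w\<in>key_energies \<times> key_momenta. (\<Sum>p\<in>?A w. ?g (fst p) * ?g (snd p))\<^sup>2)"
      by (simp only: sum.cartesian_product')
    also have "\<dots> = (\<Sum>(p, q)\<in>Sigma (S \<times> S) (\<lambda>p. {q \<in> S \<times> S. pair_key q = pair_key p}).
        (?g (fst p) * ?g (snd p)) * (?g (fst q) * ?g (snd q)))"
      by (rule sum_fibre_squares) (use S finite_keys in auto)
    also have "\<dots> \<le> 2 * (\<Sum>n\<in>S. (?g n)\<^sup>2)\<^sup>2 + corner_energy S ?g"
      by (rule pair_energy_le[OF S]) simp
    finally show "(\<Sum>k\<in>key_energies. \<Sum>v\<in>key_momenta. (cmod (pair_coeff k v))\<^sup>2) \<le> 2 * (\<Sum>n\<in>S. (?g n)\<^sup>2)\<^sup>2 + corner_energy S ?g" .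
  qed
  finally show ?thesis .
qed

text \<open>The pointwise bound for the square of the solution is a square root of
  \<open>square_function\<close>; the inequality between the arithmetic and geometric means makes it
  linear in that function, so that the bound on its integral applies.\<close>

lemma L2_norm_maximal_le:
  assumes f: "\<And>n. fourier_coeff f n = (if n \<in> S then c n else 0)"
    and R: "real (card key_energies) \<le> R"
    and B: "2 * (\<Sum>n\<in>S. (cmod (c n))\<^sup>2)\<^sup>2 + corner_energy S (\<lambda>n. cmod (c n)) \<le> B" and pos: "R * B > 0"
  shows "L2_norm (maximal_function f) \<le> ennreal (sqrt (sqrt (R * B)))"
proof -
  \<comment> \<open>This \<open>k\<close> balances the linearization: on the torus, of total mass 1,
    both summands of \<open>h\<close> integrate to at most \<open>k / 2\<close>.\<close>
  define k where "k = sqrt (R * B)"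
  have k: "k > 0" "k * k = R * B" using pos by (simp_all add: k_def)
  have R0: "R \<ge> 0" using R of_nat_0_le_iff order.trans by blast
  \<comment> \<open>the measurable majorant \<open>h\<close> makes measurability of the supremum unnecessary\<close>
  define h where "h x = k / 2 + R / (2 * k) * square_function x" for x
  have sf: "square_function x \<ge> 0" for x by (simp add: square_function_def sum_nonneg)
  have h0: "h x \<ge> 0" for x using k R0 sf by (simp add: h_def)
  have u: "(cmod (schroedinger t f x))\<^sup>2 \<le> h x" for t x
  proof -
    let ?u = "cmod (schroedinger t f x)"
    have "schroedinger t f x = (\<Sum>n\<in>S. c n * character n x * cis (- (t * of_int (nsq n))))"
      using schroedinger_eq[OF S, of f t x] f by simp
    then have "?u ^ 4 \<le> card key_energies * square_function x" using solution_le_square_function by simp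
    also have "\<dots> \<le> R * square_function x" using R sf by (intro mult_right_mono) auto
    finally have "(?u\<^sup>2)\<^sup>2 \<le> R * square_function x" by (simp add: power_mult[symmetric])
    moreover have "2 * ?u\<^sup>2 * k \<le> (?u\<^sup>2)\<^sup>2 + k\<^sup>2" by (rule sum_squares_bound)
    ultimately have "2 * ?u\<^sup>2 * k \<le> k\<^sup>2 + R * square_function x" by linarith
    also have "\<dots> = 2 * h x * k" using k(1) by (simp add: h_def field_simps power2_eq_square)
    finally show ?thesis using k(1) by simp
  qed
  have m: "(maximal_function f x)\<^sup>2 \<le> ennreal (h x)" for x
  proof -
    have "maximal_function f x \<le> ennreal (sqrt (h x))"
      unfolding maximal_function_def modulus_def
      by (intro SUP_least ennreal_leI real_le_rsqrt u)
    then have "(maximal_function f x)\<^sup>2 \<le> (ennreal (sqrt (h x)))\<^sup>2" by (intro power_mono) auto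
    then show ?thesis using h0 by (simp add: ennreal_power)
  qed
  have [measurable]: "square_function \<in> borel_measurable borel" unfolding square_function_def by measurable
  have "(\<integral>\<^sup>+x. (maximal_function f x)\<^sup>2 \<partial>torus) \<le> (\<integral>\<^sup>+x. ennreal (k / 2) + ennreal (R / (2 * k)) * ennreal (square_function x) \<partial>torus)"
  proof (rule nn_integral_mono)
    fix x
    have "ennreal (h x) = ennreal (k / 2) + ennreal (R / (2 * k)) * ennreal (square_function x)"
      using k R0 sf by (simp add: h_def ennreal_plus ennreal_mult[symmetric])
    with m[of x] show "(maximal_function f x)\<^sup>2 \<le> ennreal (k / 2) + ennreal (R / (2 * k)) * ennreal (square_function x)" by simp
  qed
  also have "\<dots> = ennreal (k / 2) + ennreal (R / (2 * k)) * (\<integral>\<^sup>+x. ennreal (square_function x) \<partial>torus)"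
    by (simp add: nn_integral_add nn_integral_cmult emeasure_space_torus)
  also have "\<dots> \<le> ennreal (k / 2) + ennreal (R / (2 * k)) * ennreal B"
    using order.trans[OF nn_integral_square_function ennreal_leI[OF B]] by (intro add_left_mono mult_left_mono) auto
  also have "\<dots> = ennreal k"
  proof -
    have "B \<ge> 0" using B by (rule order.trans[rotated])
      (auto simp: corner_energy_def intro!: add_nonneg_nonneg sum_nonneg)
    then have "ennreal (k / 2) + ennreal (R / (2 * k)) * ennreal B = ennreal (k / 2 + R / (2 * k) * B)"
      using k R0 by (simp add: ennreal_plus ennreal_mult[symmetric])
    also have "k / 2 + R / (2 * k) * B = k" using k by (simp add: field_simps)
    finally show ?thesis .
  qed
  finally show ?thesis unfolding L2_norm_def k_def[symmetric] using k by (intro ennreal_sqrt_le) auto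
qed

end

lemma maximal_function_zero:
  assumes "\<And>n. fourier_coeff f n = 0"
  shows "L2_norm (maximal_function f) = 0"
  using assms by (simp add: L2_norm_def maximal_function_def modulus_def schroedinger_def ennreal_sqrt_def)

lemma card_le_disc:
  assumes "S \<subseteq> {n. norm (freq n) \<le> r}" "r \<ge> 0"
  shows "finite S" "real (card S) \<le> (2 * r + 1)\<^sup>2"
proof -
  let ?I = "{- \<lfloor>r\<rfloor>..\<lfloor>r\<rfloor>}"
  have sub: "S \<subseteq> ?I \<times> ?I"
  proof (rule subsetI)
    fix n assume "n \<in> S"
    then have n: "norm (freq n) \<le> r" using assms(1) by blast
    have "\<bar>of_int (fst n)\<bar> \<le> r" "\<bar>of_int (snd n)\<bar> \<le> r"
      using n norm_fst_le[of "real_of_int (fst n)" "real_of_int (snd n)"]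
        norm_snd_le[of "real_of_int (snd n)" "real_of_int (fst n)"] by (simp_all add: freq_def del: of_int_abs)
    then show "n \<in> ?I \<times> ?I" by (cases n) (auto simp: le_floor_iff abs_le_iff minus_le_iff)
  qed
  then show "finite S" by (rule finite_subset) simp
  have "real (card S) \<le> real (card (?I \<times> ?I))" using card_mono[OF _ sub] by (intro of_nat_mono) simp
  also have "\<dots> = (real (card ?I))\<^sup>2" by (simp add: card_cartesian_product power2_eq_square)
  also have "\<dots> \<le> (2 * r + 1)\<^sup>2"
    using assms(2) by (intro power_mono) (auto simp: of_nat_nat)
  finally show "real (card S) \<le> (2 * r + 1)\<^sup>2" .
qed

text \<open>By \<open>card_le_disc\<close> there are at most \<open>(4 * N + 1)\<^sup>2\<close>
  frequencies, so \<open>m\<close> dyadic levels of rank suffice; this is where the logarithm of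
  \<open>N\<close> originates.\<close>

lemma level_number:
  assumes N: "N \<ge> (2::real)"
  obtains m :: nat where "(4 * N + 1)\<^sup>2 < 2 ^ m" "real m \<le> 10 * ln (2 + N)" "real m \<ge> 1"
proof -
  let ?l = "log 2 ((4 * N + 1)\<^sup>2)"
  define m where "m = nat \<lceil>?l\<rceil> + 1"
  have l0: "?l \<ge> 0" using N by (subst zero_le_log_cancel_iff) (auto intro!: one_le_power)
  have "?l < m" using l0 unfolding m_def by linarith
  then have "(4 * N + 1)\<^sup>2 < 2 powr m" using N by (subst (asm) log_less_iff) auto
  then have 1: "(4 * N + 1)\<^sup>2 < 2 ^ m" by (simp add: powr_realpow)
  have "real m \<le> ?l + 2" using l0 unfolding m_def by linarith
  also have "\<dots> = log 2 (4 * (4 * N + 1)\<^sup>2)" 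
  proof -
    have "log 2 4 = (2::real)" using log_pow_cancel[of 2 2] by simp
    then show ?thesis using N by (simp add: log_mult)
  qed
  also have "\<dots> \<le> log 2 ((2 + N) ^ 5)"
  proof -
    have "4 * N + 1 \<le> (2 + N)\<^sup>2" by (simp add: power2_eq_square algebra_simps)
    then have "(4 * N + 1)\<^sup>2 \<le> ((2 + N)\<^sup>2)\<^sup>2" using N by (intro power_mono) auto
    then have "4 * (4 * N + 1)\<^sup>2 \<le> (2 + N) * ((2 + N)\<^sup>2)\<^sup>2" using N by (intro mult_mono) auto
    also have "\<dots> = (2 + N) ^ 5" by (simp add: power_mult[symmetric] power_Suc[symmetric] del: power_Suc)
    finally show ?thesis using N by (subst log_le_cancel_iff) auto
  qed
  also have "\<dots> = 5 * ln (2 + N) / ln 2" using N by (simp add: log_def ln_realpow)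
  also have "\<dots> \<le> 10 * ln (2 + N)"
    using ln2_ge_two_thirds N by (simp add: field_simps)
  finally have "real m \<le> 10 * ln (2 + N)" .
  with 1 show thesis by (rule that) (simp add: m_def)
qed

theorem maximal_estimate:
  "\<exists>C::real. \<forall>N::real. N \<ge> 2 \<longrightarrow> (\<forall>f \<in> trig_polys_on {n. norm (freq n) \<le> 2 * N}.
     L2_norm (maximal_function f) \<le> ennreal (C * N powr (1/2) * ln (2 + N) powr (1/4)) * L2_norm (modulus f))"
proof (intro exI allI impI ballI)
  \<comment> \<open>\<open>90 = 9 * 10\<close>: at most \<open>9 * N\<^sup>2\<close> time
    frequencies and at most \<open>10 * ln (2 + N)\<close> levels.\<close>
  let ?K = "90 * (2 + energy_const)"
  fix N :: real and f
  assume N: "N \<ge> 2" and f: "f \<in> trig_polys_on {n. norm (freq n) \<le> 2 * N}"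
  define S where "S = fourier_support f"
  define c where "c = fourier_coeff f"
  have trig: "trig_polynomial f" and sub: "S \<subseteq> {n. norm (freq n) \<le> 2 * N}" using f by (auto simp: trig_polys_on_def S_def)
  have S: "finite S" and fS: "f = (\<lambda>x. \<Sum>n\<in>S. c n * character n x)"
    using trig_polynomial_expansion[OF trig] unfolding S_def c_def by blast+
  have co: "fourier_coeff f n = (if n \<in> S then c n else 0)" for n by (auto simp: S_def c_def fourier_support_def)
  define e where "e = (\<Sum>n\<in>S. (cmod (c n))\<^sup>2)"
  have e0: "e \<ge> 0" by (simp add: e_def sum_nonneg)
  have L2f: "L2_norm (modulus f) = ennreal (sqrt e)" unfolding e_def by (rule L2_norm_modulus[OF S fS])
  show "L2_norm (maximal_function f) \<le> ennreal (?K powr (1/4) * N powr (1/2) * ln (2 + N) powr (1/4)) * L2_norm (modulus f)"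
  proof (cases "e = 0")
    case True
    then have "c n = 0" if "n \<in> S" for n using S that by (simp add: e_def sum_nonneg_eq_0_iff)
    then show ?thesis using co by (subst maximal_function_zero) auto
  next
    case False
    then have e: "e > 0" using e0 by simp
    obtain m :: nat where m: "(4 * N + 1)\<^sup>2 < 2 ^ m" "real m \<le> 10 * ln (2 + N)" "real m \<ge> 1"
      using level_number[OF N] .
    have "real (card S) \<le> (4 * N + 1)\<^sup>2" using card_le_disc(2)[OF sub] N by simp
    from le_less_trans[OF this m(1)] have cS: "card S < 2 ^ m" by simp
    have en: "2 * e\<^sup>2 + corner_energy S (\<lambda>n. cmod (c n)) \<le> (2 + energy_const) * (10 * ln (2 + N)) * e\<^sup>2"
    proof -
      have "corner_energy S (\<lambda>n. cmod (c n)) \<le> energy_const * m * e\<^sup>2"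
        unfolding e_def by (rule corner_energy_le[OF S cS]) simp
      moreover have "2 * e\<^sup>2 \<le> 2 * m * e\<^sup>2" using m(3) by (intro mult_right_mono) auto
      moreover have "(2 + energy_const) * m * e\<^sup>2 \<le> (2 + energy_const) * (10 * ln (2 + N)) * e\<^sup>2"
        using m(2) energy_const_pos by (intro mult_right_mono mult_left_mono) auto
      ultimately show ?thesis by (simp add: algebra_simps)
    qed
    have cT: "real (card (key_energies S)) \<le> 9 * N\<^sup>2"
    proof -
      have nb: "0 \<le> nsq n \<and> real_of_int (nsq n) \<le> 4 * N\<^sup>2" if "n \<in> S" for n
      proof -
        have "norm (freq n) \<le> 2 * N" using sub that by blast
        then have "(norm (freq n))\<^sup>2 \<le> (2 * N)\<^sup>2" by (intro power_mono) auto
        then show ?thesis by (simp add: norm_freq nsq_def power_mult_distrib)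
      qed
      have "key_energies S \<subseteq> {0..\<lfloor>8 * N\<^sup>2\<rfloor>}"
      proof (rule subsetI)
        fix k assume "k \<in> key_energies S"
        then obtain n m where p: "n \<in> S" "m \<in> S" "k = nsq n + nsq m"
          by (rule key_energiesE[OF S])
        then show "k \<in> {0..\<lfloor>8 * N\<^sup>2\<rfloor>}" using nb[OF p(1)] nb[OF p(2)] by (simp add: le_floor_iff)
      qed
      from card_mono[OF finite_atLeastAtMost_int this]
      have "real (card (key_energies S)) \<le> real (card {0..\<lfloor>8 * N\<^sup>2\<rfloor>})" by (rule of_nat_mono)
      also have "\<dots> \<le> 8 * N\<^sup>2 + 1" by (simp add: of_nat_nat)
      finally show ?thesis using one_le_power[of N 2] N by linarith
    qed
    let ?L = "ln (2 + N)"
    have L: "?L > 0" using N by simp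
    have pos: "(9 * N\<^sup>2) * ((2 + energy_const) * (10 * ?L) * e\<^sup>2) > 0"
      using N e L energy_const_pos by (intro mult_pos_pos) auto
    have "L2_norm (maximal_function f) \<le> ennreal (sqrt (sqrt ((9 * N\<^sup>2) * ((2 + energy_const) * (10 * ?L) * e\<^sup>2))))"
      by (rule L2_norm_maximal_le[OF S co cT _ pos]) (use en in \<open>simp only: e_def\<close>)
    also have "sqrt (sqrt ((9 * N\<^sup>2) * ((2 + energy_const) * (10 * ?L) * e\<^sup>2))) = ?K powr (1/4) * N powr (1/2) * ?L powr (1/4) * sqrt e"
    proof -
      have "?K > 0" using energy_const_pos by simp
      then have K: "sqrt (sqrt ?K) = ?K powr (1/4)" by (simp add: powr_half_sqrt[symmetric] powr_powr)
      have "sqrt (sqrt ?L) = ?L powr (1/4)" using L by (simp add: powr_half_sqrt[symmetric] powr_powr)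
      moreover have "sqrt (sqrt (N\<^sup>2)) = N powr (1/2)" using N by (simp add: powr_half_sqrt)
      moreover have "sqrt (sqrt (e\<^sup>2)) = sqrt e" using e by simp
      moreover have "(9 * N\<^sup>2) * ((2 + energy_const) * (10 * ?L) * e\<^sup>2) = ?K * N\<^sup>2 * ?L * e\<^sup>2" by simp
      ultimately show ?thesis using K by (simp only: real_sqrt_mult)
    qed
    finally show ?thesis unfolding L2f using e by (simp add: ennreal_mult'' mult.assoc)
  qed
qed

section \<open>The lower bound\<close>

text \<open>A supremum of continuous functions is lower semicontinuous, which gives measurability
  with an uncountable set of times.\<close>

lemma open_maximal_superlevel:
  assumes "finite S" "\<And>n. n \<notin> S \<Longrightarrow> fourier_coeff f n = 0" "s \<ge> 0"
  shows "open {x. maximal_function f x > ennreal s}"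
proof -
  let ?u = "\<lambda>t x. \<Sum>n\<in>S. fourier_coeff f n * character n x * cis (- (t * of_int (nsq n)))"
  have "{x. maximal_function f x > ennreal s} = (\<Union>t\<in>{0<..<1}. {x. s < cmod (?u t x)})"
    using assms by (auto simp: maximal_function_def less_SUP_iff modulus_def schroedinger_eq[OF assms(1,2)] ennreal_less_iff)
  moreover have "open {x. s < cmod (?u t x)}" for t
    unfolding character_def by (intro open_Collect_less continuous_intros)
  ultimately show ?thesis by auto
qed

text \<open>The strong norm is bounded from below by integrating over \<open>B\<close> only, the
  weak one by testing the single height \<open>s\<close>.\<close>

lemma maximal_norms_ge:
  assumes S: "finite S" "\<And>n. n \<notin> S \<Longrightarrow> fourier_coeff f n = 0" and s: "s > 0" and m: "m \<ge> 0"
    and B: "B \<in> sets borel" "emeasure torus B \<ge> ennreal m" "\<And>x. x \<in> B \<Longrightarrow> maximal_function f x > ennreal s"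
    and X: "X \<in> {L2_norm, weak_L2_norm}"
  shows "X (maximal_function f) \<ge> ennreal (s * sqrt m)"
proof -
  have mono: "ennreal_sqrt a \<ge> ennreal (sqrt r)" if "a \<ge> ennreal r" "r \<ge> 0" for a r
  proof (cases a)
    case (real q)
    then show ?thesis using that by (simp add: ennreal_sqrt_ennreal ennreal_leI)
  qed (simp add: ennreal_sqrt_def)
  have "L2_norm (maximal_function f) \<ge> ennreal (sqrt (s\<^sup>2 * m))" unfolding L2_norm_def
  proof (rule mono)
    have "ennreal (s\<^sup>2 * m) \<le> ennreal (s\<^sup>2) * emeasure torus B"
      using B(2) m by (simp add: ennreal_mult mult_left_mono)
    also have "\<dots> = (\<integral>\<^sup>+x. ennreal (s\<^sup>2) * indicator B x \<partial>torus)"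
      using B(1) by (simp add: nn_integral_cmult_indicator)
    also have "\<dots> \<le> (\<integral>\<^sup>+x. (maximal_function f x)\<^sup>2 \<partial>torus)"
    proof (rule nn_integral_mono)
      fix x
      have "ennreal (s\<^sup>2) \<le> (maximal_function f x)\<^sup>2" if "x \<in> B"
        using power_mono[OF less_imp_le[OF B(3)[OF that]], of 2] s by (simp add: ennreal_power)
      then show "ennreal (s\<^sup>2) * indicator B x \<le> (maximal_function f x)\<^sup>2" by (auto simp: indicator_def)
    qed
    finally show "ennreal (s\<^sup>2 * m) \<le> (\<integral>\<^sup>+x. (maximal_function f x)\<^sup>2 \<partial>torus)" .
  qed (use m in simp)
  moreover have "sqrt (s\<^sup>2 * m) = s * sqrt m" using s by (simp add: real_sqrt_mult)
  moreover have "weak_L2_norm (maximal_function f) \<ge> ennreal (s * sqrt m)"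
  proof -
    let ?A = "{x. maximal_function f x > ennreal s}"
    \<comment> \<open>a non-measurable set would have \<open>emeasure\<close> zero\<close>
    have "?A \<in> sets torus" using borel_open[OF open_maximal_superlevel[OF S]] s by simp
    then have "emeasure torus B \<le> emeasure torus ?A" using B(3) by (intro emeasure_mono) auto
    then have "ennreal (sqrt m) \<le> ennreal_sqrt (emeasure torus ?A)" using B(2) m by (intro mono) auto
    then have "ennreal (s * sqrt m) \<le> ennreal s * ennreal_sqrt (emeasure torus ?A)"
      using s m by (simp add: ennreal_mult mult_left_mono)
    also have "\<dots> \<le> weak_L2_norm (maximal_function f)"
      unfolding weak_L2_norm_def using s by (intro SUP_upper) auto
    finally show ?thesis .
  qed
  ultimately show ?thesis using X by auto
qed

section \<open>A test function built on a square root of -1\<close>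

context
  fixes j :: int
  assumes j: "j \<ge> 2"
begin

definition conductor :: int where "conductor = 4 * j\<^sup>2 + 1"
text \<open>The first coordinate runs from \<open>conductor\<close> to at most 3/2 of it and the
  second stays below \<open>conductor\<close>, so the length is at most the root of 13/4 times
  \<open>conductor\<close>, which keeps the whole set in the required annulus.\<close>

definition spectrum :: "(int \<times> int) set" where
  "spectrum = (\<lambda>n. (n, (2 * j * n + 1) mod conductor)) ` {conductor..conductor + 2 * j\<^sup>2}"

lemma conductor_ge: "conductor \<ge> 17"
  using power_mono[of 2 j 2] j by (simp add: conductor_def)

lemma finite_spectrum: "finite spectrum"
  by (simp add: spectrum_def)

lemma card_spectrum: "real (card spectrum) \<ge> of_int conductor / 2" "card spectrum > 0"
proof -
  have "card spectrum = card {conductor..conductor + 2 * j\<^sup>2}"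
    unfolding spectrum_def by (rule card_image) (simp add: inj_on_def)
  then have "int (card spectrum) = 2 * j\<^sup>2 + 1" by simp
  then have "real (card spectrum) = 2 * (of_int j)\<^sup>2 + 1"
    by (metis of_int_1 of_int_add of_int_mult of_int_numeral of_int_of_nat_eq of_int_power)
  then show "real (card spectrum) \<ge> of_int conductor / 2" by (simp add: conductor_def)
  have "int (card spectrum) > 0" unfolding \<open>int (card spectrum) = _\<close> using zero_le_power2[of j] by linarith
  then show "card spectrum > 0" by simp
qed

lemma spectrum_bounds:
  assumes "n \<in> spectrum"
  shows "conductor \<le> fst n" "2 * fst n \<le> 3 * conductor" "0 \<le> snd n" "snd n \<le> conductor"
proof -
  obtain m where m: "n = (m, (2 * j * m + 1) mod conductor)" "conductor \<le> m" "m \<le> conductor + 2 * j\<^sup>2"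
    using assms by (auto simp: spectrum_def)
  then show "conductor \<le> fst n" "2 * fst n \<le> 3 * conductor" by (simp_all add: conductor_def)
  have "conductor > 0" using conductor_ge by simp
  then show "0 \<le> snd n" "snd n \<le> conductor" using pos_mod_bound[of conductor] m by (simp_all add: less_imp_le)
qed

lemma spectrum_norm:
  assumes "n \<in> spectrum"
  shows "of_int conductor \<le> norm (freq n)" "norm (freq n) \<le> 2 * of_int conductor"
proof -
  note b = spectrum_bounds[OF assms]
  have p: "real_of_int conductor \<ge> 0" using conductor_ge by simp
  have "conductor\<^sup>2 \<le> (fst n)\<^sup>2" using b conductor_ge by (intro power_mono) auto
  then have "conductor\<^sup>2 \<le> nsq n" by (simp add: nsq_def add_increasing2)
  then have "(real_of_int conductor)\<^sup>2 \<le> (norm (freq n))\<^sup>2"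
    unfolding norm_freq by (metis of_int_le_iff of_int_power)
  then show "of_int conductor \<le> norm (freq n)" by (rule power2_le_imp_le) simp
  have "(2 * fst n)\<^sup>2 \<le> (3 * conductor)\<^sup>2" "(snd n)\<^sup>2 \<le> conductor\<^sup>2"
    by (rule power_mono; use b conductor_ge in linarith)+
  then have "4 * (fst n)\<^sup>2 \<le> 9 * conductor\<^sup>2" "(snd n)\<^sup>2 \<le> conductor\<^sup>2" by (simp_all add: power_mult_distrib)
  then have "nsq n \<le> 4 * conductor\<^sup>2" unfolding nsq_def using zero_le_power2[of conductor] by linarith
  then have "real_of_int (nsq n) \<le> of_int (4 * conductor\<^sup>2)" by (simp only: of_int_le_iff)
  then have "(norm (freq n))\<^sup>2 \<le> (2 * real_of_int conductor)\<^sup>2" by (simp add: norm_freq power_mult_distrib)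
  then show "norm (freq n) \<le> 2 * of_int conductor" by (rule power2_le_imp_le) (use p in simp)
qed

text \<open>Modulo \<open>conductor\<close>, the number b1 n1 + b2 n2 - a |n|^2 equals (b1 + 2 j b2
  - 4 j a) n1 + b2 - a, because 1 + 4 j^2 vanishes. The divisibility removes the dependence on
  \<open>n\<close>, and \<open>q\<close> below is the explicit quotient.\<close>

lemma aligned_phase:
  assumes n: "n \<in> spectrum" and b: "conductor dvd b1 + 2 * j * b2 - 4 * j * a"
  shows "character n (2 * pi * of_int b1 / of_int conductor + d1, 2 * pi * of_int b2 / of_int conductor + d2)
      * cis (- (2 * pi * of_int a / of_int conductor * of_int (nsq n)))
    = cis (2 * pi * of_int (b2 - a) / of_int conductor) * cis (of_int (fst n) * d1 + of_int (snd n) * d2)"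
proof -
  obtain n1 n2 where nn: "n = (n1, n2)" by (rule prod.exhaust)
  define r where "r = - ((2 * j * n1 + 1) div conductor)"
  have n2: "n2 = 2 * j * n1 + 1 + conductor * r"
  proof -
    have "n2 = (2 * j * n1 + 1) mod conductor" using n by (auto simp: spectrum_def nn)
    then show ?thesis by (simp add: r_def minus_mult_div_eq_mod[symmetric])
  qed
  obtain s where s: "b1 + 2 * j * b2 - 4 * j * a = conductor * s" using b by (rule dvdE)
  then have b1: "b1 = 4 * j * a - 2 * j * b2 + conductor * s" by simp
  define q where "q = s * n1 + r * b2 - a * n1\<^sup>2 - a * r * (2 * (2 * j * n1 + 1) + conductor * r)"
  have "b1 * n1 + b2 * n2 - a * nsq n = b2 - a + conductor * q"
    unfolding nsq_def nn fst_conv snd_conv n2 b1 q_def conductor_def by (simp add: power2_eq_square algebra_simps)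
  then have q: "real_of_int b1 * n1 + real_of_int b2 * n2 - real_of_int a * nsq n = of_int (b2 - a) + of_int conductor * of_int q"
    by (metis of_int_add of_int_diff of_int_mult)
  let ?p = "real_of_int conductor"
  have p: "?p > 0" using conductor_ge by simp
  have "2 * pi * of_int b1 / ?p * of_int n1 + 2 * pi * of_int b2 / ?p * of_int n2 - 2 * pi * of_int a / ?p * of_int (nsq n)
      = 2 * pi / ?p * (real_of_int b1 * n1 + real_of_int b2 * n2 - real_of_int a * nsq n)"
    by (simp add: algebra_simps add_divide_distrib diff_divide_distrib)
  also have "\<dots> = 2 * pi * of_int (b2 - a) / ?p + 2 * pi * of_int q"
    unfolding q using p by (simp add: field_simps)
  finally have ang: "freq n \<bullet> (2 * pi * of_int b1 / ?p + d1, 2 * pi * of_int b2 / ?p + d2) + - (2 * pi * of_int a / ?p * of_int (nsq n))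
      = (2 * pi * of_int (b2 - a) / ?p + (of_int n1 * d1 + of_int n2 * d2)) + 2 * pi * of_int q"
    by (simp add: freq_def nn inner_prod_def algebra_simps)
  have "cis (2 * pi * of_int q) = 1" by (rule cis_multiple_2pi) simp
  then show ?thesis unfolding character_def cis_mult ang unfolding cis_mult[symmetric] by (simp add: nn)
qed

definition test_function :: "real \<times> real \<Rightarrow> complex" where
  "test_function x = (\<Sum>n\<in>spectrum. 1 * character n x)"

lemma coeff_test_function: "fourier_coeff test_function n = (if n \<in> spectrum then 1 else 0)"
  unfolding test_function_def[abs_def] by (rule fourier_coeff_sum[OF finite_spectrum])

lemma test_function_mem:
  "test_function \<in> trig_polys_on {n. of_int conductor \<le> norm (freq n) \<and> norm (freq n) \<le> 2 * of_int conductor} - {\<lambda>_. 0}"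
proof -
  have "trig_polynomial test_function"
    unfolding trig_polynomial_def test_function_def[abs_def] character_def
    by (intro exI[of _ spectrum] exI[of _ "\<lambda>_. 1"]) (simp add: finite_spectrum)
  moreover have "fourier_support test_function = spectrum" by (auto simp: fourier_support_def coeff_test_function)
  moreover have "test_function \<noteq> (\<lambda>_. 0)"
  proof
    obtain n where n: "n \<in> spectrum" using card_spectrum(2) unfolding card_gt_0_iff by blast
    assume "test_function = (\<lambda>_. 0)"
    then have "fourier_coeff test_function n = 0" by (simp add: fourier_coeff_def)
    with n show False by (simp add: coeff_test_function)
  qed
  ultimately show ?thesis using spectrum_norm by (auto simp: trig_polys_on_def)
qed

text \<open>The side of the square makes the phase error at most (3/2 + 1) * 2/5 = 1, which is below
  \<open>pi / 3\<close>, so every term has real part at least 1/2; the 4 in place of 2 gives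
  strictness. The bound on \<open>a\<close> puts the time below 1, since 2 pi < 8.\<close>

lemma test_function_large:
  assumes a: "a > 0" "8 * a \<le> conductor" and b: "conductor dvd b1 + 2 * j * b2 - 4 * j * a"
    and d: "0 \<le> d1" "d1 \<le> 2 / (5 * of_int conductor)" "0 \<le> d2" "d2 \<le> 2 / (5 * of_int conductor)"
  shows "maximal_function test_function (2 * pi * of_int b1 / of_int conductor + d1, 2 * pi * of_int b2 / of_int conductor + d2)
    > ennreal (card spectrum / 4)"
proof -
  let ?p = "real_of_int conductor"
  let ?x = "(2 * pi * of_int b1 / ?p + d1, 2 * pi * of_int b2 / ?p + d2)"
  have p: "?p > 0" using conductor_ge by simp
  define t where "t = 2 * pi * of_int a / ?p"
  have "8 * real_of_int a \<le> ?p" using a(2) by (metis of_int_le_iff of_int_mult of_int_numeral)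
  then have "2 * pi * of_int a < ?p"
    using mult_strict_right_mono[OF pi_less_4, of "real_of_int a"] a(1) unfolding mult.assoc by linarith
  then have t: "t \<in> {0<..<1}" using p a(1) by (simp add: t_def)
  let ?e = "\<lambda>n. of_int (fst n) * d1 + of_int (snd n) * d2"
  have u: "schroedinger t test_function ?x = cis (2 * pi * of_int (b2 - a) / ?p) * (\<Sum>n\<in>spectrum. cis (?e n))"
  proof -
    have "schroedinger t test_function ?x = (\<Sum>n\<in>spectrum. fourier_coeff test_function n * character n ?x * cis (- (t * of_int (nsq n))))"
      by (rule schroedinger_eq[OF finite_spectrum]) (simp add: coeff_test_function)
    also have "\<dots> = (\<Sum>n\<in>spectrum. cis (2 * pi * of_int (b2 - a) / ?p) * cis (?e n))"
    proof (rule sum.cong[OF refl])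
      fix n assume n: "n \<in> spectrum"
      show "fourier_coeff test_function n * character n ?x * cis (- (t * of_int (nsq n)))
          = cis (2 * pi * of_int (b2 - a) / ?p) * cis (?e n)"
        using aligned_phase[OF n b] by (simp only: coeff_test_function n if_True mult_1 t_def)
    qed
    finally show ?thesis by (simp add: sum_distrib_left)
  qed
  have cos: "1 / 2 \<le> cos (?e n)" if "n \<in> spectrum" for n
  proof -
    note sb = spectrum_bounds[OF that]
    have r: "0 \<le> real_of_int (fst n)" "2 * real_of_int (fst n) \<le> 3 * ?p" "0 \<le> real_of_int (snd n)" "real_of_int (snd n) \<le> ?p"
      using sb conductor_ge by linarith+
    have "?e n \<le> (3 / 2 * ?p) * (2 / (5 * ?p)) + ?p * (2 / (5 * ?p))"
      using r d p by (intro add_mono mult_mono) auto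
    also have "\<dots> = 1" using p by simp
    finally have "?e n \<le> 1" .
    moreover have "0 \<le> ?e n" using r d by simp
    moreover have "1 \<le> pi / 3" using pi_gt3 by simp
    ultimately have "cos (pi / 3) \<le> cos (?e n)" by (intro cos_monotone_0_pi_le) auto
    then show ?thesis by (simp add: cos_60)
  qed
  have "real (card spectrum) / 2 = (\<Sum>n\<in>spectrum. 1 / 2)" by simp
  also have "\<dots> \<le> (\<Sum>n\<in>spectrum. cos (?e n))" by (rule sum_mono) (rule cos)
  also have "\<dots> = Re (\<Sum>n\<in>spectrum. cis (?e n))" by simp
  also have "\<dots> \<le> cmod (\<Sum>n\<in>spectrum. cis (?e n))" by (rule complex_Re_le_cmod)
  also have "\<dots> = cmod (schroedinger t test_function ?x)" by (simp add: u norm_mult)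
  finally have "real (card spectrum) / 4 < cmod (schroedinger t test_function ?x)" using card_spectrum(2) by simp
  then have "ennreal (card spectrum / 4) < modulus (schroedinger t test_function) ?x"
    by (simp add: modulus_def ennreal_less_iff)
  also have "\<dots> \<le> maximal_function test_function ?x"
    unfolding maximal_function_def using t by (intro SUP_upper)
  finally show ?thesis .
qed

text \<open>The solution \<open>b1\<close> of the congruence in \<open>aligned_phase\<close> for
  given \<open>a\<close> and \<open>b2 = b\<close>: each time has one aligned grid point per
  row.\<close>

definition anchor :: "int \<Rightarrow> int \<Rightarrow> int" where "anchor a b = (4 * j * a - 2 * j * b) mod conductor"
definition cell :: "int \<times> int \<Rightarrow> (real \<times> real) set" where
  "cell ab = (let h = 2 / (5 * of_int conductor); x = 2 * pi * of_int (anchor (fst ab) (snd ab)) / of_int conductor; y = 2 * pi * of_int (snd ab) / of_int conductor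
     in {x..<x + h} \<times> {y..<y + h})"
definition cells :: "(int \<times> int) set" where "cells = {1..conductor div 8} \<times> {0..<conductor}"

lemma anchor_inj:
  assumes "anchor a b = anchor a' b" "a \<in> {1..conductor div 8}" "a' \<in> {1..conductor div 8}"
  shows "a = a'"
proof -
  have "conductor dvd (4 * j * a - 2 * j * b) - (4 * j * a' - 2 * j * b)"
    using assms(1) unfolding anchor_def by (simp add: mod_eq_dvd_iff)
  \<comment> \<open>Multiplication by \<open>j\<close> inverts \<open>4 * j\<close> up to sign,
    because \<open>4 * j\<^sup>2\<close> is -1 modulo \<open>conductor\<close>.\<close>
  then have "conductor dvd j * ((4 * j * a - 2 * j * b) - (4 * j * a' - 2 * j * b))" by (rule dvd_mult)
  moreover have "j * ((4 * j * a - 2 * j * b) - (4 * j * a' - 2 * j * b)) = conductor * (a - a') - (a - a')"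
    by (simp add: conductor_def power2_eq_square algebra_simps)
  ultimately have "conductor dvd a - a'" by (simp add: dvd_diff_right_iff)
  then show ?thesis using assms(2,3) conductor_ge zdvd_imp_le[of conductor "a - a'"] zdvd_imp_le[of conductor "a' - a"]
    by (cases a a' rule: linorder_cases) (auto simp: dvd_diff_commute)
qed

text \<open>The grid has spacing \<open>2 * pi / conductor\<close>, larger than the side of a cell,
  so a common point forces the same grid point, and \<open>anchor_inj\<close> recovers the
  time.\<close>

lemma cell_disjoint:
  assumes "ab \<in> cells" "ab' \<in> cells" "z \<in> cell ab" "z \<in> cell ab'"
  shows "ab = ab'"
proof -
  let ?p = "real_of_int conductor"
  have p: "?p > 0" using conductor_ge by simp
  have same: "k = k'" if "2 * pi * of_int k / ?p \<le> w" "w < 2 * pi * of_int k / ?p + 2 / (5 * ?p)"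
    "2 * pi * of_int k' / ?p \<le> w" "w < 2 * pi * of_int k' / ?p + 2 / (5 * ?p)" for k k' :: int and w
  proof -
    have *: "l \<le> l'" if "2 * pi * of_int l / ?p < 2 * pi * of_int l' / ?p + 2 / (5 * ?p)" for l l' :: int
    proof (rule ccontr)
      assume "\<not> l \<le> l'"
      then have "real_of_int l \<ge> of_int l' + 1" by linarith
      then have "2 * pi * real_of_int l \<ge> 2 * pi * (of_int l' + 1)" by (intro mult_left_mono) auto
      moreover have "2 * pi * of_int l < 2 * pi * of_int l' + 2 / 5" using that p by (simp add: field_simps)
      ultimately show False using pi_gt3 by (simp add: algebra_simps)
    qed
    show ?thesis using *[of k k'] *[of k' k] that by simp
  qed
  obtain a b a' b' where ab: "ab = (a, b)" "ab' = (a', b')" by (metis surj_pair)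
  obtain z1 z2 where z: "z = (z1, z2)" by (rule prod.exhaust)
  have "anchor a b = anchor a' b'"
    by (rule same[of _ z1]) (use assms(3,4) in \<open>auto simp: cell_def Let_def ab z\<close>)
  moreover have "b = b'"
    by (rule same[of _ z2]) (use assms(3,4) in \<open>auto simp: cell_def Let_def ab z\<close>)
  ultimately show ?thesis using anchor_inj[of a b a'] assms(1,2) by (auto simp: cells_def ab)
qed

lemma cell_subset:
  assumes "ab \<in> cells"
  shows "cell ab \<subseteq> torus_box"
proof -
  let ?p = "real_of_int conductor"
  have p: "?p > 0" using conductor_ge by simp
  have *: "0 \<le> 2 * pi * of_int k / ?p \<and> 2 * pi * of_int k / ?p + 2 / (5 * ?p) \<le> 2 * pi" if "0 \<le> k" "k < conductor" for k :: int
  proof -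
    have "real_of_int k + 1 \<le> ?p" using that by linarith
    then have "2 * pi * (real_of_int k + 1) \<le> 2 * pi * ?p" by (intro mult_left_mono) auto
    then have "2 * pi * of_int k + 2 / 5 \<le> 2 * pi * ?p" using pi_gt3 by (simp add: algebra_simps)
    then show ?thesis using that p by (simp add: field_simps)
  qed
  have "0 \<le> anchor a b" "anchor a b < conductor" for a b using conductor_ge by (simp_all add: anchor_def)
  then have 1: "0 \<le> 2 * pi * of_int (anchor (fst ab) (snd ab)) / ?p \<and> 2 * pi * of_int (anchor (fst ab) (snd ab)) / ?p + 2 / (5 * ?p) \<le> 2 * pi"
    by (intro *)
  have 2: "0 \<le> 2 * pi * of_int (snd ab) / ?p \<and> 2 * pi * of_int (snd ab) / ?p + 2 / (5 * ?p) \<le> 2 * pi"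
    using assms by (intro *) (auto simp: cells_def)
  show ?thesis unfolding cell_def Let_def
    by (rule Sigma_mono; rule subsetI; use 1 2 in \<open>simp only: atLeastLessThan_iff; linarith\<close>)
qed

lemma cell_sets: "cell ab \<in> sets borel"
proof -
  have "cell ab \<in> sets (borel \<Otimes>\<^sub>M borel)" by (simp add: cell_def Let_def)
  then show ?thesis unfolding borel_prod .
qed

text \<open>At least \<open>conductor\<^sup>2 / 16\<close> disjoint squares of side
  \<open>2 / (5 * conductor)\<close> have area at least 1/100, and the normalization
  \<open>4 * pi\<^sup>2\<close> is at most 64.\<close>

lemma emeasure_cells: "emeasure torus (\<Union>(cell ` cells)) \<ge> ennreal (1 / 6400)"
proof -
  let ?p = "real_of_int conductor" let ?h = "2 / (5 * ?p)"
  have p: "?p \<ge> 17" using conductor_ge by simp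
  have fin: "finite cells" by (simp add: cells_def)
  have disj: "disjoint_family_on cell cells" using cell_disjoint by (auto simp: disjoint_family_on_def)
  have "emeasure lborel (\<Union>(cell ` cells)) = (\<Sum>ab\<in>cells. emeasure lborel (cell ab))"
    by (rule sum_emeasure[OF _ disj fin, symmetric]) (auto simp: cell_sets)
  also have "\<dots> = (\<Sum>ab\<in>cells. ennreal (?h * ?h))"
    unfolding cell_def Let_def using p by (intro sum.cong refl emeasure_rectangle) auto
  also have "\<dots> = ennreal (real (card cells) * (?h * ?h))"
    by (simp add: ennreal_of_nat_eq_real_of_nat ennreal_mult[symmetric])
  finally have lb: "emeasure lborel (\<Union>(cell ` cells)) = ennreal (real (card cells) * (?h * ?h))" .
  have "real (card cells) = of_int (conductor div 8) * ?p"
    using conductor_ge by (simp add: cells_def card_cartesian_product of_nat_nat)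
  moreover have "of_int (conductor div 8) \<ge> ?p / 16" using conductor_ge by linarith
  ultimately have c: "real (card cells) \<ge> ?p / 16 * ?p" using p by (simp add: mult_right_mono)
  have "1 / 100 = ?p / 16 * ?p * (?h * ?h)" using p by (simp add: field_simps)
  also have "\<dots> \<le> real (card cells) * (?h * ?h)" using c by (intro mult_right_mono) auto
  finally have v: "1 / 100 \<le> real (card cells) * (?h * ?h)" .
  have pi2: "4 * pi\<^sup>2 \<le> 64" using power_mono[of pi 4 2] pi_less_4 by simp
  have "1 / 6400 \<le> (1 / 100) / (4 * pi\<^sup>2)" using pi2 by (simp add: field_simps)
  also have "\<dots> \<le> real (card cells) * (?h * ?h) / (4 * pi\<^sup>2)" using v by (intro divide_right_mono) auto
  finally have "ennreal (1 / 6400) \<le> ennreal (real (card cells) * (?h * ?h) / (4 * pi\<^sup>2))" by (rule ennreal_leI)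
  also have "\<dots> = emeasure torus (\<Union>(cell ` cells))"
  proof -
    have "\<Union>(cell ` cells) \<in> sets borel" using fin cell_sets by (intro sets.finite_UN) auto
    moreover have "\<Union>(cell ` cells) \<subseteq> torus_box" by (rule UN_least) (rule cell_subset)
    ultimately show ?thesis by (simp add: emeasure_torus lb divide_ennreal)
  qed
  finally show ?thesis .
qed

lemma test_function_ratio:
  assumes X: "X \<in> {L2_norm, weak_L2_norm}"
  shows "X (maximal_function test_function) / L2_norm (modulus test_function) \<ge> ennreal (1 / 640 * of_int conductor powr (1/2))"
proof -
  let ?c = "real (card spectrum)"
  have c: "?c > 0" using card_spectrum(2) by simp
  have "maximal_function test_function z > ennreal (?c / 4)" if "z \<in> \<Union>(cell ` cells)" for z
  proof -
    obtain q where q: "q \<in> cells" "z \<in> cell q" using \<open>z \<in> \<Union>(cell ` cells)\<close> by blast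
    obtain a b where "q = (a, b)" by (rule prod.exhaust)
    with q have ab: "(a, b) \<in> cells" "z \<in> cell (a, b)" by simp_all
    let ?x = "2 * pi * of_int (anchor a b) / of_int conductor" and ?y = "2 * pi * of_int b / of_int conductor"
    have z: "z = (?x + (fst z - ?x), ?y + (snd z - ?y))" by simp
    have "conductor dvd anchor a b - (4 * j * a - 2 * j * b)" unfolding anchor_def by (simp add: mod_eq_dvd_iff[symmetric])
    then have "conductor dvd anchor a b + 2 * j * b - 4 * j * a" by (simp add: algebra_simps)
    then show ?thesis
      by (subst z, intro test_function_large) (use ab in \<open>auto simp: cells_def cell_def Let_def\<close>)
  qed
  moreover have "\<Union>(cell ` cells) \<in> sets borel" using cell_sets by (auto simp: cells_def)
  ultimately have "X (maximal_function test_function) \<ge> ennreal (?c / 4 * sqrt (1 / 6400))"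
    using c emeasure_cells X by (intro maximal_norms_ge[OF finite_spectrum]) (auto simp: coeff_test_function)
  moreover have "sqrt (1 / 6400) = 1 / (80::real)" by (rule real_sqrt_unique) (simp_all add: power2_eq_square)
  ultimately have num: "X (maximal_function test_function) \<ge> ennreal (?c / 320)" by simp
  have den: "L2_norm (modulus test_function) = ennreal (sqrt ?c)"
    using L2_norm_modulus[OF finite_spectrum, of test_function "\<lambda>_. 1"] by (simp add: test_function_def fun_eq_iff)
  have "1 / 640 * of_int conductor powr (1/2) \<le> ?c / 320 / sqrt ?c"
  proof -
    \<comment> \<open>The ratio of the norms is at least \<open>sqrt ?c / 320\<close>; the factor 4
      here, weaker than what \<open>card_spectrum\<close> offers, has a rational square root and
      turns 320 into 640.\<close>
    have "of_int conductor \<le> 4 * ?c" using card_spectrum(1) c by simp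
    then have "sqrt (of_int conductor) \<le> sqrt (4 * ?c)" by (rule real_sqrt_le_mono)
    then have "sqrt (of_int conductor) \<le> 2 * sqrt ?c" by (simp add: real_sqrt_mult)
    moreover have "?c / 320 / sqrt ?c = sqrt ?c / 320" using c by (simp add: real_div_sqrt field_simps)
    ultimately show ?thesis using conductor_ge by (simp add: powr_half_sqrt)
  qed
  then have "ennreal (1 / 640 * of_int conductor powr (1/2)) \<le> ennreal (?c / 320) / ennreal (sqrt ?c)"
    using c by (simp add: divide_ennreal ennreal_leI)
  also have "\<dots> \<le> X (maximal_function test_function) / L2_norm (modulus test_function)"
    unfolding den by (rule divide_right_mono_ennreal[OF num])
  finally show ?thesis .
qed

end

theorem maximal_lower_bound:
  "\<exists>c::real. \<exists>N :: nat \<Rightarrow> nat. c > 0 \<and> \<not> bdd_above (range N) \<and>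
     (\<forall>k. N k \<ge> 2 \<and> (\<forall>X \<in> {L2_norm, weak_L2_norm}.
        (SUP f \<in> trig_polys_on {n. real (N k) \<le> norm (freq n) \<and> norm (freq n) \<le> 2 * real (N k)} - {\<lambda>_. 0}.
           X (maximal_function f) / L2_norm (modulus f)) \<ge> ennreal (c * real (N k) powr (1/2))))"
proof (intro exI conjI allI ballI)
  let ?N = "\<lambda>k::nat. 4 * (k + 2)\<^sup>2 + 1"
  show "(1 / 640 :: real) > 0" by simp
  show "\<not> bdd_above (range ?N)"
  proof
    assume "bdd_above (range ?N)"
    then obtain M where M: "?N k \<le> M" for k by (auto simp: bdd_above_def)
    have "M < ?N M" by (simp add: power2_eq_square)
    with M[of M] show False by simp
  qed
  fix k
  show "?N k \<ge> 2" by (simp add: power2_eq_square)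
  fix X assume X: "X \<in> {L2_norm, weak_L2_norm}"
  have j: "int (k + 2) \<ge> 2" by simp
  have p: "real_of_int (conductor (int (k + 2))) = real (?N k)" unfolding conductor_def[OF j] by simp
  show "ennreal (1 / 640 * real (?N k) powr (1/2))
      \<le> (SUP f \<in> trig_polys_on {n. real (?N k) \<le> norm (freq n) \<and> norm (freq n) \<le> 2 * real (?N k)} - {\<lambda>_. 0}.
           X (maximal_function f) / L2_norm (modulus f))"
    by (rule SUP_upper2[where f = "\<lambda>f. X (maximal_function f) / L2_norm (modulus f)",
      OF test_function_mem[OF j, unfolded p] test_function_ratio[OF j X, unfolded p]])
qed

theorem proposition4p1:
  shows "(\<exists>C::real. \<forall>N::real. N \<ge> 2 \<longrightarrow>
            (\<forall>f \<in> trig_polys_on {n. norm (freq n) \<le> 2 * N}.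
               L2_norm (maximal_function f)
                 \<le> ennreal (C * N powr (1/2) * ln (2 + N) powr (1/4)) * L2_norm (modulus f)))
       \<and> (\<exists>c::real. \<exists>N :: nat \<Rightarrow> nat. c > 0 \<and> \<not> bdd_above (range N) \<and>
            (\<forall>k. N k \<ge> 2 \<and>
               (\<forall>X \<in> {L2_norm, weak_L2_norm}.
                  (SUP f \<in> trig_polys_on {n. real (N k) \<le> norm (freq n) \<and> norm (freq n) \<le> 2 * real (N k)} - {\<lambda>_. 0}.
                     X (maximal_function f) / L2_norm (modulus f))
                    \<ge> ennreal (c * real (N k) powr (1/2)))))"
  using maximal_estimate maximal_lower_bound by (rule conjI)

end
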